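(* Let $n\ge 1$, let $M\subset\mathbb{B}_n$ be a subset, let $P=\{f\in L^2_a(\mathbb{B}_n): f|_M=0\}$ and $Q=P^{\perp}$ (orthogonal complement in $L^2_a(\mathbb{B}_n)$). Suppose there exists a positive, finite, regular Borel measure $\mu$ on $M$ and constants $C,c>0$ such that for all $f\in Q$, $$c\|f\|^2\le\int_M|f(w)|^2\,d\mu(w)\le C\|f\|^2,$$ where $\|\cdot\|$ is the norm of $L^2_a(\mathbb{B}_n)$. Then the submodule $P$ is essentially normal.
   Context: $\mathbb{B}_n$ is the open unit ball of $\mathbb{C}^n$, $v_n$ the normalized volume measure on $\mathbb{B}_n$, and $L^2_a(\mathbb{B}_n)$ the Bergman space of holomorphic functions on $\mathbb{B}_n$ square integrable with respect to $v_n$. For a closed subspace $P\subset L^2_a(\mathbb{B}_n)$ invariant under the multiplication operators $T_{z_i}f=z_if$ ($i=1,\dots,n$), write $S_i=T_{z_i}|_P$; $P$ is called essentially normal if all commutators $[S_i,S_j^*]$, $1\le i,j\le n$, are compact operators on $P$. *)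

theory Defs
  imports "HOL-Analysis.Analysis"
begin

type_synonym 'n cfun = "complex ^ 'n \<Rightarrow> complex"

definition holo_on :: "(complex ^ 'n) set \<Rightarrow> 'n::finite cfun \<Rightarrow> bool" where
  "holo_on U f \<longleftrightarrow> (\<forall>z\<in>U. \<exists>L. (f has_derivative L) (at z) \<and> (\<forall>c x. L (c *s x) = c * L x))"

definition unit_ball :: "(complex ^ 'n::finite) set" where
  "unit_ball = ball 0 1"

definition bvol :: "'n::finite itself \<Rightarrow> real" where
  "bvol _ = measure lborel (unit_ball :: (complex ^ 'n) set)"

text \<open>Bergman space: holomorphic on the ball, square integrable; functions are
  extended by 0 outside the ball so that elements are determined uniquely.\<close>
definition bergman :: "'n::finite cfun set" where
  "bergman = {f. holo_on unit_ball f \<and> (\<forall>z. z \<notin> unit_ball \<longrightarrow> f z = 0) \<and>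
      (\<integral>\<^sup>+ z\<in>unit_ball. ennreal ((cmod (f z))\<^sup>2) \<partial>lborel) < \<infinity>}"

definition binner :: "'n::finite cfun \<Rightarrow> 'n cfun \<Rightarrow> complex" where
  "binner f g = (LINT z:unit_ball|lborel. f z * cnj (g z)) / complex_of_real (bvol TYPE('n))"

definition bnorm :: "'n::finite cfun \<Rightarrow> real" where
  "bnorm f = sqrt ((LINT z:unit_ball|lborel. (cmod (f z))\<^sup>2) / bvol TYPE('n))"

definition mult_z :: "'n \<Rightarrow> 'n::finite cfun \<Rightarrow> 'n cfun" where
  "mult_z i f = (\<lambda>z. z $ i * f z)"

definition adjP :: "'n::finite cfun set \<Rightarrow> ('n cfun \<Rightarrow> 'n cfun) \<Rightarrow> 'n cfun \<Rightarrow> 'n cfun" where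
  "adjP P T g = (THE h. h \<in> P \<and> (\<forall>f\<in>P. binner (T f) g = binner f h))"

definition compact_op :: "'n::finite cfun set \<Rightarrow> ('n cfun \<Rightarrow> 'n cfun) \<Rightarrow> bool" where
  "compact_op P K \<longleftrightarrow> (\<forall>u (B::real). (\<forall>k. u k \<in> P \<and> bnorm (u k) \<le> B) \<longrightarrow>
      (\<exists>(r::nat\<Rightarrow>nat) g. strict_mono r \<and> g \<in> P \<and> (\<lambda>k. bnorm (K (u (r k)) - g)) \<longlonglongrightarrow> 0))"

definition essentially_normal :: "'n::finite cfun set \<Rightarrow> bool" where
  "essentially_normal P \<longleftrightarrow> (\<forall>i j. compact_op P
      (\<lambda>f. mult_z i (adjP P (mult_z j) f) - adjP P (mult_z j) (mult_z i f)))"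

definition regular_on :: "'a::topological_space set \<Rightarrow> 'a measure \<Rightarrow> bool" where
  "regular_on M mu \<longleftrightarrow> (\<forall>E\<in>sets mu.
      emeasure mu E = (INF U\<in>{U. openin (top_of_set M) U \<and> E \<subseteq> U}. emeasure mu U) \<and>
      emeasure mu E = (SUP K\<in>{K. compact K \<and> K \<subseteq> E}. emeasure mu K))"

end

theory Submission
  imports Defs "HOL-Complex_Analysis.Great_Picard"
begin

text \<open>
  Write \<open>T\<^sub>i\<close> for multiplication by \<open>z\<^sub>i\<close> on the Bergman space \<open>H\<close>. Restricted to a complex line through
  the origin, \<open>\<Sum>\<^sub>i T\<^sub>i T\<^sub>i\<^sup>* f\<close> has Taylor coefficients \<open>d\<^sub>m f\<^sub>m\<close>, where \<open>d\<^sub>m\<close> is a ratio of consecutive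
  moments of \<open>|z\<^sub>1|\<^sup>2\<close> over the ball and hence tends to 1. So \<open>I - \<Sum>\<^sub>i T\<^sub>i T\<^sub>i\<^sup>*\<close> is compact, and with it the
  Hankel operators \<open>f \<mapsto> cnj z\<^sub>i f - T\<^sub>i\<^sup>* f\<close> and all commutators \<open>[T\<^sub>i, T\<^sub>j\<^sup>*]\<close>. It remains to show that the
  component of \<open>T\<^sub>j\<^sup>* f\<^sub>k\<close> in \<open>Q\<close> tends to 0 whenever \<open>f\<^sub>k\<close> in \<open>P\<close> is bounded and tends to 0 locally
  uniformly; by the lower bound on \<open>Q\<close> this means \<open>T\<^sub>j\<^sup>* f\<^sub>k \<rightarrow> 0\<close> in \<open>L\<^sup>2(\<mu>)\<close>.

  Let \<open>E\<^sub>m(f)\<close> be the sum of the squared \<open>L\<^sup>2(\<mu>)\<close>-norms of \<open>T\<^sub>i\<^sub>1\<^sup>* \<cdots> T\<^sub>i\<^sub>m\<^sup>* f\<close> over all words of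
  length \<open>m\<close>. Up to errors that vanish along \<open>f\<^sub>k\<close>, the sequence \<open>E\<^sub>m\<close> is convex in \<open>m\<close>: on the support of
  \<open>\<mu>\<close>, contracting the symmetric tensor of second order adjoints with the point \<open>w\<close> gives back the first
  order ones. It is also bounded in \<open>m\<close>, because \<open>\<mu>\<close> is a Carleson measure. A bounded convex sequence is
  nonincreasing, so the limit superior of \<open>E\<^sub>1(f\<^sub>k)\<close> is at most that of \<open>E\<^sub>0(f\<^sub>k)\<close>, which is 0 since \<open>f\<^sub>k\<close>
  vanishes on \<open>M\<close>. This replaces a Fuglede-Putnam argument modulo the compact operators.
\<close>

section \<open>Invariance of Lebesgue measure and circle averages\<close>

text \<open>The two bounds are assumed on \<open>Q\<close> only. Elements of \<open>P\<close> vanish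
  on \<open>M\<close>, so in \<open>L\<^sup>2(\<mu>)\<close> a function cannot be told from its
  component in \<open>Q\<close>. Hence the upper bound holds on the whole Bergman space, and the
  lower bound for the component of \<open>T\<^sub>j\<^sup>* f\<close> in \<open>Q\<close> can be
  evaluated on \<open>T\<^sub>j\<^sup>* f\<close> itself. Compactness is tested on bounded sequences
  that tend to 0 locally uniformly, to which Montel's theorem reduces it; for the operator
  \<open>I - \<Sum>\<^sub>i T\<^sub>i T\<^sub>i\<^sup>*\<close> it takes the form of an estimate of
  its quadratic form by \<open>\<epsilon>\<close> times the squared norm plus a multiple of the
  squared supremum over a smaller ball. Complex lines serve to diagonalise that operator without
  power series in several variables: averaging an integral over scalar rotations leaves circles,
  each of which lies on one line. The errors in the convexity of \<open>E\<^sub>m\<close> vanish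
  along the sequence for each fixed \<open>m\<close>, with no uniformity in \<open>m\<close>. So the
  number of convexity steps is fixed first, from the bound on \<open>E\<^sub>m\<close>, and only
  then the index in the sequence.\<close>

lemma nn_integral_lborel_shift:
  fixes f :: "'a::euclidean_space \<Rightarrow> ennreal"
  assumes [measurable]: "f \<in> borel_measurable borel"
  shows "(\<integral>\<^sup>+ x. f (a + x) \<partial>lborel) = (\<integral>\<^sup>+ x. f x \<partial>lborel)"
proof -
  have "(\<integral>\<^sup>+ x. f x \<partial>lborel) = (\<integral>\<^sup>+ x. f x \<partial>distr lborel borel ((+) a))"
    by (simp add: lborel_distr_plus)
  also have "\<dots> = (\<integral>\<^sup>+ x. f (a + x) \<partial>lborel)"
    by (rule nn_integral_distr) auto
  finally show ?thesis ..
qed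

text \<open>The Fubini argument for the uniqueness of Haar measure, tested against the unit ball, which the isometry preserves.\<close>
lemma distr_lborel_linear_isometry:
  fixes A :: "'a::euclidean_space \<Rightarrow> 'a"
  assumes lin: "linear A" and iso: "\<And>x. norm (A x) = norm x"
  shows "distr lborel borel A = lborel"
proof -
  have orth: "orthogonal_transformation A"
    using lin iso by (simp add: orthogonal_transformation)
  then have "bij A" by (rule orthogonal_transformation_bij)
  define B where "B = inv A"
  have AB: "A (B y) = y" for y
    unfolding B_def using \<open>bij A\<close> by (simp add: bij_is_surj surj_f_inv_f)
  have contA: "continuous_on UNIV A"
    using lin by (simp add: linear_continuous_on linear_linear)
  then have measA [measurable]: "A \<in> borel_measurable borel"
    by (rule borel_measurable_continuous_onI)
  let ?G = "ball 0 1 :: 'a set"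
  have [measurable]: "?G \<in> sets borel" by simp
  have ball_shift: "(\<integral>\<^sup>+ x. indicator ?G (y - A x) \<partial>lborel) = emeasure lborel ?G" for y
  proof -
    have "norm (y - A x) = norm (x + - B y)" for x
    proof -
      have "norm (y - A x) = norm (A (B y - x))"
        using linear_diff[OF lin, of "B y" x] by (simp add: AB)
      then show ?thesis by (simp add: iso norm_minus_commute)
    qed
    then have "(\<integral>\<^sup>+ x. indicator ?G (y - A x) \<partial>lborel) = (\<integral>\<^sup>+ x. indicator ?G (- B y + x) \<partial>lborel)"
      by (intro nn_integral_cong) (auto simp: indicator_def add.commute)
    also have "\<dots> = (\<integral>\<^sup>+ x. indicator ?G x \<partial>lborel)"
      by (rule nn_integral_lborel_shift) measurable
    finally show ?thesis by simp
  qed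
  have Gpos: "emeasure lborel ?G \<noteq> 0"
    using content_ball_pos[of 1 "0::'a"] by (auto simp: measure_def)
  have Gfin: "emeasure lborel ?G \<noteq> \<infinity>"
    using emeasure_lborel_ball_finite[of "0::'a" 1] by auto
  show ?thesis
  proof (rule measure_eqI)
    fix X assume "X \<in> sets (distr lborel borel A)"
    then have [measurable]: "X \<in> sets borel" by simp
    have "emeasure (distr lborel borel A) X = (\<integral>\<^sup>+ x. indicator X x \<partial>distr lborel borel A)"
      by simp
    also have "\<dots> = (\<integral>\<^sup>+ x. indicator X (A x) \<partial>lborel)"
      by (rule nn_integral_distr) measurable
    finally have "emeasure (distr lborel borel A) X * emeasure lborel ?G
        = (\<integral>\<^sup>+ x. indicator X (A x) \<partial>lborel) * (\<integral>\<^sup>+ y. indicator ?G y \<partial>lborel)"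
      by simp
    also have "\<dots> = (\<integral>\<^sup>+ y. (\<integral>\<^sup>+ x. indicator X (A x) \<partial>lborel) * indicator ?G y \<partial>lborel)"
      by (rule nn_integral_cmult[symmetric]) auto
    also have "\<dots> = (\<integral>\<^sup>+ y. (\<integral>\<^sup>+ x. indicator X (A x + y) * indicator ?G y \<partial>lborel) \<partial>lborel)"
    proof (rule nn_integral_cong)
      fix y :: 'a
      have "(\<integral>\<^sup>+ x. indicator X (A x) \<partial>lborel) = (\<integral>\<^sup>+ x. indicator X (A (B y + x)) \<partial>lborel)"
        by (rule nn_integral_lborel_shift[symmetric]) measurable
      also have "\<dots> = (\<integral>\<^sup>+ x. indicator X (A x + y) \<partial>lborel)"
        by (simp add: linear_add[OF lin] AB add.commute)
      finally show "(\<integral>\<^sup>+ x. indicator X (A x) \<partial>lborel) * indicator ?G y =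
        (\<integral>\<^sup>+ x. indicator X (A x + y) * indicator ?G y \<partial>lborel)"
        by (simp add: nn_integral_multc)
    qed
    also have "\<dots> = (\<integral>\<^sup>+ x. (\<integral>\<^sup>+ y. indicator X (A x + y) * indicator ?G y \<partial>lborel) \<partial>lborel)"
      by (rule lborel_pair.Fubini') measurable
    also have "\<dots> = (\<integral>\<^sup>+ x. (\<integral>\<^sup>+ y. indicator X y * indicator ?G (y - A x) \<partial>lborel) \<partial>lborel)"
    proof (rule nn_integral_cong)
      fix x :: 'a
      show "(\<integral>\<^sup>+ y. indicator X (A x + y) * indicator ?G y \<partial>lborel) =
            (\<integral>\<^sup>+ y. indicator X y * indicator ?G (y - A x) \<partial>lborel)"
        using nn_integral_lborel_shift[of "\<lambda>y. indicator X y * indicator ?G (y - A x)" "A x"]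
        by simp
    qed
    also have "\<dots> = (\<integral>\<^sup>+ y. (\<integral>\<^sup>+ x. indicator X y * indicator ?G (y - A x) \<partial>lborel) \<partial>lborel)"
      by (rule lborel_pair.Fubini') measurable
    also have "\<dots> = (\<integral>\<^sup>+ y. indicator X y * emeasure lborel ?G \<partial>lborel)"
      by (simp add: nn_integral_cmult ball_shift)
    also have "\<dots> = emeasure lborel X * emeasure lborel ?G"
      by (simp add: nn_integral_multc)
    finally show "emeasure (distr lborel borel A) X = emeasure lborel X"
      using Gpos Gfin by (simp add: mult.commute[of _ "emeasure lborel ?G"] ennreal_mult_cancel_left)
  qed simp
qed

text \<open>A Lebesgue integral, so that Fubini's theorem and termwise integration of series apply
  to it directly.\<close>

definition circle_mean :: "(real \<Rightarrow> complex) \<Rightarrow> complex" where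
  "circle_mean g = (LINT t:{0..2*pi}|lborel. g t) / (2*pi)"

text \<open>Fubini moves the average over \<open>t\<close> outside; for fixed \<open>t\<close> the
  isometry \<open>A t\<close> preserves Lebesgue measure, so the inner integral does not depend on
  \<open>t\<close>. Used for the scalar rotations and for the rotations fixing a line.\<close>

lemma integral_circle_mean:
  fixes A :: "real \<Rightarrow> 'a::euclidean_space \<Rightarrow> 'a" and F :: "'a \<Rightarrow> complex"
  assumes meas: "(\<lambda>(t, z). A t z) \<in> borel_measurable (borel \<Otimes>\<^sub>M borel)"
    and lin: "\<And>t. linear (A t)" and iso: "\<And>t x. norm (A t x) = norm x"
    and F: "integrable lborel F"
  shows "integrable lborel (\<lambda>z. circle_mean (\<lambda>t. F (A t z)))"
    and "(LINT z|lborel. circle_mean (\<lambda>t. F (A t z))) = (LINT z|lborel. F z)"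
proof -
  define R where "R = restrict_space lborel {0..2*pi::real}"
  have Rfin: "finite_measure R"
    unfolding R_def by (intro finite_measureI) (simp add: emeasure_restrict_space space_restrict_space)
  then interpret R: sigma_finite_measure R
    by (simp add: finite_measure.axioms(1))
  interpret pair_sigma_finite R "lborel :: 'a measure" ..
  have Fm [measurable]: "F \<in> borel_measurable borel"
    using borel_measurable_integrable[OF F] by simp
  have [measurable]: "(\<lambda>x. x) \<in> R \<rightarrow>\<^sub>M borel"
    unfolding R_def by (simp add: measurable_restrict_space1)
  have [measurable]: "(\<lambda>(t, z). A t z) \<in> borel_measurable (R \<Otimes>\<^sub>M lborel)"
  proof -
    have "(\<lambda>p. (fst p, snd p)) \<in> (R \<Otimes>\<^sub>M lborel) \<rightarrow>\<^sub>M (borel \<Otimes>\<^sub>M borel)"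
      by measurable
    from measurable_compose[OF this meas] show ?thesis by (simp add: split_beta')
  qed
  have Am: "A t \<in> borel_measurable borel" for t
    using lin by (simp add: borel_measurable_continuous_onI linear_continuous_on linear_linear)
  have inv: "integrable lborel (\<lambda>z. F (A t z))" "(LINT z|lborel. F (A t z)) = (LINT z|lborel. F z)"
    "(LINT z|lborel. norm (F (A t z))) = (LINT z|lborel. norm (F z))" for t
  proof -
    have d: "distr lborel borel (A t) = lborel"
      by (rule distr_lborel_linear_isometry[OF lin iso])
    show "integrable lborel (\<lambda>z. F (A t z))"
      using F integrable_distr_eq[of "A t" lborel borel F] Am by (simp add: d)
    show "(LINT z|lborel. F (A t z)) = (LINT z|lborel. F z)"
      using integral_distr[of "A t" lborel borel F] Am by (simp add: d)
    show "(LINT z|lborel. norm (F (A t z))) = (LINT z|lborel. norm (F z))"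
      using integral_distr[of "A t" lborel borel "\<lambda>z. norm (F z)"] Am by (simp add: d)
  qed
  have FA [measurable]: "(\<lambda>(t, z). F (A t z)) \<in> borel_measurable (R \<Otimes>\<^sub>M lborel)"
    using measurable_compose[OF \<open>(\<lambda>(t, z). A t z) \<in> borel_measurable (R \<Otimes>\<^sub>M lborel)\<close> Fm]
    by (simp add: split_beta')
  have int: "integrable (R \<Otimes>\<^sub>M lborel) (\<lambda>(t, z). F (A t z))"
    by (rule Fubini_integrable) (use Rfin in \<open>simp_all add: inv finite_measure.integrable_const\<close>)
  have cm: "circle_mean (\<lambda>t. F (A t z)) = (LINT t|R. F (A t z)) / (2*pi)" for z
    unfolding circle_mean_def R_def by (simp add: set_lebesgue_integral_def integral_restrict_space)
  show "integrable lborel (\<lambda>z. circle_mean (\<lambda>t. F (A t z)))"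
    unfolding cm using integrable_snd[OF int] by simp
  have "(LINT z|lborel. circle_mean (\<lambda>t. F (A t z))) = (LINT z|lborel. (LINT t|R. F (A t z))) / (2*pi)"
    unfolding cm by simp
  also have "(LINT z|lborel. (LINT t|R. F (A t z))) = (LINT t|R. (LINT z|lborel. F (A t z)))"
    by (rule Fubini_integral[OF int])
  also have "\<dots> = measure R (space R) *\<^sub>R (LINT z|lborel. F z)"
    by (simp add: inv)
  also have "measure R (space R) = 2*pi"
    unfolding R_def by (simp add: measure_restrict_space space_restrict_space)
  finally show "(LINT z|lborel. circle_mean (\<lambda>t. F (A t z))) = (LINT z|lborel. F z)"
    by (simp add: scaleR_conv_of_real)
qed

section \<open>Square integrable functions\<close>

text \<open>Functions, not classes modulo null sets: elements of the Bergman space are evaluated at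
  points, and the same function is measured against Lebesgue measure and against
  \<open>\<mu>\<close>.\<close>

definition L2 :: "'a measure \<Rightarrow> ('a \<Rightarrow> complex) set" where
  "L2 M = {f \<in> borel_measurable M. integrable M (\<lambda>x. (cmod (f x))\<^sup>2)}"

definition nsq :: "'a measure \<Rightarrow> ('a \<Rightarrow> complex) \<Rightarrow> real" where
  "nsq M f = (LINT x|M. (cmod (f x))\<^sup>2)"

definition ip :: "'a measure \<Rightarrow> ('a \<Rightarrow> complex) \<Rightarrow> ('a \<Rightarrow> complex) \<Rightarrow> complex" where
  "ip M f g = (LINT x|M. f x * cnj (g x))"

text \<open>Young's inequality for the cross term. A small \<open>t\<close> keeps the coefficient of
  the first summand close to 1, at the expense of the second; this is what makes perturbation
  arguments possible.\<close>

lemma cmod_add_sq_le: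
  assumes "t > 0"
  shows "(cmod (a + b))\<^sup>2 \<le> (1 + t) * (cmod a)\<^sup>2 + (1 + 1 / t) * (cmod b)\<^sup>2"
proof -
  have "(cmod (a + b))\<^sup>2 \<le> (cmod a + cmod b)\<^sup>2"
    by (simp add: norm_triangle_ineq power_mono)
  also have "\<dots> = (cmod a)\<^sup>2 + (cmod b)\<^sup>2 + 2 * cmod a * cmod b"
    by (simp add: power2_sum)
  also have "2 * cmod a * cmod b \<le> t * (cmod a)\<^sup>2 + (1 / t) * (cmod b)\<^sup>2"
  proof -
    have "0 \<le> (t * cmod a - cmod b)\<^sup>2 / t"
      using assms by simp
    also have "\<dots> = t * (cmod a)\<^sup>2 + (1 / t) * (cmod b)\<^sup>2 - 2 * cmod a * cmod b"
      using assms by (simp add: power2_eq_square field_simps)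
    finally show ?thesis by simp
  qed
  finally show ?thesis by (simp add: algebra_simps)
qed

lemma L2_integrable: "f \<in> L2 M \<Longrightarrow> integrable M (\<lambda>x. (cmod (f x))\<^sup>2)"
  by (simp add: L2_def)

lemma L2_I:
  assumes "f \<in> borel_measurable M" "integrable M g" "\<And>x. (cmod (f x))\<^sup>2 \<le> g x"
  shows "f \<in> L2 M"
proof -
  have "integrable M (\<lambda>x. (cmod (f x))\<^sup>2)"
  proof (rule Bochner_Integration.integrable_bound[OF assms(2)])
    show "(\<lambda>x. (cmod (f x))\<^sup>2) \<in> borel_measurable M" using assms(1) by measurable
    show "AE x in M. norm ((cmod (f x))\<^sup>2) \<le> norm (g x)"
      using assms(3) by (intro AE_I2) (simp add: order_trans[OF _ abs_ge_self])
  qed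
  with assms(1) show ?thesis by (simp add: L2_def)
qed

lemma L2_add:
  assumes "f \<in> L2 M" "g \<in> L2 M"
  shows "(\<lambda>x. f x + g x) \<in> L2 M"
  using assms cmod_add_sq_le[of 1]
  by (intro L2_I[of _ _ "\<lambda>x. (1 + 1) * (cmod (f x))\<^sup>2 + (1 + 1 / 1) * (cmod (g x))\<^sup>2"])
     (auto simp: L2_def)

lemma L2_cmult:
  assumes "f \<in> L2 M"
  shows "(\<lambda>x. c * f x) \<in> L2 M"
  using assms by (auto simp: L2_def norm_mult power_mult_distrib)

lemma L2_minus:
  assumes "f \<in> L2 M" "g \<in> L2 M"
  shows "(\<lambda>x. f x - g x) \<in> L2 M"
  using L2_add[OF assms(1) L2_cmult[OF assms(2), of "-1"]] by simp

lemma L2_mult_bounded: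
  assumes "f \<in> L2 M" "h \<in> borel_measurable M" "\<And>x. cmod (h x * f x) \<le> cmod (f x)"
  shows "(\<lambda>x. h x * f x) \<in> L2 M" "nsq M (\<lambda>x. h x * f x) \<le> nsq M f"
proof -
  have le: "(cmod (h x * f x))\<^sup>2 \<le> (cmod (f x))\<^sup>2" for x
    using assms(3) by (rule power_mono) simp
  show L: "(\<lambda>x. h x * f x) \<in> L2 M"
    by (rule L2_I[OF _ L2_integrable[OF assms(1)] le]) (use assms in \<open>auto simp: L2_def\<close>)
  show "nsq M (\<lambda>x. h x * f x) \<le> nsq M f"
    unfolding nsq_def by (intro integral_mono L2_integrable L assms(1) le)
qed

lemma nsq_nonneg [simp]: "0 \<le> nsq M f"
  by (simp add: nsq_def)

lemma nsq_cmult: "nsq M (\<lambda>x. c * f x) = (cmod c)\<^sup>2 * nsq M f"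
  by (simp add: nsq_def norm_mult power_mult_distrib)

lemma nsq_add_le:
  assumes "f \<in> L2 M" "g \<in> L2 M" "t > 0"
  shows "nsq M (\<lambda>x. f x + g x) \<le> (1 + t) * nsq M f + (1 + 1 / t) * nsq M g"
proof -
  have "nsq M (\<lambda>x. f x + g x) \<le> (LINT x|M. (1 + t) * (cmod (f x))\<^sup>2 + (1 + 1 / t) * (cmod (g x))\<^sup>2)"
    unfolding nsq_def
    by (intro integral_mono L2_integrable L2_add assms cmod_add_sq_le
        Bochner_Integration.integrable_add integrable_mult_right)
  also have "\<dots> = (1 + t) * nsq M f + (1 + 1 / t) * nsq M g"
    unfolding nsq_def using assms by (subst Bochner_Integration.integral_add) (auto simp: L2_def)
  finally show ?thesis .
qed

lemma nsq_minus_commute: "nsq M (\<lambda>x. f x - g x) = nsq M (\<lambda>x. g x - f x)"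
  by (simp add: nsq_def norm_minus_commute)

lemma borel_measurable_cnj' [measurable (raw)]:
  "f \<in> borel_measurable M \<Longrightarrow> (\<lambda>x. cnj (f x)) \<in> borel_measurable M"
  by (rule measurable_compose[OF _ borel_measurable_continuous_onI]) (auto intro: continuous_intros)

lemma ip_integrable:
  assumes "f \<in> L2 M" "g \<in> L2 M"
  shows "integrable M (\<lambda>x. f x * cnj (g x))"
proof (rule Bochner_Integration.integrable_bound)
  show "integrable M (\<lambda>x. (cmod (f x))\<^sup>2 + (cmod (g x))\<^sup>2)"
    using assms by (auto simp: L2_def)
  have [measurable]: "f \<in> borel_measurable M" "g \<in> borel_measurable M"
    using assms by (auto simp: L2_def)
  show "(\<lambda>x. f x * cnj (g x)) \<in> borel_measurable M" by measurable
  show "AE x in M. norm (f x * cnj (g x)) \<le> norm ((cmod (f x))\<^sup>2 + (cmod (g x))\<^sup>2)"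
  proof (intro AE_I2)
    fix x
    have "0 \<le> (cmod (f x) - cmod (g x))\<^sup>2" by simp
    then have "2 * (cmod (f x) * cmod (g x)) \<le> (cmod (f x))\<^sup>2 + (cmod (g x))\<^sup>2"
      by (simp add: power2_diff)
    moreover have "0 \<le> cmod (f x) * cmod (g x)" by simp
    ultimately have "cmod (f x) * cmod (g x) \<le> (cmod (f x))\<^sup>2 + (cmod (g x))\<^sup>2" by linarith
    then show "norm (f x * cnj (g x)) \<le> norm ((cmod (f x))\<^sup>2 + (cmod (g x))\<^sup>2)"
      by (simp add: norm_mult)
  qed
qed

lemma ip_diff_left: "f \<in> L2 M \<Longrightarrow> g \<in> L2 M \<Longrightarrow> h \<in> L2 M \<Longrightarrow> ip M (\<lambda>x. f x - g x) h = ip M f h - ip M g h"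
  unfolding ip_def by (simp add: left_diff_distrib ip_integrable)

lemma ip_diff_right: "f \<in> L2 M \<Longrightarrow> g \<in> L2 M \<Longrightarrow> h \<in> L2 M \<Longrightarrow> ip M f (\<lambda>x. g x - h x) = ip M f g - ip M f h"
  unfolding ip_def by (simp add: right_diff_distrib ip_integrable)

lemma ip_cmult_left: "ip M (\<lambda>x. c * f x) g = c * ip M f g"
  unfolding ip_def by (simp add: mult.assoc)

lemma ip_commute: "ip M f g = cnj (ip M g f)"
  unfolding ip_def by (subst Bochner_Integration.integral_cnj[symmetric]) (simp add: mult.commute)

lemma ip_self: "ip M f f = complex_of_real (nsq M f)"
  unfolding ip_def nsq_def by (simp add: complex_mult_cnj cmod_power2 flip: integral_complex_of_real)

lemma nsq_diff:
  assumes "f \<in> L2 M" "g \<in> L2 M"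
  shows "nsq M (\<lambda>x. f x - g x) = nsq M f - 2 * Re (ip M f g) + nsq M g"
proof -
  have "ip M (\<lambda>x. f x - g x) (\<lambda>x. f x - g x) = ip M f f - ip M f g - (ip M g f - ip M g g)"
    using assms by (simp add: ip_diff_left ip_diff_right L2_minus)
  also have "\<dots> = complex_of_real (nsq M f) - ip M f g - cnj (ip M f g) + complex_of_real (nsq M g)"
    by (simp add: ip_self ip_commute[of M g f])
  finally have "complex_of_real (nsq M (\<lambda>x. f x - g x)) = \<dots>"
    by (simp add: ip_self)
  then have "Re (complex_of_real (nsq M (\<lambda>x. f x - g x))) = Re \<dots>" by (rule arg_cong)
  then show ?thesis by simp
qed

text \<open>The usual variation: moving \<open>g\<close> by a small multiple of \<open>f\<close>, in
  the phase given by the inner product, would decrease the norm to first order.\<close>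

lemma ip_eq_0_if_minimal:
  assumes f: "f \<in> L2 M" and g: "g \<in> L2 M"
    and min: "\<And>c. nsq M g \<le> nsq M (\<lambda>x. g x - c * f x)"
  shows "ip M f g = 0"
proof (rule ccontr)
  define a where "a = ip M f g"
  assume "ip M f g \<noteq> 0"
  then have "a \<noteq> 0" by (simp add: a_def)
  \<comment> \<open>The \<open>+ 1\<close> allows for \<open>nsq M f = 0\<close> and keeps the
    quadratic term below the linear one.\<close>
  define s where "s = 1 / (nsq M f + 1)"
  have s: "s > 0" "s * nsq M f < 1"
    unfolding s_def using nsq_nonneg[of M f] by (auto simp: divide_simps simp del: nsq_nonneg)
  define c where "c = complex_of_real s * cnj a"
  have "nsq M (\<lambda>x. g x - c * f x) = nsq M g - 2 * Re (ip M g (\<lambda>x. c * f x)) + (cmod c)\<^sup>2 * nsq M f"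
    using assms by (simp add: nsq_diff L2_cmult nsq_cmult)
  also have "ip M g (\<lambda>x. c * f x) = cnj (c * a)"
    by (subst ip_commute) (simp add: ip_cmult_left a_def)
  also have "c * a = complex_of_real (s * (cmod a)\<^sup>2)"
    unfolding c_def by (simp add: mult.commute complex_norm_square flip: of_real_power)
  also have "(cmod c)\<^sup>2 = s\<^sup>2 * (cmod a)\<^sup>2"
    unfolding c_def using s by (simp add: norm_mult power_mult_distrib)
  finally have "nsq M g \<le> nsq M g - 2 * (s * (cmod a)\<^sup>2) + s\<^sup>2 * (cmod a)\<^sup>2 * nsq M f"
    using min[of c] by simp
  then have "2 * (s * (cmod a)\<^sup>2) \<le> (s * (cmod a)\<^sup>2) * (s * nsq M f)"
    by (simp add: power2_eq_square algebra_simps)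
  moreover have "s * (cmod a)\<^sup>2 > 0" using s \<open>a \<noteq> 0\<close> by simp
  ultimately have "2 \<le> s * nsq M f"
    by (metis mult.commute mult_le_cancel_left_pos)
  with s show False by simp
qed

section \<open>Power series on circles\<close>

lemma circle_mean_cis:
  "circle_mean (\<lambda>t. cis (real n * t) * cis (- (real m * t))) = (if n = m then 1 else 0)"
proof (cases "n = m")
  case True
  have "circle_mean (\<lambda>t. cis (real n * t) * cis (- (real m * t))) = circle_mean (\<lambda>t. 1)"
    using True by (simp add: cis_mult)
  also have "\<dots> = 1"
    unfolding circle_mean_def by (simp add: scaleR_conv_of_real set_lebesgue_integral_def)
  finally show ?thesis using True by simp
next
  case False
  define k where "k = real n - real m"
  have k: "k \<noteq> 0" using False by (simp add: k_def)
  have eq: "cis (real n * t) * cis (- (real m * t)) = cis (k * t)" for t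
    by (simp add: cis_mult k_def algebra_simps)
  have "((\<lambda>t. cis (k * t)) has_integral (cis (k * (2*pi)) / (\<i> * k) - cis (k * 0) / (\<i> * k))) {0..2*pi}"
  proof (rule fundamental_theorem_of_calculus)
    fix t :: real
    have "((\<lambda>x. exp (\<i> * k * x) / (\<i> * k)) has_field_derivative exp (\<i> * k * of_real t)) (at (of_real t))"
      using k by (auto intro!: derivative_eq_intros)
    from has_vector_derivative_real_field[OF this]
    show "((\<lambda>t. cis (k * t) / (\<i> * k)) has_vector_derivative cis (k * t)) (at t within {0..2*pi})"
      by (simp add: cis_conv_exp mult.assoc)
  qed simp
  moreover have "cis (k * (2*pi)) = 1"
  proof -
    have "k * (2*pi) = of_int (int n - int m) * (2*pi)" by (simp add: k_def)
    then show ?thesis using cis_multiple_2pi[of "of_int (int n - int m)"] by (simp add: mult.commute)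
  qed
  ultimately have "((\<lambda>t. cis (k * t)) has_integral 0) {0..2*pi}" by simp
  moreover have "set_integrable lborel {0..2*pi} (\<lambda>t. cis (k * t))"
    unfolding set_integrable_def
    by (rule borel_integrable_compact) (auto intro!: continuous_intros)
  ultimately have "(LINT t:{0..2*pi}|lborel. cis (k * t)) = 0"
    by (metis has_integral_unique has_integral_set_lebesgue integrable_completion
        set_borel_integral_eq_integral(2) integral_unique)
  then show ?thesis using False by (simp add: circle_mean_def eq)
qed

text \<open>Coefficients are kept as data instead of derivatives at 0, so that the expansion of a
  new function can be exhibited by manipulating series.\<close>

definition power_coeffs :: "(nat \<Rightarrow> complex) \<Rightarrow> (complex \<Rightarrow> complex) \<Rightarrow> real \<Rightarrow> bool" where
  "power_coeffs c g R \<longleftrightarrow> (\<forall>x. cmod x < R \<longrightarrow> (\<lambda>n. c n * x ^ n) sums g x)"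

lemma power_coeffs_deriv:
  assumes "g holomorphic_on ball 0 R"
  shows "power_coeffs (\<lambda>n. (deriv ^^ n) g 0 / fact n) g R"
  using holomorphic_power_series[OF assms] by (simp add: power_coeffs_def)

lemma power_coeffs_abs_summable:
  assumes "power_coeffs c g R" "cmod x < R"
  shows "summable (\<lambda>n. cmod (c n) * cmod x ^ n)"
proof -
  define s where "s = (cmod x + R) / 2"
  have "summable (\<lambda>n. c n * complex_of_real s ^ n)"
    using assms(1)[unfolded power_coeffs_def, rule_format, of "of_real s"] norm_ge_zero[of x] assms(2)
    unfolding sums_iff by (auto simp: s_def simp del: of_real_add of_real_divide norm_ge_zero)
  then have "summable (\<lambda>n. norm (c n * x ^ n))"
    by (rule powser_insidea)
       (use assms(2) norm_ge_zero[of x] in \<open>auto simp: s_def simp del: of_real_add of_real_divide norm_ge_zero\<close>)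
  then show ?thesis by (simp add: norm_mult norm_power)
qed

text \<open>Absolute convergence inside the radius justifies integrating term by term. The weight
  \<open>\<phi>\<close> is left open: a character extracts a coefficient, the conjugate of a second
  series gives Parseval's identity.\<close>

lemma circle_mean_power_series:
  assumes g: "power_coeffs c g R" and x: "cmod x < R" and phi: "continuous_on UNIV \<phi>"
  shows "(\<lambda>n. c n * x ^ n * circle_mean (\<lambda>t. cis (real n * t) * \<phi> t))
          sums circle_mean (\<lambda>t. g (x * cis t) * \<phi> t)"
proof -
  let ?I = "{0..2*pi}"
  obtain B where B: "\<And>t. t \<in> ?I \<Longrightarrow> cmod (\<phi> t) \<le> B"
    using compact_imp_bounded[OF compact_continuous_image[OF continuous_on_subset[OF phi] compact_Icc]]
    by (metis bounded_iff imageI subset_UNIV)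
  define F where "F n t = indicator ?I t *\<^sub>R (c n * x ^ n * (cis (real n * t) * \<phi> t))" for n t
  have int: "integrable lborel (F n)" for n
    unfolding F_def
    by (rule borel_integrable_compact) (auto intro!: continuous_intros continuous_on_subset[OF phi])
  have bd: "cmod (F n t) \<le> indicator ?I t * (cmod (c n) * cmod x ^ n * B)" for n t
    using B[of t] unfolding F_def
    by (auto simp: indicator_def norm_mult norm_power intro!: mult_left_mono)
  have sm: "summable (\<lambda>n. cmod (c n) * cmod x ^ n * B)"
    using power_coeffs_abs_summable[OF g x] by (rule summable_mult2)
  have "(\<lambda>n. integral\<^sup>L lborel (F n)) sums (LINT t|lborel. (\<Sum>n. F n t))"
  proof (rule sums_integral[OF int])
    show "AE t in lborel. summable (\<lambda>n. norm (F n t))"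
    proof (rule AE_I2)
      fix t
      show "summable (\<lambda>n. norm (F n t))"
        by (rule summable_comparison_test'[OF summable_mult[OF sm, of "indicator ?I t"], of 0])
           (use bd in auto)
    qed
    have "norm (LINT t|lborel. norm (F n t)) \<le> (2*pi) * (cmod (c n) * cmod x ^ n * B)" for n
    proof -
      have "(LINT t|lborel. norm (F n t)) \<le> (LINT t|lborel. indicator ?I t * (cmod (c n) * cmod x ^ n * B))"
        by (intro integral_mono bd integrable_norm int) auto
      then show ?thesis by simp
    qed
    then show "summable (\<lambda>n. LINT t|lborel. norm (F n t))"
      by (intro summable_comparison_test'[OF summable_mult[OF sm, of "2*pi"], of 0]) auto
  qed
  moreover have "(\<Sum>n. F n t) = indicator ?I t *\<^sub>R (g (x * cis t) * \<phi> t)" for t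
  proof -
    have "(\<lambda>n. c n * (x * cis t) ^ n) sums g (x * cis t)"
      using g x by (simp add: power_coeffs_def norm_mult)
    then have "(\<lambda>n. indicator ?I t *\<^sub>R (c n * (x * cis t) ^ n * \<phi> t))
        sums (indicator ?I t *\<^sub>R (g (x * cis t) * \<phi> t))"
      by (intro sums_scaleR_right sums_mult2)
    moreover have "indicator ?I t *\<^sub>R (c n * (x * cis t) ^ n * \<phi> t) = F n t" for n
      by (simp add: F_def power_mult_distrib Complex.DeMoivre mult_ac)
    ultimately show ?thesis by (simp add: sums_iff)
  qed
  ultimately have "(\<lambda>n. integral\<^sup>L lborel (F n) / (2*pi)) sums
     ((LINT t:?I|lborel. (g (x * cis t) * \<phi> t)) / (2*pi))"
    unfolding set_lebesgue_integral_def by (simp add: sums_divide)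
  moreover have "integral\<^sup>L lborel (F n) =
      c n * x ^ n * (LINT t:?I|lborel. cis (real n * t) * \<phi> t)" for n
    unfolding F_def set_lebesgue_integral_def
    by (subst integral_mult_right_zero[symmetric]) (simp add: scaleR_conv_of_real mult_ac)
  ultimately show ?thesis by (simp add: circle_mean_def)
qed

lemma circle_mean_coeff:
  assumes g: "power_coeffs c g R" and x: "cmod x < R"
  shows "circle_mean (\<lambda>t. g (x * cis t) * cis (- (real m * t))) = c m * x ^ m"
proof -
  have "(\<lambda>n. c n * x ^ n * (if n = m then 1 else 0))
      sums circle_mean (\<lambda>t. g (x * cis t) * cis (- (real m * t)))"
    using circle_mean_power_series[OF g x, of "\<lambda>t. cis (- (real m * t))"]
    by (simp add: circle_mean_cis continuous_intros)
  moreover have "(\<lambda>n. c n * x ^ n * (if n = m then 1 else 0)) sums (c m * x ^ m)"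
    using sums_single[of m "\<lambda>n. c n * x ^ n"] by (simp add: if_distrib cong: if_cong)
  ultimately show ?thesis by (rule sums_unique2)
qed

lemma circle_mean_holomorphic:
  assumes "g holomorphic_on ball 0 R" "1 < R"
  shows "circle_mean (\<lambda>t. g (cis t)) = g 0"
  using circle_mean_coeff[OF power_coeffs_deriv[OF assms(1)], of 1 0] assms(2) by simp

lemma circle_mean_cnj: "circle_mean (\<lambda>t. cnj (g t)) = cnj (circle_mean g)"
  unfolding circle_mean_def set_lebesgue_integral_def
  by (simp flip: Bochner_Integration.integral_cnj)

text \<open>Polarised, since it will pair the restriction of \<open>f - row_col f\<close> with that
  of \<open>f\<close>.\<close>

lemma circle_mean_Parseval:
  assumes u: "power_coeffs a u R" and g: "power_coeffs c g R"
    and cont: "continuous_on (ball 0 R) g" and x: "cmod x < R"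
  shows "(\<lambda>n. a n * cnj (c n) * of_real ((cmod x)\<^sup>2) ^ n)
          sums circle_mean (\<lambda>t. u (x * cis t) * cnj (g (x * cis t)))"
proof -
  have "circle_mean (\<lambda>t. cis (real n * t) * cnj (g (x * cis t))) = cnj (c n * x ^ n)" for n
  proof -
    have "circle_mean (\<lambda>t. cis (real n * t) * cnj (g (x * cis t)))
        = circle_mean (\<lambda>t. cnj (g (x * cis t) * cis (- (real n * t))))"
      by (simp add: cis_cnj mult.commute)
    then show ?thesis
      by (simp only: circle_mean_cnj circle_mean_coeff[OF g x])
  qed
  moreover have "continuous_on UNIV (\<lambda>t. cnj (g (x * cis t)))"
    by (intro continuous_on_cnj continuous_on_compose2[OF cont])
       (use x in \<open>auto intro!: continuous_intros simp: norm_mult\<close>)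
  moreover have "a n * x ^ n * cnj (c n * x ^ n) = a n * cnj (c n) * of_real ((cmod x)\<^sup>2) ^ n" for n
    by (simp add: complex_norm_square power_mult_distrib flip: of_real_power) 
  ultimately show ?thesis
    using circle_mean_power_series[OF u x, of "\<lambda>t. cnj (g (x * cis t))"] by (simp only:)
qed

section \<open>Holomorphic functions on the ball\<close>

lemma norm_vec_sq: "(norm (z :: complex ^ 'n))\<^sup>2 = (\<Sum>i\<in>UNIV. (cmod (z $ i))\<^sup>2)"
  by (simp add: norm_vec_def L2_set_def sum_nonneg)

lemma norm_vector_scalar_mult: "norm (c *s (z :: complex ^ 'n)) = cmod c * norm z"
proof -
  have "(norm (c *s z))\<^sup>2 = (cmod c * norm z)\<^sup>2"
    by (simp add: norm_vec_sq power_mult_distrib norm_mult sum_distrib_left)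
  then show ?thesis by simp
qed

lemma linear_vector_scalar_mult: "linear (\<lambda>z :: complex ^ 'n. c *s z)"
  by (rule linearI) (auto simp: vec_eq_iff algebra_simps)

lemma linear_vector_scalar_mult_left: "linear (\<lambda>c. c *s (z :: complex ^ 'n))"
  by (rule linearI) (auto simp: vec_eq_iff algebra_simps)

lemma continuous_on_vector_scalar_mult [continuous_intros]:
  fixes g :: "'a::topological_space \<Rightarrow> complex ^ 'n"
  assumes "continuous_on S f" "continuous_on S g"
  shows "continuous_on S (\<lambda>x. f x *s g x)"
  unfolding vector_scalar_mult_def using assms by (intro continuous_on_vec_lambda continuous_intros)

lemma holo_on_continuous_on: "holo_on U f \<Longrightarrow> continuous_on U f"
  unfolding holo_on_def
  by (meson continuous_at_imp_continuous_on has_derivative_continuous)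

lemma holo_on_const: "holo_on U (\<lambda>z. c)"
  unfolding holo_on_def by (auto intro!: exI[of _ "\<lambda>h. 0"])

lemma holo_on_nth: "holo_on U (\<lambda>z. z $ i)"
  unfolding holo_on_def
  by (auto intro!: exI[of _ "\<lambda>h. h $ i"] bounded_linear_imp_has_derivative bounded_linear_vec_nth)

lemma holo_on_add:
  assumes "holo_on U f" "holo_on U g"
  shows "holo_on U (\<lambda>z. f z + g z)"
  unfolding holo_on_def
proof
  fix z assume "z \<in> U"
  then obtain L L' where "(f has_derivative L) (at z)" "\<forall>c x. L (c *s x) = c * L x"
    "(g has_derivative L') (at z)" "\<forall>c x. L' (c *s x) = c * L' x"
    using assms unfolding holo_on_def by metis
  then show "\<exists>L. ((\<lambda>z. f z + g z) has_derivative L) (at z) \<and> (\<forall>c x. L (c *s x) = c * L x)"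
    by (intro exI[of _ "\<lambda>h. L h + L' h"]) (intro conjI has_derivative_add, auto simp: algebra_simps)
qed

lemma holo_on_mult:
  assumes "holo_on U f" "holo_on U g"
  shows "holo_on U (\<lambda>z. f z * g z)"
  unfolding holo_on_def
proof
  fix z assume "z \<in> U"
  then obtain L L' where "(f has_derivative L) (at z)" "\<forall>c x. L (c *s x) = c * L x"
    "(g has_derivative L') (at z)" "\<forall>c x. L' (c *s x) = c * L' x"
    using assms unfolding holo_on_def by metis
  then show "\<exists>L. ((\<lambda>z. f z * g z) has_derivative L) (at z) \<and> (\<forall>c x. L (c *s x) = c * L x)"
    by (intro exI[of _ "\<lambda>h. f z * L' h + L h * g z"])
       (intro conjI has_derivative_mult, auto simp: algebra_simps)
qed

text \<open>Complex linearity of \<open>L\<close> is exactly what turns the real derivative along a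
  complex line into a complex derivative: \<open>L (h *s b) = h * L b\<close>.\<close>

lemma holo_slice_deriv:
  fixes a b :: "complex ^ 'n"
  assumes f: "(f has_derivative L) (at (a + x *s b))" and L: "\<forall>c x. L (c *s x) = c * L x"
  shows "((\<lambda>x. f (a + x *s b)) has_field_derivative L b) (at x)"
proof -
  have "((\<lambda>x. a + x *s b) has_derivative (\<lambda>h. h *s b)) (at x)"
    using linear_vector_scalar_mult_left[of b]
    by (auto intro!: derivative_eq_intros bounded_linear_imp_has_derivative simp: linear_linear)
  from has_derivative_compose[OF this f]
  have "((\<lambda>x. f (a + x *s b)) has_derivative (\<lambda>h. L (h *s b))) (at x)" by simp
  then show ?thesis
    using L by (simp add: has_field_derivative_def mult_commute_abs)
qed

lemma holo_slice:
  fixes a b :: "complex ^ 'n"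
  assumes f: "holo_on U f" and S: "\<And>x. x \<in> S \<Longrightarrow> a + x *s b \<in> U"
  shows "(\<lambda>x. f (a + x *s b)) holomorphic_on S"
  unfolding holomorphic_on_def field_differentiable_def
proof
  fix x assume "x \<in> S"
  then obtain L where "(f has_derivative L) (at (a + x *s b))" "\<forall>c x. L (c *s x) = c * L x"
    using f S unfolding holo_on_def by metis
  from holo_slice_deriv[OF this]
  show "\<exists>f'. ((\<lambda>x. f (a + x *s b)) has_field_derivative f') (at x within S)"
    using DERIV_subset by blast
qed

text \<open>Cauchy's inequality in one variable, on the complex line through \<open>z\<close> in the
  direction \<open>h\<close>.\<close>

lemma holo_derivative_bound:
  fixes z h :: "complex ^ 'n"
  assumes f: "holo_on U f" and \<rho>: "\<rho> > 0" and sub: "cball z \<rho> \<subseteq> U"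
    and B: "\<And>y. y \<in> cball z \<rho> \<Longrightarrow> cmod (f y) \<le> B"
    and L: "(f has_derivative L) (at z)" "\<forall>c x. L (c *s x) = c * L x"
  shows "cmod (L h) \<le> B / \<rho> * norm h"
proof (cases "h = 0")
  case True
  then have "L h = 0" using L(2)[rule_format, of 0 h] by simp
  then show ?thesis using True by simp
next
  case False
  define b where "b = complex_of_real (1 / norm h) *s h"
  have nb: "norm b = 1" unfolding b_def using False by (simp add: norm_vector_scalar_mult norm_divide)
  define g where "g x = f (z + x *s b)" for x
  have inb: "z + x *s b \<in> cball z \<rho>" if "x \<in> cball 0 \<rho>" for x
    using that nb by (simp add: dist_norm norm_vector_scalar_mult)
  have gh: "g holomorphic_on cball 0 \<rho>"
    unfolding g_def using inb sub by (intro holo_slice[OF f]) blast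
  have "(g has_field_derivative L b) (at 0)"
    unfolding g_def using holo_slice_deriv[of f L z 0 b] L by simp
  then have dg: "deriv g 0 = L b" by (rule DERIV_imp_deriv)
  have "norm ((deriv ^^ 1) g 0) \<le> fact 1 * B / \<rho> ^ 1"
  proof (rule Cauchy_inequality)
    show "g holomorphic_on ball 0 \<rho>" using gh by (rule holomorphic_on_subset) auto
    show "continuous_on (cball 0 \<rho>) g" using gh by (rule holomorphic_on_imp_continuous_on)
    fix x :: complex assume "norm (0 - x) = \<rho>"
    then show "norm (g x) \<le> B" using B[OF inb[of x]] by (simp add: g_def)
  qed fact
  then have Lb: "cmod (L b) \<le> B / \<rho>" by (simp add: dg)
  have "h = complex_of_real (norm h) *s b"
    using False by (simp add: b_def vec_eq_iff)
  then have "L h = complex_of_real (norm h) * L b" using L(2) by metis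
  then have "cmod (L h) = cmod (L b) * norm h" by (simp add: norm_mult)
  also have "\<dots> \<le> B / \<rho> * norm h" using Lb by (rule mult_right_mono) simp
  finally show ?thesis .
qed

section \<open>Elements of the Bergman space and bounds for their values at points\<close>

lemma bergman_holo: "f \<in> bergman \<Longrightarrow> holo_on (ball 0 1) f"
  by (simp add: bergman_def unit_ball_def)

lemma bergman_zero: "f \<in> bergman \<Longrightarrow> norm z \<ge> 1 \<Longrightarrow> f z = 0"
  by (simp add: bergman_def unit_ball_def)

lemma holo_measurable:
  assumes "holo_on (ball 0 1) f" "\<And>z. norm z \<ge> 1 \<Longrightarrow> f z = 0"
  shows "f \<in> borel_measurable borel"
proof -
  have "(\<lambda>z. indicator (ball 0 1) z *\<^sub>R f z) \<in> borel_measurable borel"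
    by (rule borel_measurable_continuous_on_indicator) (use assms holo_on_continuous_on in auto)
  also have "(\<lambda>z. indicator (ball 0 1) z *\<^sub>R f z) = f"
    using assms(2) by (auto simp: indicator_def not_less)
  finally show ?thesis .
qed

lemma bergman_iff:
  "f \<in> bergman \<longleftrightarrow> holo_on (ball 0 1) f \<and> (\<forall>z. norm z \<ge> 1 \<longrightarrow> f z = 0) \<and> f \<in> L2 lborel"
proof (cases "holo_on (ball 0 1) f \<and> (\<forall>z. norm z \<ge> 1 \<longrightarrow> f z = 0)")
  case True
  then have m: "f \<in> borel_measurable borel" using holo_measurable by blast
  have "(\<integral>\<^sup>+ z\<in>unit_ball. ennreal ((cmod (f z))\<^sup>2) \<partial>lborel) = (\<integral>\<^sup>+ z. ennreal ((cmod (f z))\<^sup>2) \<partial>lborel)"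
    using True by (intro nn_integral_cong) (auto simp: indicator_def unit_ball_def)
  then show ?thesis
    using True m by (auto simp: bergman_def unit_ball_def L2_def integrable_iff_bounded)
qed (auto simp: bergman_def unit_ball_def)

lemma bergman_L2: "f \<in> bergman \<Longrightarrow> f \<in> L2 lborel"
  by (simp add: bergman_iff)

lemma bergman_measurable: "f \<in> bergman \<Longrightarrow> f \<in> borel_measurable borel"
  using bergman_L2 by (fastforce simp: L2_def)

lemma bergman_add: "f \<in> bergman \<Longrightarrow> g \<in> bergman \<Longrightarrow> (\<lambda>z. f z + g z) \<in> bergman"
  by (simp add: bergman_iff holo_on_add L2_add)

lemma bergman_cmult: "f \<in> bergman \<Longrightarrow> (\<lambda>z. c * f z) \<in> bergman"
  by (simp add: bergman_iff holo_on_mult holo_on_const L2_cmult)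

lemma bergman_diff:
  assumes "f \<in> bergman" "g \<in> bergman"
  shows "(\<lambda>z. f z - g z) \<in> bergman"
  using bergman_add[OF assms(1) bergman_cmult[OF assms(2), of "-1"]] by simp

lemma bergman_0: "(\<lambda>z. 0) \<in> bergman"
  by (simp add: bergman_iff holo_on_const L2_def)

lemma bergman_sum: "(\<And>i. i \<in> I \<Longrightarrow> f i \<in> bergman) \<Longrightarrow> (\<lambda>z. \<Sum>i\<in>I. f i z) \<in> bergman"
  by (induction I rule: infinite_finite_induct) (auto simp: bergman_0 bergman_add)

lemma nth_measurable [measurable]: "(\<lambda>z :: complex ^ 'n. z $ i) \<in> borel_measurable borel"
  by (intro borel_measurable_continuous_onI continuous_intros)

lemma cmod_nth_mult_le:
  assumes "f \<in> bergman"
  shows "cmod (z $ i * f z) \<le> cmod (f z)"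
proof (cases "norm z < 1")
  case True
  then have "cmod (z $ i) \<le> 1" using Finite_Cartesian_Product.norm_nth_le[of z i] by linarith
  then show ?thesis by (simp add: norm_mult mult_left_le_one_le)
next
  case False
  then show ?thesis using bergman_zero[OF assms, of z] by simp
qed

lemma mult_z_L2:
  assumes "f \<in> bergman"
  shows "(\<lambda>z. z $ i * f z) \<in> L2 lborel" "nsq lborel (\<lambda>z. z $ i * f z) \<le> nsq lborel f"
    "(\<lambda>z. cnj (z $ i) * f z) \<in> L2 lborel" "nsq lborel (\<lambda>z. cnj (z $ i) * f z) \<le> nsq lborel f"
proof -
  have *: "cmod (z $ i * f z) \<le> cmod (f z)" "cmod (cnj (z $ i) * f z) \<le> cmod (f z)" for z
    using cmod_nth_mult_le[OF assms, of z i] by (auto simp: norm_mult)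
  show "(\<lambda>z. z $ i * f z) \<in> L2 lborel" "nsq lborel (\<lambda>z. z $ i * f z) \<le> nsq lborel f"
    by (rule L2_mult_bounded[OF bergman_L2[OF assms] _ *(1)]; measurable)+
  show "(\<lambda>z. cnj (z $ i) * f z) \<in> L2 lborel" "nsq lborel (\<lambda>z. cnj (z $ i) * f z) \<le> nsq lborel f"
    by (rule L2_mult_bounded[OF bergman_L2[OF assms] _ *(2)]; measurable)+
qed

lemma bergman_mult_z:
  assumes "f \<in> bergman"
  shows "(\<lambda>z. z $ i * f z) \<in> bergman"
  using assms mult_z_L2[OF assms] by (simp add: bergman_iff holo_on_mult holo_on_nth)

lemma cis_scale_measurable:
  "(\<lambda>(t, z :: complex ^ 'n). cis t *s z) \<in> borel_measurable (borel \<Otimes>\<^sub>M borel)"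
  unfolding borel_prod split_beta'
  by (intro borel_measurable_continuous_onI continuous_intros)

lemma lborel_shift:
  fixes f :: "'a::euclidean_space \<Rightarrow> real"
  assumes "integrable lborel f"
  shows "integrable lborel (\<lambda>u. f (a + u))" "(LINT u|lborel. f (a + u)) = (LINT u|lborel. f u)"
proof -
  have m: "f \<in> borel_measurable borel" using borel_measurable_integrable[OF assms] by simp
  have "integrable (distr lborel borel ((+) a)) f" using assms by (simp add: lborel_distr_plus)
  then show "integrable lborel (\<lambda>u. f (a + u))"
    by (subst (asm) integrable_distr_eq) (use m in auto)
  show "(LINT u|lborel. f (a + u)) = (LINT u|lborel. f u)"
    using integral_distr[of "(+) a" lborel borel f] m by (simp add: lborel_distr_plus)
qed

text \<open>The mean value property is applied to \<open>f\<^sup>2\<close>, not to \<open>f\<close>.\<close>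
lemma bergman_submean:
  fixes f :: "'n::finite cfun"
  assumes f: "f \<in> bergman" and \<rho>: "\<rho> > 0" and sub: "cball z \<rho> \<subseteq> ball 0 1"
  shows "(cmod (f z))\<^sup>2 * measure lborel (ball (0 :: complex ^ 'n) \<rho>)
    \<le> (LINT u|lborel. indicator (ball 0 \<rho>) u * (cmod (f (z + u)))\<^sup>2)"
proof -
  let ?B = "ball (0 :: complex ^ 'n) \<rho>"
  define F where "F u = indicator ?B u *\<^sub>R (f (z + u) * f (z + u))" for u
  have [measurable]: "f \<in> borel_measurable borel" by (rule bergman_measurable[OF f])
  have [measurable]: "?B \<in> sets borel" by simp
  have i1: "integrable lborel (\<lambda>u. (cmod (f (z + u)))\<^sup>2)"
    by (rule lborel_shift(1)[OF L2_integrable[OF bergman_L2[OF f]]])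
  have bd: "norm (F u) \<le> (cmod (f (z + u)))\<^sup>2" for u
    by (auto simp: F_def indicator_def norm_mult power2_eq_square)
  have F: "integrable lborel F"
    by (rule Bochner_Integration.integrable_bound[OF i1]) (use bd in \<open>auto simp: F_def[abs_def] simp del: norm_scaleR\<close>)
  have cm: "circle_mean (\<lambda>t. F (cis t *s u)) = indicator ?B u *\<^sub>R (f z * f z)" for u
  proof (cases "u \<in> ?B")
    case True
    \<comment> \<open>The mean value property over the unit circle asks for holomorphy on a strictly
      larger disc. As \<open>u\<close> lies in the open ball, \<open>\<rho> / norm u > 1\<close>;
      for \<open>u = 0\<close> the function is constant and any radius above 1 will do.\<close>
    define R where "R = (if u = 0 then 2 else \<rho> / norm u)"
    have R: "R > 1" using True \<rho> by (auto simp: R_def field_simps)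
    have inb: "z + x *s u \<in> ball 0 1" if "x \<in> ball 0 R" for x
    proof -
      have "cmod x * norm u \<le> \<rho>"
        using that True \<rho> by (cases "u = 0") (auto simp: R_def field_simps)
      then have "z + x *s u \<in> cball z \<rho>" by (simp add: norm_vector_scalar_mult dist_norm)
      then show ?thesis using sub by blast
    qed
    have "(\<lambda>x. f (z + x *s u) * f (z + x *s u)) holomorphic_on ball 0 R"
      using holo_slice[OF bergman_holo[OF f], of "ball 0 R" z u] inb by (intro holomorphic_on_mult) auto
    from circle_mean_holomorphic[OF this R] show ?thesis
      using True by (simp add: F_def norm_vector_scalar_mult)
  next
    case False
    then show ?thesis
      by (simp add: F_def norm_vector_scalar_mult circle_mean_def set_lebesgue_integral_def)
  qed
  have "(LINT u|lborel. circle_mean (\<lambda>t. F (cis t *s u))) = (LINT u|lborel. F u)"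
    by (rule integral_circle_mean(2)[OF cis_scale_measurable linear_vector_scalar_mult _ F])
       (simp add: norm_vector_scalar_mult)
  then have "measure lborel ?B *\<^sub>R (f z * f z) = (LINT u|lborel. F u)"
    using emeasure_lborel_ball_finite[of "0 :: complex ^ 'n" \<rho>]
    by (simp add: cm integral_scaleR_left[OF integrable_real_indicator])
  then have "(cmod (f z))\<^sup>2 * measure lborel ?B = norm (LINT u|lborel. F u)"
    by (metis norm_mult norm_scaleR abs_of_nonneg measure_nonneg mult.commute power2_eq_square real_norm_def)
  also have "\<dots> \<le> (LINT u|lborel. norm (F u))" by (rule integral_norm_bound)
  also have "\<dots> = (LINT u|lborel. indicator ?B u * (cmod (f (z + u)))\<^sup>2)"
    by (simp add: F_def norm_mult power2_eq_square)
  finally show ?thesis .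
qed

lemma bergman_point_bound:
  fixes f :: "'n::finite cfun"
  assumes f: "f \<in> bergman" and \<rho>: "\<rho> > 0" and sub: "cball z \<rho> \<subseteq> ball 0 1"
  shows "(cmod (f z))\<^sup>2 * measure lborel (ball (0 :: complex ^ 'n) \<rho>) \<le> nsq lborel f"
proof -
  note i = lborel_shift[OF L2_integrable[OF bergman_L2[OF f]], of z]
  have "integrable lborel (\<lambda>u. indicator (ball 0 \<rho>) u *\<^sub>R (cmod (f (z + u)))\<^sup>2)"
    by (rule integrable_mult_indicator[OF _ i(1)]) simp
  then have "(LINT u|lborel. indicator (ball 0 \<rho>) u * (cmod (f (z + u)))\<^sup>2) \<le> (LINT u|lborel. (cmod (f (z + u)))\<^sup>2)"
    by (intro integral_mono i(1)) (auto simp: indicator_def)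
  then show ?thesis
    using bergman_submean[OF assms] by (simp add: i nsq_def)
qed

lemma bergman_local_bound:
  assumes "r < 1"
  obtains K where "K > 0"
    "\<And>f z. f \<in> (bergman :: 'n::finite cfun set) \<Longrightarrow> norm z \<le> r \<Longrightarrow> (cmod (f z))\<^sup>2 \<le> K * nsq lborel f"
proof
  define \<rho> where "\<rho> = (1 - r) / 2"
  have \<rho>: "\<rho> > 0" using assms by (simp add: \<rho>_def)
  define v where "v = measure lborel (ball (0 :: complex ^ 'n) \<rho>)"
  have v: "v > 0" unfolding v_def using content_ball_pos[OF \<rho>] by blast
  then show "1 / v > 0" by simp
  fix f :: "'n cfun" and z :: "complex ^ 'n" assume f: "f \<in> bergman" "norm z \<le> r"
  have "cball z \<rho> \<subseteq> ball 0 1"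
  proof
    fix y assume "y \<in> cball z \<rho>"
    then have "norm y \<le> norm z + \<rho>"
      by (metis dist_commute dist_norm mem_cball norm_triangle_sub add_left_mono order_trans)
    then show "y \<in> ball 0 1" using f assms by (simp add: \<rho>_def field_simps)
  qed
  from bergman_point_bound[OF f(1) \<rho> this]
  show "(cmod (f z))\<^sup>2 \<le> 1 / v * nsq lborel f" using v by (simp add: v_def field_simps)
qed

lemma bergman_eq_0:
  assumes "f \<in> bergman" "nsq lborel f = 0"
  shows "f z = 0"
proof (cases "norm z < 1")
  case True
  obtain K where "(cmod (f z))\<^sup>2 \<le> K * nsq lborel f"
    using bergman_local_bound[OF True] assms(1) by (metis order_refl)
  then show ?thesis using assms by simp
qed (use assms bergman_zero[of f z] in auto)

text \<open>The bounds \<open>c k\<close> may vary, as they do along a minimising sequence.\<close>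

lemma nsq_Fatou:
  assumes g: "\<And>k. g k \<in> L2 M" "\<And>k. nsq M (g k) \<le> c k" "c \<longlonglongrightarrow> C"
    and lim: "\<And>x. (\<lambda>k. g k x) \<longlonglongrightarrow> G x"
  shows "G \<in> L2 M" "nsq M G \<le> C"
proof -
  have gm [measurable]: "g k \<in> borel_measurable M" for k using g(1)[of k] by (simp add: L2_def)
  have Gm [measurable]: "G \<in> borel_measurable M"
    by (rule borel_measurable_LIMSEQ_metric[OF gm lim])
  have "(\<integral>\<^sup>+ x. ennreal ((cmod (G x))\<^sup>2) \<partial>M) = (\<integral>\<^sup>+ x. liminf (\<lambda>k. ennreal ((cmod (g k x))\<^sup>2)) \<partial>M)"
  proof (rule nn_integral_cong)
    fix x
    have "(\<lambda>k. ennreal ((cmod (g k x))\<^sup>2)) \<longlonglongrightarrow> ennreal ((cmod (G x))\<^sup>2)"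
      using lim by (intro tendsto_intros)
    then show "ennreal ((cmod (G x))\<^sup>2) = liminf (\<lambda>k. ennreal ((cmod (g k x))\<^sup>2))"
      by (intro lim_imp_Liminf[symmetric]) auto
  qed
  also have "\<dots> \<le> liminf (\<lambda>k. \<integral>\<^sup>+ x. ennreal ((cmod (g k x))\<^sup>2) \<partial>M)"
    by (rule nn_integral_liminf) measurable
  also have "\<dots> \<le> liminf (\<lambda>k. ennreal (c k))"
  proof (rule Liminf_mono, rule always_eventually, rule allI)
    fix k
    have "(\<integral>\<^sup>+ x. ennreal ((cmod (g k x))\<^sup>2) \<partial>M) = ennreal (nsq M (g k))"
      unfolding nsq_def by (rule nn_integral_eq_integral[OF L2_integrable[OF g(1)]]) simp
    then show "(\<integral>\<^sup>+ x. ennreal ((cmod (g k x))\<^sup>2) \<partial>M) \<le> ennreal (c k)"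
      using g(2) by (simp add: ennreal_leI)
  qed
  also have "\<dots> = ennreal C"
    using g(3) by (intro lim_imp_Liminf tendsto_intros) auto
  finally have *: "(\<integral>\<^sup>+ x. ennreal ((cmod (G x))\<^sup>2) \<partial>M) \<le> ennreal C" .
  then have "integrable M (\<lambda>x. (cmod (G x))\<^sup>2)"
    by (subst integrable_iff_bounded) (auto intro: le_less_trans)
  then show G: "G \<in> L2 M" by (simp add: L2_def)
  have "C \<ge> 0"
    by (rule LIMSEQ_le_const[OF g(3)]) (use g(2) order_trans[OF nsq_nonneg] in blast)
  moreover have "(\<integral>\<^sup>+ x. ennreal ((cmod (G x))\<^sup>2) \<partial>M) = ennreal (nsq M G)"
    unfolding nsq_def by (rule nn_integral_eq_integral[OF L2_integrable[OF G]]) simp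
  ultimately show "nsq M G \<le> C" using * by simp
qed

section \<open>Montel's theorem and orthogonal projections\<close>

text \<open>Locally uniform convergence on the ball: closed balls of radius below 1 exhaust its
  compact subsets.\<close>

definition loc_lim :: "(nat \<Rightarrow> 'n::finite cfun) \<Rightarrow> 'n cfun \<Rightarrow> bool" where
  "loc_lim u g \<longleftrightarrow> (\<forall>r<1. uniform_limit (cball 0 r) u g sequentially)"

lemma cball_shrink:
  fixes z :: "'a::real_normed_vector"
  assumes "norm z \<le> r" "r + \<rho> \<le> s"
  shows "cball z \<rho> \<subseteq> cball 0 s"
proof
  fix y assume "y \<in> cball z \<rho>"
  then have "norm (z - y) \<le> \<rho>" by (simp add: dist_norm)
  then have "norm y \<le> norm z + \<rho>" using norm_triangle_ineq4[of z "z - y"] by simp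
  then show "y \<in> cball 0 s" using assms by simp
qed

text \<open>Cauchy's inequality for the differences \<open>u m - u n\<close> makes the derivatives
  uniformly Cauchy on a smaller ball, so the sequence may be differentiated in the limit; complex
  linearity of the derivatives passes to their pointwise limit.\<close>

lemma holo_on_loc_lim:
  fixes u :: "nat \<Rightarrow> 'n::finite cfun"
  assumes u: "\<And>k. holo_on (ball 0 1) (u k)" and lim: "loc_lim u g"
  shows "holo_on (ball 0 1) g"
proof -
  define D where "D k z = (SOME L. (u k has_derivative L) (at z) \<and> (\<forall>c x. L (c *s x) = c * L x))" for k z
  have D': "(u k has_derivative D k z) (at z) \<and> (\<forall>c x. D k z (c *s x) = c * D k z x)" if "z \<in> ball 0 1" for k z
  proof -
    have "\<exists>L. (u k has_derivative L) (at z) \<and> (\<forall>c x. L (c *s x) = c * L x)"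
      using u[of k] that unfolding holo_on_def by blast
    from someI_ex[OF this] show ?thesis unfolding D_def .
  qed
  have D: "(u k has_derivative D k z) (at z)" "D k z (c *s x) = c * D k z x" if "z \<in> ball 0 1" for k z c x
    using D'[OF that, of k] by blast+
  show ?thesis
    unfolding holo_on_def
  proof
    fix z0 :: "complex ^ 'n" assume z0: "z0 \<in> ball 0 1"
    define r where "r = (norm z0 + 1) / 2"
    define \<rho> where "\<rho> = (1 - r) / 2"
    have r: "norm z0 < r" "r < 1" "0 < \<rho>" "r + \<rho> < 1"
      using z0 by (auto simp: r_def \<rho>_def field_simps)
    have ul: "uniform_limit (cball 0 (r + \<rho>)) u g sequentially"
      using lim r unfolding loc_lim_def by blast
    have cau: "\<exists>N. \<forall>m\<ge>N. \<forall>n\<ge>N. \<forall>z\<in>ball 0 r. \<forall>h. cmod (D m z h - D n z h) \<le> e * norm h" if "e > 0" for e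
    proof -
      have "\<forall>\<^sub>F n in sequentially. \<forall>x\<in>cball 0 (r + \<rho>). dist (u n x) (g x) < e * \<rho> / 2"
        using ul that r by (intro uniform_limitD) auto
      then obtain N where N: "\<And>n x. n \<ge> N \<Longrightarrow> x \<in> cball 0 (r + \<rho>) \<Longrightarrow> dist (u n x) (g x) < e * \<rho> / 2"
        unfolding eventually_sequentially by blast
      have "cmod (D m z h - D n z h) \<le> e * norm h" if mn: "m \<ge> N" "n \<ge> N" and z: "z \<in> ball 0 r" for m n z h
      proof -
        have sub: "cball z \<rho> \<subseteq> cball 0 (r + \<rho>)" using z by (intro cball_shrink[of z r]) auto
        have z1: "z \<in> ball 0 1" using z r by auto
        have d: "((\<lambda>x. u m x + -1 * u n x) has_derivative (\<lambda>h. D m z h + -1 * D n z h)) (at z)"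
          by (intro has_derivative_add has_derivative_mult_right D(1)[OF z1])
        have "cmod (D m z h + -1 * D n z h) \<le> (e * \<rho>) / \<rho> * norm h"
        proof (rule holo_derivative_bound[OF _ r(3) _ _ d])
          show "holo_on (ball 0 1) (\<lambda>x. u m x + -1 * u n x)"
            by (intro holo_on_add holo_on_mult holo_on_const u)
          show "cball z \<rho> \<subseteq> ball 0 1" using sub r(4) by force
          show "\<forall>c x. D m z (c *s x) + - 1 * D n z (c *s x) = c * (D m z x + - 1 * D n z x)"
            using D(2)[OF z1] by (simp add: algebra_simps)
          fix y assume "y \<in> cball z \<rho>"
          then have "dist (u m y) (g y) < e * \<rho> / 2" "dist (u n y) (g y) < e * \<rho> / 2"
            using N[OF mn(1)] N[OF mn(2)] sub by auto
          then have "dist (u m y) (u n y) < e * \<rho>"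
            using dist_triangle2[of "u m y" "u n y" "g y"] by linarith
          then show "cmod (u m y + - 1 * u n y) \<le> e * \<rho>" by (simp add: dist_norm)
        qed
        then show ?thesis using r by simp
      qed
      then show ?thesis by blast
    qed
    have conv: "convergent (\<lambda>n. D n z h)" if zr: "z \<in> ball 0 r" for z h
    proof (rule Cauchy_convergent, rule CauchyI)
      fix e :: real assume "e > 0"
      then have "e / (norm h + 1) > 0" by (simp add: add_nonneg_pos)
      from cau[OF this] obtain N where
        N: "\<forall>m\<ge>N. \<forall>n\<ge>N. \<forall>z\<in>ball 0 r. \<forall>h'. cmod (D m z h' - D n z h') \<le> e / (norm h + 1) * norm h'"
        by blast
      have "norm h + 1 > 0" by (simp add: add_nonneg_pos)
      then have "e / (norm h + 1) * norm h < e" using \<open>e > 0\<close> by (simp add: field_simps)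
      moreover have "norm (D m z h - D n z h) \<le> e / (norm h + 1) * norm h" if "m \<ge> N" "n \<ge> N" for m n
        using N that zr by blast
      ultimately show "\<exists>M. \<forall>m\<ge>M. \<forall>n\<ge>M. norm (D m z h - D n z h) < e"
        using le_less_trans by blast
    qed
    define g' where "g' z h = lim (\<lambda>n. D n z h)" for z h
    have g': "(\<lambda>n. D n z h) \<longlonglongrightarrow> g' z h" if "z \<in> ball 0 r" for z h
      unfolding g'_def using conv[OF that] by (simp add: convergent_LIMSEQ_iff)
    have z0r: "z0 \<in> ball 0 r" using r by simp
    have ptw: "(\<lambda>n. u n z) \<longlonglongrightarrow> g z" if "z \<in> ball 0 r" for z
      by (rule tendsto_uniform_limitI[OF ul]) (use that r in auto)
    have "\<exists>G. \<forall>x\<in>ball 0 r. (\<lambda>n. u n x) \<longlonglongrightarrow> G x \<and> (G has_derivative g' x) (at x within ball 0 r)"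
    proof (rule has_derivative_sequence[where S = "ball 0 r" and f = u and f' = D and g' = g' and ?x0.0 = z0 and l = "g z0"])
      show "convex (ball 0 r :: (complex ^ 'n) set)" by (rule convex_ball)
      show "z0 \<in> ball 0 r" by (rule z0r)
      show "(\<lambda>n. u n z0) \<longlonglongrightarrow> g z0" by (rule ptw[OF z0r])
      show "(u n has_derivative D n x) (at x within ball 0 r)" if "x \<in> ball 0 r" for n x
        by (rule has_derivative_at_withinI, rule D(1)) (use that r in auto)
      fix e :: real assume "e > 0"
      then obtain N where N: "\<forall>m\<ge>N. \<forall>n\<ge>N. \<forall>z\<in>ball 0 r. \<forall>h. cmod (D m z h - D n z h) \<le> e * norm h"
        using cau by blast
      have "cmod (D n x h - g' x h) \<le> e * norm h" if "n \<ge> N" "x \<in> ball 0 r" for n x h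
      proof (rule LIMSEQ_le_const2)
        show "(\<lambda>m. cmod (D n x h - D m x h)) \<longlonglongrightarrow> cmod (D n x h - g' x h)"
          by (rule tendsto_norm[OF tendsto_diff[OF tendsto_const g'[OF that(2)]]])
        show "\<exists>N. \<forall>m\<ge>N. cmod (D n x h - D m x h) \<le> e * norm h"
          using N that by (intro exI[of _ N]) blast
      qed
      then show "\<forall>\<^sub>F n in sequentially. \<forall>x\<in>ball 0 r. \<forall>h. norm (D n x h - g' x h) \<le> e * norm h"
        unfolding eventually_sequentially by (intro exI[of _ N]) simp
    qed
    then obtain G where G: "\<And>x. x \<in> ball 0 r \<Longrightarrow> (\<lambda>n. u n x) \<longlonglongrightarrow> G x"
      "\<And>x. x \<in> ball 0 r \<Longrightarrow> (G has_derivative g' x) (at x within ball 0 r)" by blast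
    have "G x = g x" if "x \<in> ball 0 r" for x using LIMSEQ_unique[OF G(1) ptw] that by blast
    then have "(g has_derivative g' z0) (at z0 within ball 0 r)"
      using has_derivative_transform[OF z0r _ G(2)[OF z0r], of g] by simp
    then have "(g has_derivative g' z0) (at z0)"
      using at_within_open[OF z0r] by simp
    moreover have "g' z0 (c *s x) = c * g' z0 x" for c x
    proof (rule LIMSEQ_unique[OF g'[OF z0r]])
      show "(\<lambda>n. D n z0 (c *s x)) \<longlonglongrightarrow> c * g' z0 x"
        unfolding D(2)[OF z0] by (rule tendsto_mult_left[OF g'[OF z0r]])
    qed
    ultimately show "\<exists>L. (g has_derivative L) (at z0) \<and> (\<forall>c x. L (c *s x) = c * L x)" by blast
  qed
qed

text \<open>Bounded point evaluation on a slightly larger ball and Cauchy's inequality bound the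
  derivative. This is the equicontinuity for Arzela-Ascoli.\<close>

lemma bergman_local_Lipschitz:
  assumes "r < 1"
  obtains K where "K > 0"
    "\<And>f x y. f \<in> (bergman :: 'n::finite cfun set) \<Longrightarrow> norm x \<le> r \<Longrightarrow> norm y \<le> r
       \<Longrightarrow> cmod (f x - f y) \<le> K * sqrt (nsq lborel f) * norm (x - y)"
proof -
  define \<rho> where "\<rho> = (1 - r) / 2"
  have \<rho>: "\<rho> > 0" "r + \<rho> < 1" using assms by (auto simp: \<rho>_def field_simps)
  obtain K where K: "K > 0" "\<And>f z. f \<in> (bergman :: 'n::finite cfun set) \<Longrightarrow> norm z \<le> r + \<rho> \<Longrightarrow> (cmod (f z))\<^sup>2 \<le> K * nsq lborel f"
    using bergman_local_bound[OF \<rho>(2)] by blast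
  show ?thesis
  proof
    show "sqrt K / \<rho> > 0" using K \<rho> by simp
    fix f :: "'n cfun" and x y :: "complex ^ 'n"
    assume f: "f \<in> bergman" and xy: "norm x \<le> r" "norm y \<le> r"
    define B where "B = sqrt K * sqrt (nsq lborel f)"
    have B0: "0 \<le> B" using K by (simp add: B_def)
    have B: "cmod (f z) \<le> B" if "norm z \<le> r + \<rho>" for z
    proof -
      have "(cmod (f z))\<^sup>2 \<le> B\<^sup>2" using K(2)[OF f that] K(1) by (simp add: B_def power_mult_distrib)
      then show ?thesis using B0 by (rule power2_le_imp_le)
    qed
    have "\<forall>z. \<exists>L. z \<in> ball 0 1 \<longrightarrow> (f has_derivative L) (at z) \<and> (\<forall>c x. L (c *s x) = c * L x)"
      using bergman_holo[OF f] unfolding holo_on_def by meson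
    then obtain D where D: "\<And>z. z \<in> ball 0 1 \<Longrightarrow> (f has_derivative D z) (at z)"
      "\<And>z. z \<in> ball 0 1 \<Longrightarrow> (\<forall>c x. D z (c *s x) = c * D z x)"
      by metis
    have "norm (f x - f y) \<le> (B / \<rho>) * norm (x - y)"
    proof (rule differentiable_bound[OF convex_cball[of 0 r]])
      fix z :: "complex ^ 'n" assume z: "z \<in> cball 0 r"
      have z1: "z \<in> ball 0 1" using z assms by auto
      show "(f has_derivative D z) (at z within cball 0 r)" using D(1)[OF z1] by (rule has_derivative_at_withinI)
      have sub: "cball z \<rho> \<subseteq> cball 0 (r + \<rho>)" using z by (intro cball_shrink[of z r]) auto
      show "onorm (D z) \<le> B / \<rho>"
      proof (rule onorm_le)
        fix h
        show "norm (D z h) \<le> B / \<rho> * norm h"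
          by (rule holo_derivative_bound[OF bergman_holo[OF f] \<rho>(1) _ _ D(1)[OF z1] D(2)[OF z1]])
             (use sub \<rho>(2) B in \<open>force+\<close>)
      qed
    qed (use xy in auto)
    then show "cmod (f x - f y) \<le> sqrt K / \<rho> * sqrt (nsq lborel f) * norm (x - y)"
      by (simp add: B_def)
  qed
qed

lemma bergman_Montel_cball:
  fixes u :: "nat \<Rightarrow> 'n::finite cfun"
  assumes u: "\<And>k. u k \<in> bergman" "\<And>k. nsq lborel (u k) \<le> B" and "r < 1"
  obtains g k where "strict_mono (k :: nat \<Rightarrow> nat)"
    "\<And>e. 0 < e \<Longrightarrow> \<exists>N. \<forall>n x. n \<ge> N \<and> x \<in> cball 0 r \<longrightarrow> norm (u (k n) x - g x) < e"
proof -
  have B: "B \<ge> 0" using u(2)[of 0] nsq_nonneg order_trans by blast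
  obtain K where K: "K > 0" "\<And>f z. f \<in> (bergman :: 'n::finite cfun set) \<Longrightarrow> norm z \<le> r \<Longrightarrow> (cmod (f z))\<^sup>2 \<le> K * nsq lborel f"
    using bergman_local_bound[OF \<open>r < 1\<close>] by blast
  obtain L where L: "L > 0"
    "\<And>f x y. f \<in> (bergman :: 'n::finite cfun set) \<Longrightarrow> norm x \<le> r \<Longrightarrow> norm y \<le> r
       \<Longrightarrow> cmod (f x - f y) \<le> L * sqrt (nsq lborel f) * norm (x - y)"
    using bergman_local_Lipschitz[OF \<open>r < 1\<close>] by blast
  have 1: "norm (u n x) \<le> sqrt (K * B)" if "x \<in> cball 0 r" for n x
  proof -
    have "(cmod (u n x))\<^sup>2 \<le> K * nsq lborel (u n)" using K(2)[OF u(1)] that by simp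
    also have "\<dots> \<le> K * B" using u(2) K(1) by simp
    finally show ?thesis by (rule real_le_rsqrt)
  qed
  have 2: "\<exists>d. 0 < d \<and> (\<forall>n y. y \<in> cball 0 r \<and> norm (x - y) < d \<longrightarrow> norm (u n x - u n y) < e)"
    if x: "x \<in> cball 0 r" and e: "0 < e" for x e
  proof (intro exI conjI allI impI)
    let ?C = "L * sqrt B + 1"
    have C: "?C > 0" using L(1) B by (simp add: add_nonneg_pos)
    show "0 < e / ?C" using C e by simp
    fix n y assume y: "y \<in> cball 0 r \<and> norm (x - y) < e / ?C"
    have "norm (u n x - u n y) \<le> L * sqrt (nsq lborel (u n)) * norm (x - y)"
      using L(2)[OF u(1)] x y by simp
    also have "\<dots> \<le> ?C * norm (x - y)"
    proof (rule mult_right_mono)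
      have "L * sqrt (nsq lborel (u n)) \<le> L * sqrt B" using L(1) u(2) by simp
      then show "L * sqrt (nsq lborel (u n)) \<le> ?C" by linarith
    qed simp
    also have "\<dots> < e" using y C by (simp add: pos_less_divide_eq mult.commute)
    finally show "norm (u n x - u n y) < e" .
  qed
  from Arzela_Ascoli[OF compact_cball 1 2] show ?thesis
    using that by metis
qed

text \<open>Arzela-Ascoli on the balls of radius \<open>\<rho> i\<close>, which tend to 1, followed
  by a diagonal subsequence. The norm bound for the limit comes from Fatou's lemma, for which
  convergence is needed outside the ball too; there all terms are 0.\<close>

theorem bergman_Montel:
  fixes u :: "nat \<Rightarrow> 'n::finite cfun"
  assumes u: "\<And>k. u k \<in> bergman" "\<And>k. nsq lborel (u k) \<le> B"
  shows "\<exists>g r. strict_mono (r :: nat \<Rightarrow> nat) \<and> g \<in> bergman \<and> loc_lim (u \<circ> r) g \<and> nsq lborel g \<le> B \<and>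
    (\<forall>z. (\<lambda>k. u (r k) z) \<longlonglongrightarrow> g z)"
proof -
  define \<rho> where "\<rho> i = 1 - 1 / real (i + 2)" for i
  have \<rho>1: "\<rho> i < 1" for i by (simp add: \<rho>_def)
  define P where "P i s \<longleftrightarrow> (\<exists>g. \<forall>e>0. \<exists>N. \<forall>n\<ge>N. \<forall>x\<in>cball 0 (\<rho> i). norm (u (s n) x - g x) < e)"
    for i and s :: "nat \<Rightarrow> nat"
  have sub: "\<exists>k. strict_mono (k :: nat \<Rightarrow> nat) \<and> P i (s \<circ> k)" for i s
  proof -
    have "\<And>k. (u \<circ> s) k \<in> bergman" "\<And>k. nsq lborel ((u \<circ> s) k) \<le> B" using u by auto
    from bergman_Montel_cball[of "u \<circ> s", OF this \<rho>1[of i]] obtain k g where "strict_mono (k :: nat \<Rightarrow> nat)"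
      "\<And>e. 0 < e \<Longrightarrow> \<exists>N. \<forall>n x. n \<ge> N \<and> x \<in> cball 0 (\<rho> i) \<longrightarrow> norm ((u \<circ> s) (k n) x - g x) < e"
      by metis
    then show ?thesis unfolding P_def by (metis comp_apply)
  qed
  have PP: "P i (s \<circ> k2)" if P1: "P i (s \<circ> k1)" and k12: "\<And>j. N \<le> j \<Longrightarrow> \<exists>j'. j \<le> j' \<and> k2 j = k1 j'"
    for i s k1 k2 and N :: nat
  proof -
    obtain g where g: "\<And>e. e > 0 \<Longrightarrow> \<exists>N. \<forall>n\<ge>N. \<forall>x\<in>cball 0 (\<rho> i). norm (u (s (k1 n)) x - g x) < e"
      using P1 unfolding P_def by auto
    show ?thesis unfolding P_def
    proof (intro exI[of _ g] allI impI)
      fix e :: real assume "e > 0"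
      then obtain N' where N': "\<forall>n\<ge>N'. \<forall>x\<in>cball 0 (\<rho> i). norm (u (s (k1 n)) x - g x) < e" using g by blast
      show "\<exists>N. \<forall>n\<ge>N. \<forall>x\<in>cball 0 (\<rho> i). norm (u ((s \<circ> k2) n) x - g x) < e"
      proof (intro exI[of _ "max N N'"] allI impI)
        fix n assume "max N N' \<le> n"
        then obtain j' where "n \<le> j'" "k2 n = k1 j'" using k12[of n] by auto
        then show "\<forall>x\<in>cball 0 (\<rho> i). norm (u ((s \<circ> k2) n) x - g x) < e"
          using N' \<open>max N N' \<le> n\<close> by auto
      qed
    qed
  qed
  have "\<exists>r. strict_mono (r :: nat \<Rightarrow> nat) \<and> (\<forall>i. P i r)"
  proof (rule subsequence_diagonalization_lemma[of P id])
    show "\<exists>k. strict_mono (k :: nat \<Rightarrow> nat) \<and> P i (s \<circ> k)" for i s by (rule sub)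
    show "P i (s \<circ> k2)" if "P i (s \<circ> k1)" "\<And>j. N \<le> j \<Longrightarrow> \<exists>j'. j \<le> j' \<and> k2 j = k1 j'"
      for i s k1 k2 N using that by (rule PP)
    show "\<exists>r. strict_mono (r :: nat \<Rightarrow> nat) \<and> (\<forall>i. P i r)"
      if "strict_mono k" "\<And>i. P i (id \<circ> k)" for k using that by auto
  qed
  then obtain r where r: "strict_mono (r :: nat \<Rightarrow> nat)" "\<And>i. P i r" by blast
  then have "\<forall>i. \<exists>g. uniform_limit (cball 0 (\<rho> i)) (u \<circ> r) g sequentially"
    unfolding P_def uniform_limit_sequentially_iff dist_norm by simp
  then obtain G where G: "\<And>i. uniform_limit (cball 0 (\<rho> i)) (u \<circ> r) (G i) sequentially"
    by metis
  have ex: "\<exists>i. x \<le> \<rho> i" if x1: "x < 1" for x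
  proof -
    obtain i where "inverse (real (Suc i)) < 1 - x" using reals_Archimedean[of "1 - x"] x1 by auto
    moreover have "1 / real (i + 2) \<le> inverse (real (Suc i))" by (simp add: field_simps)
    ultimately show ?thesis by (intro exI[of _ i]) (simp add: \<rho>_def)
  qed
  \<comment> \<open>This pointwise limit glues the limits \<open>G i\<close> obtained on the single
    balls; outside the ball it is 0.\<close>
  define g where "g z = lim (\<lambda>k. u (r k) z)" for z
  have ptw: "(\<lambda>k. u (r k) z) \<longlonglongrightarrow> g z" for z
  proof (cases "norm z < 1")
    case True
    then obtain i where "z \<in> cball 0 (\<rho> i)" using ex by auto
    from tendsto_uniform_limitI[OF G this] have "convergent (\<lambda>k. u (r k) z)"
      by (auto simp: convergent_def)
    then show ?thesis by (simp add: g_def convergent_LIMSEQ_iff)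
  next
    case False
    then have "u (r k) z = 0" for k using bergman_zero[OF u(1)] by simp
    then show ?thesis by (simp add: g_def)
  qed
  have lim: "loc_lim (u \<circ> r) g"
    unfolding loc_lim_def
  proof (intro allI impI)
    fix s :: real assume "s < 1"
    then obtain i where i: "s \<le> \<rho> i" using ex by auto
    have "uniform_limit (cball 0 (\<rho> i)) (u \<circ> r) g sequentially"
    proof (rule uniform_limit_cong'[THEN iffD1, OF _ _ G[of i]])
      fix x :: "complex ^ 'n" assume "x \<in> cball 0 (\<rho> i)"
      from tendsto_uniform_limitI[OF G this] have "(\<lambda>k. u (r k) x) \<longlonglongrightarrow> G i x" by simp
      then show "G i x = g x" using ptw LIMSEQ_unique by blast
    qed simp
    then show "uniform_limit (cball 0 s) (u \<circ> r) g sequentially"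
      by (rule uniform_limit_on_subset) (use i in auto)
  qed
  have L: "g \<in> L2 lborel" "nsq lborel g \<le> B"
    by (rule nsq_Fatou[OF bergman_L2[OF u(1)] u(2) tendsto_const ptw])+
  have "g z = 0" if "norm z \<ge> 1" for z
    using bergman_zero[OF u(1) that] by (simp add: g_def)
  moreover have "holo_on (ball 0 1) g"
    by (rule holo_on_loc_lim[OF _ lim]) (simp add: bergman_holo u(1))
  ultimately have "g \<in> bergman"
    using L by (simp add: bergman_iff)
  with r(1) lim L(2) ptw show ?thesis by (intro exI[of _ g] exI[of _ r]) simp
qed

text \<open>The case \<open>M = {}\<close> is the whole Bergman space, so a single projection serves
  both for \<open>P\<close> and for the adjoints on the whole space.\<close>

definition bsub :: "(complex ^ 'n) set \<Rightarrow> 'n::finite cfun set" where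
  "bsub M = {f \<in> bergman. \<forall>w\<in>M. f w = 0}"

lemma bsub_empty: "bsub {} = bergman"
  by (simp add: bsub_def)

lemma bsub_bergman: "f \<in> bsub M \<Longrightarrow> f \<in> bergman"
  by (simp add: bsub_def)

lemma bsub_L2: "f \<in> bsub M \<Longrightarrow> f \<in> L2 lborel"
  by (simp add: bsub_def bergman_L2)

lemma bsub_add: "f \<in> bsub M \<Longrightarrow> g \<in> bsub M \<Longrightarrow> (\<lambda>z. f z + g z) \<in> bsub M"
  by (simp add: bsub_def bergman_add)

lemma bsub_diff: "f \<in> bsub M \<Longrightarrow> g \<in> bsub M \<Longrightarrow> (\<lambda>z. f z - g z) \<in> bsub M"
  by (simp add: bsub_def bergman_diff)

lemma bsub_cmult: "f \<in> bsub M \<Longrightarrow> (\<lambda>z. c * f z) \<in> bsub M"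
  by (simp add: bsub_def bergman_cmult)

lemma bsub_mult_z: "f \<in> bsub M \<Longrightarrow> (\<lambda>z. z $ i * f z) \<in> bsub M"
  by (simp add: bsub_def bergman_mult_z)

text \<open>A minimising sequence has a locally uniform limit, which is a minimiser by Fatou's lemma; so the
  projection theorem needs no completeness.\<close>
lemma bsub_projection:
  assumes \<phi>: "\<phi> \<in> L2 lborel"
  shows "\<exists>h. h \<in> bsub M \<and> (\<forall>f\<in>bsub M. ip lborel f \<phi> = ip lborel f h)"
proof -
  define I where "I = (INF f\<in>bsub M. nsq lborel (\<lambda>z. \<phi> z - f z))"
  have ne: "bsub M \<noteq> {}" using bergman_0 by (auto simp: bsub_def)
  have bdd: "bdd_below ((\<lambda>f. nsq lborel (\<lambda>z. \<phi> z - f z)) ` bsub M)"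
    by (rule bdd_belowI[of _ 0]) auto
  have I: "I \<le> nsq lborel (\<lambda>z. \<phi> z - f z)" if "f \<in> bsub M" for f
    unfolding I_def by (rule cINF_lower[OF bdd that])
  have "\<exists>f\<in>bsub M. nsq lborel (\<lambda>z. \<phi> z - f z) < I + 1 / real (Suc k)" for k
    using cInf_lessD[of "(\<lambda>f. nsq lborel (\<lambda>z. \<phi> z - f z)) ` bsub M" "I + 1 / real (Suc k)"] ne
    by (auto simp: I_def)
  then obtain u where u: "\<And>k. u k \<in> bsub M" "\<And>k. nsq lborel (\<lambda>z. \<phi> z - u k z) < I + 1 / real (Suc k)"
    by metis
  have bnd: "nsq lborel (u k) \<le> 2 * nsq lborel \<phi> + 2 * (I + 1)" for k
  proof -
    have "nsq lborel (u k) = nsq lborel (\<lambda>z. \<phi> z + (u k z - \<phi> z))" by simp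
    also have "\<dots> \<le> (1 + 1) * nsq lborel \<phi> + (1 + 1 / 1) * nsq lborel (\<lambda>z. u k z - \<phi> z)"
      by (rule nsq_add_le[OF \<phi> L2_minus[OF bsub_L2[OF u(1)] \<phi>]]) simp
    also have "nsq lborel (\<lambda>z. u k z - \<phi> z) \<le> I + 1"
    proof -
      have "1 / real (Suc k) \<le> 1" by simp
      then show ?thesis using u(2)[of k] by (subst nsq_minus_commute) linarith
    qed
    finally show ?thesis by simp
  qed
  obtain h r where h: "strict_mono (r :: nat \<Rightarrow> nat)" "h \<in> bergman" "\<forall>z. (\<lambda>k. u (r k) z) \<longlonglongrightarrow> h z"
    using bergman_Montel[of u, OF bsub_bergman[OF u(1)] bnd] by auto
  have "h w = 0" if "w \<in> M" for w
  proof -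
    have "u (r k) w = 0" for k using u(1)[of "r k"] that by (simp add: bsub_def)
    then show ?thesis using h(3)[rule_format, of w] by (simp add: LIMSEQ_const_iff)
  qed
  then have hM: "h \<in> bsub M" using h(2) by (simp add: bsub_def)
  have min: "nsq lborel (\<lambda>z. \<phi> z - h z) \<le> I"
  proof (rule nsq_Fatou(2))
    show "(\<lambda>z. \<phi> z - u (r k) z) \<in> L2 lborel" for k by (rule L2_minus[OF \<phi> bsub_L2[OF u(1)]])
    show "nsq lborel (\<lambda>z. \<phi> z - u (r k) z) \<le> I + 1 / real (Suc (r k))" for k using u(2)[of "r k"] by simp
    have "((\<lambda>k. I + 1 / real (Suc k)) \<circ> r) \<longlonglongrightarrow> I + 0"
      by (rule LIMSEQ_subseq_LIMSEQ[OF tendsto_add[OF tendsto_const LIMSEQ_Suc[OF lim_1_over_n]] h(1)])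
    then show "(\<lambda>k. I + 1 / real (Suc (r k))) \<longlonglongrightarrow> I" by (simp add: o_def)
    show "(\<lambda>k. \<phi> z - u (r k) z) \<longlonglongrightarrow> \<phi> z - h z" for z by (rule tendsto_diff[OF tendsto_const h(3)[rule_format]])
  qed
  have "ip lborel f \<phi> = ip lborel f h" if f: "f \<in> bsub M" for f
  proof -
    have "ip lborel f (\<lambda>z. \<phi> z - h z) = 0"
    proof (rule ip_eq_0_if_minimal)
      fix c
      have "(\<lambda>z. h z + c * f z) \<in> bsub M" by (intro bsub_add bsub_cmult f hM)
      from I[OF this] min show "nsq lborel (\<lambda>z. \<phi> z - h z) \<le> nsq lborel (\<lambda>z. \<phi> z - h z - c * f z)"
        by (simp add: algebra_simps)
    qed (rule bsub_L2[OF f], rule L2_minus[OF \<phi> bsub_L2[OF hM]])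
    then show ?thesis using f hM \<phi> by (simp add: ip_diff_right bsub_L2)
  qed
  with hM show ?thesis by blast
qed

text \<open>The projection acts on all of \<open>L2 lborel\<close>, since it will be applied to
  functions such as \<open>cnj (z $ i) * f z\<close>, which are not holomorphic.\<close>

definition proj :: "(complex ^ 'n) set \<Rightarrow> 'n::finite cfun \<Rightarrow> 'n cfun" where
  "proj M \<phi> = (SOME h. h \<in> bsub M \<and> (\<forall>f\<in>bsub M. ip lborel f \<phi> = ip lborel f h))"

lemma proj:
  assumes "\<phi> \<in> L2 lborel"
  shows proj_in: "proj M \<phi> \<in> bsub M"
    and ip_proj: "\<And>f. f \<in> bsub M \<Longrightarrow> ip lborel f (proj M \<phi>) = ip lborel f \<phi>"
  using someI_ex[OF bsub_projection[OF assms, of M]] unfolding proj_def by auto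

text \<open>The difference of two candidates is orthogonal to itself. Norm 0 forces it to vanish at
  every point, because evaluations are bounded; so the equality is one of functions.\<close>

lemma proj_unique:
  assumes "\<phi> \<in> L2 lborel" "h \<in> bsub M" "\<And>f. f \<in> bsub M \<Longrightarrow> ip lborel f h = ip lborel f \<phi>"
  shows "proj M \<phi> = h"
proof
  fix z
  define d where "d = (\<lambda>z. proj M \<phi> z - h z)"
  have d: "d \<in> bsub M" unfolding d_def using assms proj_in by (intro bsub_diff) auto
  have "ip lborel d d = ip lborel d (proj M \<phi>) - ip lborel d h"
    using d assms proj_in[OF assms(1)] unfolding d_def by (intro ip_diff_right bsub_L2)
  also have "\<dots> = 0" using assms d by (simp add: ip_proj)
  finally have "nsq lborel d = 0" by (simp add: ip_self)
  then show "proj M \<phi> z = h z" using bergman_eq_0[OF bsub_bergman[OF d]] by (simp add: d_def)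
qed

lemma nsq_proj:
  assumes "\<phi> \<in> L2 lborel"
  shows "nsq lborel (\<lambda>z. \<phi> z - proj M \<phi> z) = nsq lborel \<phi> - nsq lborel (proj M \<phi>)"
proof -
  have "ip lborel \<phi> (proj M \<phi>) = cnj (ip lborel (proj M \<phi>) \<phi>)" by (rule ip_commute)
  also have "\<dots> = complex_of_real (nsq lborel (proj M \<phi>))"
    by (simp add: ip_proj[OF assms proj_in[OF assms], symmetric] ip_self)
  finally show ?thesis
    using nsq_diff[OF assms bsub_L2[OF proj_in[OF assms]]] by simp
qed

section \<open>The adjoints of the coordinate multiplications\<close>

text \<open>\<open>Tad i\<close> is the adjoint of multiplication by \<open>z\<^sub>i\<close> on the whole Bergman space, i.e. the Toeplitz
  operator with symbol \<open>cnj z\<^sub>i\<close>.\<close>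
definition Tad :: "'n::finite \<Rightarrow> 'n cfun \<Rightarrow> 'n cfun" where
  "Tad i f = proj {} (\<lambda>z. cnj (z $ i) * f z)"

lemma Tad_bergman: "f \<in> bergman \<Longrightarrow> Tad i f \<in> bergman"
  using proj_in[OF mult_z_L2(3), of f "{}"] by (simp add: Tad_def bsub_empty)

lemma ip_mult_cnj: "ip M f (\<lambda>z. cnj (z $ i) * g z) = ip M (\<lambda>z. z $ i * f z) g"
  by (simp add: ip_def mult_ac)

lemma ip_Tad:
  assumes "f \<in> bergman" "g \<in> bergman"
  shows "ip lborel g (Tad i f) = ip lborel (\<lambda>z. z $ i * g z) f"
  using ip_proj[OF mult_z_L2(3)[OF assms(1)], of g "{}"] assms
  by (simp add: Tad_def bsub_empty ip_mult_cnj)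

text \<open>Inherited from the multiplications by taking adjoints. It supplies the symmetry of the
  tensor \<open>Tad j (Tad i f) z\<close> in the convexity step.\<close>

lemma Tad_commute:
  assumes "f \<in> bergman"
  shows "Tad i (Tad j f) = Tad j (Tad i f)"
proof -
  have "proj {} (\<lambda>z. cnj (z $ i) * Tad j f z) = Tad j (Tad i f)"
  proof (rule proj_unique)
    show "(\<lambda>z. cnj (z $ i) * Tad j f z) \<in> L2 lborel"
      by (rule mult_z_L2(3)[OF Tad_bergman[OF assms]])
    show "Tad j (Tad i f) \<in> bsub {}" using assms by (simp add: bsub_empty Tad_bergman)
    fix g :: "'a cfun" assume "g \<in> bsub {}"
    then have g: "g \<in> bergman" by (simp add: bsub_empty)
    show "ip lborel g (Tad j (Tad i f)) = ip lborel g (\<lambda>z. cnj (z $ i) * Tad j f z)"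
      by (simp add: ip_mult_cnj ip_Tad assms g Tad_bergman bergman_mult_z mult.left_commute)
  qed
  then show ?thesis by (simp add: Tad_def)
qed

section \<open>The row of multiplications, the column of adjoints, and the defect\<close>

lemma cmod_sum_mult_sq_le:
  "(cmod (\<Sum>i\<in>I. a i * b i))\<^sup>2 \<le> (\<Sum>i\<in>I. (cmod (a i))\<^sup>2) * (\<Sum>i\<in>I. (cmod (b i))\<^sup>2)"
proof -
  have "cmod (\<Sum>i\<in>I. a i * b i) \<le> (\<Sum>i\<in>I. cmod (a i) * cmod (b i))"
    using norm_sum[of "\<lambda>i. a i * b i" I] by (simp add: norm_mult)
  then have "(cmod (\<Sum>i\<in>I. a i * b i))\<^sup>2 \<le> (\<Sum>i\<in>I. cmod (a i) * cmod (b i))\<^sup>2"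
    by (rule power_mono) simp
  also have "\<dots> \<le> (\<Sum>i\<in>I. (cmod (a i))\<^sup>2) * (\<Sum>i\<in>I. (cmod (b i))\<^sup>2)"
    by (rule Cauchy_Schwarz_ineq_sum)
  finally show ?thesis .
qed

lemma sum_nsq_eq: "(\<And>i. i \<in> I \<Longrightarrow> f i \<in> L2 M) \<Longrightarrow>
    (\<Sum>i\<in>I. nsq M (f i)) = (LINT z|M. (\<Sum>i\<in>I. (cmod (f i z))\<^sup>2))"
  unfolding nsq_def by (subst Bochner_Integration.integral_sum) (auto intro: L2_integrable)

lemma sum_nsq_mult_cnj_le:
  fixes f :: "'n::finite cfun"
  assumes "f \<in> bergman"
  shows "(\<Sum>i\<in>UNIV. nsq lborel (\<lambda>z. cnj (z $ i) * f z)) \<le> nsq lborel f"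
proof -
  have "(\<Sum>i\<in>UNIV. (cmod (cnj (z $ i) * f z))\<^sup>2) = (norm z)\<^sup>2 * (cmod (f z))\<^sup>2" for z
    by (simp add: norm_vec_sq norm_mult power_mult_distrib sum_distrib_right)
  also have "(norm z)\<^sup>2 * (cmod (f z))\<^sup>2 \<le> (cmod (f z))\<^sup>2" for z
  proof (cases "norm z < 1")
    case True
    then have "(norm z)\<^sup>2 \<le> 1" by (simp add: power_le_one)
    then show ?thesis by (simp add: mult_left_le_one_le)
  next
    case False
    then show ?thesis using bergman_zero[OF assms, of z] by simp
  qed
  finally have le: "(\<Sum>i\<in>UNIV. (cmod (cnj (z $ i) * f z))\<^sup>2) \<le> (cmod (f z))\<^sup>2" for z .
  show ?thesis
    unfolding sum_nsq_eq[OF mult_z_L2(3)[OF assms]]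
    unfolding nsq_def by (intro integral_mono le Bochner_Integration.integrable_sum L2_integrable mult_z_L2(3) bergman_L2 assms)
qed

text \<open>The quadratic form of \<open>I - \<Sum>\<^sub>i T\<^sub>i T\<^sub>i\<^sup>*\<close>; it dominates the Hankel operators with symbols \<open>cnj z\<^sub>i\<close>.\<close>
definition defect :: "'n::finite cfun \<Rightarrow> real" where
  "defect f = nsq lborel f - (\<Sum>i\<in>UNIV. nsq lborel (Tad i f))"

text \<open>The operator \<open>\<Sum>\<^sub>i T\<^sub>i T\<^sub>i\<^sup>*\<close>, the row of
  multiplications composed with the column of adjoints.\<close>

definition row_col :: "'n::finite cfun \<Rightarrow> 'n cfun" where
  "row_col f = (\<lambda>z. \<Sum>i\<in>UNIV. z $ i * Tad i f z)"

lemma row_col_bergman: "f \<in> bergman \<Longrightarrow> row_col f \<in> bergman"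
  unfolding row_col_def by (intro bergman_sum bergman_mult_z Tad_bergman)

text \<open>Pythagoras for the projection of each \<open>cnj (z $ i) * f z\<close>, together with
  \<open>norm z < 1\<close> on the ball. The left side is the total squared norm of the Hankel
  parts; its nonnegativity also shows that the column of adjoints is a contraction.\<close>

lemma sum_nsq_mult_cnj_minus_Tad_le:
  assumes "f \<in> bergman"
  shows "(\<Sum>i\<in>UNIV. nsq lborel (\<lambda>z. cnj (z $ i) * f z - Tad i f z)) \<le> defect f"
  using sum_nsq_mult_cnj_le[OF assms]
  by (simp add: Tad_def nsq_proj[OF mult_z_L2(3)[OF assms]] sum_subtractf defect_def)

lemma sum_nsq_Tad_le:
  assumes "f \<in> bergman"
  shows "(\<Sum>i\<in>UNIV. nsq lborel (Tad i f)) \<le> nsq lborel f"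
proof -
  have "0 \<le> (\<Sum>i\<in>UNIV. nsq lborel (\<lambda>z. cnj (z $ i) * f z - Tad i f z))" by (simp add: sum_nonneg)
  then show ?thesis using sum_nsq_mult_cnj_minus_Tad_le[OF assms] by (simp add: defect_def)
qed

lemma ip_sum_left:
  assumes "\<And>i. i \<in> I \<Longrightarrow> f i \<in> L2 M" "g \<in> L2 M"
  shows "ip M (\<lambda>z. \<Sum>i\<in>I. f i z) g = (\<Sum>i\<in>I. ip M (f i) g)"
  unfolding ip_def sum_distrib_right
  by (rule Bochner_Integration.integral_sum) (use assms ip_integrable in blast)

lemma ip_row_col:
  assumes "f \<in> bergman"
  shows "ip lborel (row_col f) f = of_real (\<Sum>i\<in>UNIV. nsq lborel (Tad i f))"
proof -
  have "ip lborel (row_col f) f = (\<Sum>i\<in>UNIV. ip lborel (\<lambda>z. z $ i * Tad i f z) f)"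
    unfolding row_col_def by (rule ip_sum_left) (auto intro!: bergman_L2 bergman_mult_z Tad_bergman assms)
  also have "\<dots> = (\<Sum>i\<in>UNIV. ip lborel (Tad i f) (Tad i f))"
    by (simp add: ip_Tad assms Tad_bergman)
  finally show ?thesis by (simp add: ip_self)
qed

lemma nsq_sum_mult_z_le:
  fixes h :: "'n::finite \<Rightarrow> 'n cfun"
  assumes h: "\<And>i. h i \<in> bergman"
  shows "nsq lborel (\<lambda>z. \<Sum>i\<in>UNIV. z $ i * h i z) \<le> (\<Sum>i\<in>UNIV. nsq lborel (h i))"
proof -
  have le: "(cmod (\<Sum>i\<in>UNIV. z $ i * h i z))\<^sup>2 \<le> (\<Sum>i\<in>UNIV. (cmod (h i z))\<^sup>2)" for z
  proof (cases "norm z < 1")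
    case True
    have "(cmod (\<Sum>i\<in>UNIV. z $ i * h i z))\<^sup>2 \<le> (norm z)\<^sup>2 * (\<Sum>i\<in>UNIV. (cmod (h i z))\<^sup>2)"
      using cmod_sum_mult_sq_le[of "\<lambda>i. z $ i" "\<lambda>i. h i z" UNIV] by (simp add: norm_vec_sq)
    also have "\<dots> \<le> (\<Sum>i\<in>UNIV. (cmod (h i z))\<^sup>2)"
      using True by (intro mult_left_le_one_le) (auto simp: sum_nonneg power_le_one)
    finally show ?thesis .
  next
    case False
    then have "h i z = 0" for i using bergman_zero[OF h, of z] by simp
    then show ?thesis by simp
  qed
  show ?thesis
    unfolding sum_nsq_eq[OF bergman_L2[OF h]]
    unfolding nsq_def by (intro integral_mono le Bochner_Integration.integrable_sum L2_integrable
        bergman_L2 h bergman_sum bergman_mult_z)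
qed

text \<open>Write \<open>A\<close> for \<open>row_col\<close>. As the row of multiplications is a
  contraction, the squared norm of \<open>A f\<close> is at most the inner product of
  \<open>A f\<close> and \<open>f\<close>; expanding the square leaves at most the inner product of
  \<open>f - A f\<close> and \<open>f\<close>, which is the defect.\<close>

lemma nsq_minus_row_col_le:
  assumes "f \<in> bergman"
  shows "nsq lborel (\<lambda>z. f z - row_col f z) \<le> defect f"
proof -
  have "ip lborel f (row_col f) = of_real (\<Sum>i\<in>UNIV. nsq lborel (Tad i f))"
    by (subst ip_commute) (simp add: ip_row_col[OF assms])
  then have "nsq lborel (\<lambda>z. f z - row_col f z)
     = nsq lborel f - 2 * (\<Sum>i\<in>UNIV. nsq lborel (Tad i f)) + nsq lborel (row_col f)"
    by (subst nsq_diff) (auto simp: assms bergman_L2 row_col_bergman)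
  moreover have "nsq lborel (row_col f) \<le> (\<Sum>i\<in>UNIV. nsq lborel (Tad i f))"
    unfolding row_col_def by (rule nsq_sum_mult_z_le) (rule Tad_bergman[OF assms])
  ultimately show ?thesis by (simp add: defect_def)
qed

section \<open>The complex line through a unit vector and the rotations fixing it\<close>

definition cip :: "complex ^ 'n \<Rightarrow> complex ^ 'n \<Rightarrow> complex" where
  "cip z w = (\<Sum>i\<in>UNIV. z $ i * cnj (w $ i))"

lemma cip_add_left: "cip (x + y) w = cip x w + cip y w"
  by (simp add: cip_def algebra_simps sum.distrib)

lemma cip_diff_left: "cip (x - y) w = cip x w - cip y w"
  by (simp add: cip_def algebra_simps sum_subtractf)

lemma cip_scale_left: "cip (c *s x) w = c * cip x w"
  by (simp add: cip_def sum_distrib_left mult_ac)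

lemma cip_commute: "cip x y = cnj (cip y x)"
  by (simp add: cip_def mult.commute)

lemma cip_add_right: "cip w (x + y) = cip w x + cip w y"
  by (simp add: cip_def algebra_simps sum.distrib)

lemma cip_scale_right: "cip w (c *s x) = cnj c * cip w x"
  by (simp add: cip_def sum_distrib_left mult_ac)

lemma cip_self: "cip z z = of_real ((norm z)\<^sup>2)"
  unfolding cip_def norm_vec_sq of_real_sum complex_norm_square ..

lemma cmod_cip_le: "cmod (cip z w) \<le> norm z * norm w"
proof -
  have "(cmod (cip z w))\<^sup>2 \<le> (norm z * norm w)\<^sup>2"
    unfolding cip_def using cmod_sum_mult_sq_le[of "\<lambda>i. z $ i" "\<lambda>i. cnj (w $ i)" UNIV]
    by (simp add: norm_vec_sq power_mult_distrib)
  then show ?thesis by (rule power2_le_imp_le) simp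
qed

lemma norm_orthogonal_sq:
  assumes "norm w = 1" "cip y w = 0"
  shows "(norm (x *s w + y))\<^sup>2 = (cmod x)\<^sup>2 + (norm y)\<^sup>2"
proof -
  have "cip w y = 0" using cip_commute[of w y] assms by simp
  then have "cip (x *s w + y) (x *s w + y) = x * cnj x + cip y y"
    using assms by (simp add: cip_add_left cip_add_right cip_scale_left cip_scale_right cip_self[of w])
  also have "\<dots> = of_real ((cmod x)\<^sup>2 + (norm y)\<^sup>2)"
    by (simp only: complex_norm_square cip_self of_real_add)
  finally have "cip (x *s w + y) (x *s w + y) = of_real ((cmod x)\<^sup>2 + (norm y)\<^sup>2)" .
  then show ?thesis unfolding cip_self by (simp only: of_real_eq_iff)
qed

text \<open>For a unit vector \<open>w\<close>, the unitary map that fixes the line of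
  \<open>w\<close> and multiplies its orthogonal complement by \<open>cis t\<close>.\<close>

definition rot :: "complex ^ 'n \<Rightarrow> real \<Rightarrow> complex ^ 'n \<Rightarrow> complex ^ 'n" where
  "rot w t z = cip z w *s w + cis t *s (z - cip z w *s w)"

lemma linear_rot: "linear (rot w t)"
proof (rule linearI)
  show "rot w t (x + y) = rot w t x + rot w t y" for x y
    by (simp add: rot_def vec_eq_iff cip_add_left algebra_simps)
  have "cip (r *\<^sub>R x) w = r *\<^sub>R cip x w" for r x
    by (simp add: cip_def scaleR_sum_right)
  then show "rot w t (r *\<^sub>R x) = r *\<^sub>R rot w t x" for r x
    by (simp add: rot_def vec_eq_iff algebra_simps)
qed

lemma cip_complement:
  assumes "norm w = 1"
  shows "cip (c *s (z - cip z w *s w)) w = 0"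
  using assms by (simp add: cip_scale_left cip_diff_left cip_self)

lemma cip_rot: "norm w = 1 \<Longrightarrow> cip (rot w t z) w = cip z w"
  unfolding rot_def cip_add_left by (simp only: cip_complement) (simp add: cip_scale_left cip_self)

lemma norm_slice_sq:
  assumes "norm w = 1"
  shows "(norm (cip z w *s w + c *s (z - cip z w *s w)))\<^sup>2
    = (cmod (cip z w))\<^sup>2 + (cmod c)\<^sup>2 * (norm (z - cip z w *s w))\<^sup>2"
  by (simp only: norm_orthogonal_sq[OF assms cip_complement[OF assms]] norm_vector_scalar_mult power_mult_distrib)

lemma norm_rot:
  assumes "norm w = 1"
  shows "norm (rot w t z) = norm z"
proof -
  have "(norm (rot w t z))\<^sup>2 = (norm (cip z w *s w + 1 *s (z - cip z w *s w)))\<^sup>2"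
    unfolding rot_def norm_slice_sq[OF assms] by simp
  then show ?thesis by simp
qed

lemma continuous_on_cip [continuous_intros]:
  fixes f :: "'a::topological_space \<Rightarrow> complex ^ 'n"
  shows "continuous_on S f \<Longrightarrow> continuous_on S (\<lambda>z. cip (f z) w)"
  unfolding cip_def by (intro continuous_intros)

lemma rot_measurable:
  "(\<lambda>(t, z :: complex ^ 'n). rot w t z) \<in> borel_measurable (borel \<Otimes>\<^sub>M borel)"
  unfolding borel_prod split_beta' rot_def
  by (intro borel_measurable_continuous_onI continuous_intros)

section \<open>Powers of linear forms and Taylor coefficients along a line\<close>

lemma holo_on_cong:
  assumes f: "holo_on U f" and "open U" "\<And>z. z \<in> U \<Longrightarrow> f z = g z"
  shows "holo_on U g"
  unfolding holo_on_def
proof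
  fix z assume "z \<in> U"
  then obtain L where "(f has_derivative L) (at z)" "\<forall>c x. L (c *s x) = c * L x"
    using f unfolding holo_on_def by blast
  moreover have "(g has_derivative L) (at z)"
    by (rule has_derivative_transform_within_open[OF calculation(1) \<open>open U\<close> \<open>z \<in> U\<close>]) (use assms in auto)
  ultimately show "\<exists>L. (g has_derivative L) (at z) \<and> (\<forall>c x. L (c *s x) = c * L x)" by blast
qed

lemma holo_on_sum: "(\<And>i. i \<in> I \<Longrightarrow> holo_on U (f i)) \<Longrightarrow> holo_on U (\<lambda>z. \<Sum>i\<in>I. f i z)"
  by (induction I rule: infinite_finite_induct) (auto simp: holo_on_const holo_on_add)

lemma holo_on_power: "holo_on U f \<Longrightarrow> holo_on U (\<lambda>z. f z ^ m)"
  by (induction m) (auto simp: holo_on_const holo_on_mult)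

text \<open>Up to a positive factor, the element of the Bergman space that represents the
  \<open>m\<close>-th Taylor coefficient along the line of \<open>w\<close>; see
  \<open>ip_cpow\<close>.\<close>

definition cpow :: "complex ^ 'n \<Rightarrow> nat \<Rightarrow> 'n::finite cfun" where
  "cpow w m z = (if norm z < 1 then cip z w ^ m else 0)"

lemma cpow_bergman:
  fixes w :: "complex ^ 'n::finite"
  assumes "norm w = 1"
  shows "cpow w m \<in> bergman"
proof -
  have "holo_on (ball 0 1) (\<lambda>z. cip z w ^ m)"
    unfolding cip_def by (intro holo_on_power holo_on_sum holo_on_mult holo_on_nth holo_on_const)
  then have h: "holo_on (ball 0 1) (cpow w m)"
    by (rule holo_on_cong) (auto simp: cpow_def)
  have z: "cpow w m z = 0" if "norm z \<ge> 1" for z using that by (simp add: cpow_def)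
  have "cpow w m \<in> L2 lborel"
  proof (rule L2_I)
    show "cpow w m \<in> borel_measurable lborel" using holo_measurable[OF h z] by simp
    show "integrable lborel (indicator (ball 0 1) :: complex ^ 'n \<Rightarrow> real)"
      using emeasure_lborel_ball_finite[of "0 :: complex ^ 'n" 1] by (intro integrable_real_indicator) auto
    fix z
    have "cmod (cip z w) \<le> 1" if "norm z < 1" using cmod_cip_le[of z w] that assms by simp
    then show "(cmod (cpow w m z))\<^sup>2 \<le> indicator (ball 0 1) z"
      by (auto simp: cpow_def indicator_def norm_power power_le_one)
  qed
  with h z show ?thesis by (simp add: bergman_iff)
qed

definition slice :: "'n::finite cfun \<Rightarrow> complex ^ 'n \<Rightarrow> complex \<Rightarrow> complex" where
  "slice f w x = f (x *s w)"

lemma slice_holomorphic: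
  assumes "f \<in> bergman" "norm w = 1"
  shows "slice f w holomorphic_on ball 0 1"
  unfolding slice_def using holo_slice[OF bergman_holo[OF assms(1)], of "ball 0 1" 0 w] assms(2)
  by (simp add: norm_vector_scalar_mult)

text \<open>Averaging over the rotations fixing \<open>w\<close> replaces \<open>f\<close> by its restriction to the complex line through \<open>w\<close>;
  averaging over all scalar rotations then picks out one Taylor coefficient of that restriction.\<close>
lemma ip_cpow:
  fixes w :: "complex ^ 'n::finite"
  assumes f: "f \<in> bergman" and w: "norm w = 1" and c: "power_coeffs c (slice f w) 1"
  shows "ip lborel f (cpow w m) = c m * of_real (nsq lborel (cpow w m))"
proof -
  define F where "F z = f z * cnj (cpow w m z)" for z
  define F1 where "F1 z = slice f w (cip z w) * cnj (cpow w m z)" for z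
  have cmod_cip: "cmod (cip z w) < 1" if "norm z < 1" for z
    using cmod_cip_le[of z w] that w by simp
  have F: "integrable lborel F" unfolding F_def
    by (rule ip_integrable[OF bergman_L2[OF f] bergman_L2[OF cpow_bergman[OF w]]])
  have cm0: "circle_mean (\<lambda>t. 0) = 0" by (simp add: circle_mean_def set_lebesgue_integral_def)
  have cmm: "circle_mean (\<lambda>t. g t * a) = circle_mean g * a" for g a
    by (simp add: circle_mean_def set_lebesgue_integral_def flip: mult_scaleR_left)
  have F1: "circle_mean (\<lambda>t. F (rot w t z)) = F1 z" for z
  proof (cases "norm z < 1")
    case True
    define y where "y = z - cip z w *s w"
    have nz: "(norm z)\<^sup>2 = (cmod (cip z w))\<^sup>2 + (norm y)\<^sup>2"
      using norm_slice_sq[OF w, of z 1] by (simp add: y_def)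
    have z1: "(norm z)\<^sup>2 < 1" using True by (simp add: power_less_one_iff)
    \<comment> \<open>By \<open>nz\<close> the point \<open>cip z w *s w + x *s y\<close> stays in
      the unit ball as long as \<open>cmod x * norm y\<close> is below
      \<open>sqrt (1 - (cmod (cip z w))\<^sup>2)\<close>, and \<open>norm y\<close> itself is
      strictly below it. So a disc of radius above 1 is available, as the mean value property
      asks.\<close>
    have "\<exists>R>1. \<forall>x\<in>ball 0 R. cip z w *s w + x *s y \<in> ball 0 1"
    proof (cases "y = 0")
      case True
      then show ?thesis using nz z1 w
        by (intro exI[of _ 2]) (auto simp: norm_vector_scalar_mult power_less_one_iff)
    next
      case False
      define R where "R = sqrt ((1 - (cmod (cip z w))\<^sup>2)) / norm y"
      have "(norm y)\<^sup>2 < 1 - (cmod (cip z w))\<^sup>2" using nz z1 by linarith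
      then have "norm y < sqrt (1 - (cmod (cip z w))\<^sup>2)" by (rule real_less_rsqrt)
      then have R1: "R > 1" using False by (simp add: R_def)
      have "norm (cip z w *s w + x *s y) < 1" if "x \<in> ball 0 R" for x
      proof -
        have "cmod x * norm y < sqrt (1 - (cmod (cip z w))\<^sup>2)"
          using that False by (simp add: R_def pos_less_divide_eq)
        then have "(cmod x * norm y)\<^sup>2 < (sqrt (1 - (cmod (cip z w))\<^sup>2))\<^sup>2"
          by (rule power_strict_mono) auto
        then have "(cmod x)\<^sup>2 * (norm y)\<^sup>2 < 1 - (cmod (cip z w))\<^sup>2"
          using cmod_cip[OF \<open>norm z < 1\<close>] by (simp add: power_mult_distrib power_le_one)
        then have "(norm (cip z w *s w + x *s y))\<^sup>2 < 1"
          using norm_slice_sq[OF w, of z x] by (simp add: y_def)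
        then show ?thesis by (simp add: power_less_one_iff)
      qed
      with R1 show ?thesis by (intro exI[of _ R]) auto
    qed
    then obtain R where R: "R > 1" "\<And>x. x \<in> ball 0 R \<Longrightarrow> cip z w *s w + x *s y \<in> ball 0 1" by blast
    have "circle_mean (\<lambda>t. f (cip z w *s w + cis t *s y)) = f (cip z w *s w + 0 *s y)"
      by (rule circle_mean_holomorphic[OF holo_slice[OF bergman_holo[OF f] R(2)] R(1)])
    then have "circle_mean (\<lambda>t. f (rot w t z)) = slice f w (cip z w)"
      by (simp add: rot_def y_def slice_def)
    then show ?thesis
      unfolding F_def F1_def by (simp add: cpow_def norm_rot[OF w] cip_rot[OF w] True cmm)
  qed (simp add: F_def F1_def cpow_def norm_rot[OF w] cm0)
  have i1: "integrable lborel F1" "(LINT z|lborel. F1 z) = (LINT z|lborel. F z)"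
    using integral_circle_mean[OF rot_measurable linear_rot norm_rot[OF w] F] by (auto simp: F1)
  have F2: "circle_mean (\<lambda>t. F1 (cis t *s z)) = c m * of_real ((cmod (cpow w m z))\<^sup>2)" for z
  proof (cases "norm z < 1")
    case True
    have "F1 (cis t *s z) = (slice f w (cip z w * cis t) * cis (- (real m * t))) * cnj (cpow w m z)" for t
      using True by (simp add: F1_def cpow_def norm_vector_scalar_mult cip_scale_left power_mult_distrib
          Complex.DeMoivre cis_cnj mult_ac)
    then have "circle_mean (\<lambda>t. F1 (cis t *s z)) = c m * cip z w ^ m * cnj (cpow w m z)"
      using circle_mean_coeff[OF c cmod_cip[OF True]] by (simp add: cmm)
    also have "\<dots> = c m * of_real ((cmod (cpow w m z))\<^sup>2)"
      using True by (simp add: cpow_def complex_norm_square mult.assoc flip: of_real_power)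
    finally show ?thesis .
  qed (simp add: F1_def cpow_def norm_vector_scalar_mult cm0)
  have "ip lborel f (cpow w m) = (LINT z|lborel. F1 z)" by (simp add: i1 ip_def F_def)
  also have "\<dots> = (LINT z|lborel. circle_mean (\<lambda>t. F1 (cis t *s z)))"
    by (rule integral_circle_mean(2)[OF cis_scale_measurable linear_vector_scalar_mult _ i1(1), symmetric])
       (simp add: norm_vector_scalar_mult)
  also have "\<dots> = c m * of_real (nsq lborel (cpow w m))"
    unfolding F2 nsq_def by (simp flip: integral_complex_of_real)
  finally show ?thesis .
qed

section \<open>Compactness of the defect\<close>

lemma nsq_cpow_pos:
  fixes w :: "complex ^ 'n::finite"
  assumes "norm w = 1"
  shows "nsq lborel (cpow w m) > 0"
proof (rule ccontr)
  assume "\<not> ?thesis"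
  then have "nsq lborel (cpow w m) = 0" using nsq_nonneg[of lborel "cpow w m"] by linarith
  from bergman_eq_0[OF cpow_bergman[OF assms] this, of "(1/2) *s w"]
  show False using assms by (simp add: cpow_def norm_vector_scalar_mult cip_scale_left cip_self)
qed

text \<open>The ball of radius \<open>\<eta>\<close> around \<open>(1 - \<eta>) w\<close> lies in
  the unit ball, and on it \<open>cmod (cip z w)\<close> is at least \<open>1 - 2 * \<eta>\<close>.
  Since \<open>\<eta>\<close> is arbitrary, the norms of \<open>cpow w m\<close> decay more slowly
  than any geometric sequence.\<close>

lemma nsq_cpow_lower:
  fixes w :: "complex ^ 'n::finite"
  assumes w: "norm w = 1" and \<eta>: "0 < \<eta>" "\<eta> < 1/2"
  shows "((1 - 2 * \<eta>)\<^sup>2) ^ m * measure lborel (ball (0 :: complex ^ 'n) \<eta>) \<le> nsq lborel (cpow w m)"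
proof -
  define p where "p = complex_of_real (1 - \<eta>) *s w"
  have "((1 - 2 * \<eta>)\<^sup>2) ^ m * indicator (ball p \<eta>) z \<le> (cmod (cpow w m z))\<^sup>2" for z
  proof (cases "z \<in> ball p \<eta>")
    case True
    then have zp: "norm (z - p) < \<eta>" by (simp add: dist_norm norm_minus_commute)
    have np: "norm p = 1 - \<eta>" using w \<eta> by (simp add: p_def norm_vector_scalar_mult del: of_real_diff)
    have nz: "norm z < 1" using norm_triangle_ineq[of p "z - p"] zp np by simp
    have "cip z w = cip p w + cip (z - p) w" by (simp add: cip_diff_left)
    moreover have "cip p w = of_real (1 - \<eta>)" using w by (simp only: p_def cip_scale_left cip_self) simp
    moreover have "cmod (of_real (1 - \<eta>)) = 1 - \<eta>" using \<eta> by (simp del: of_real_diff)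
    moreover have "cmod (cip (z - p) w) < \<eta>" using cmod_cip_le[of "z - p" w] zp w by simp
    ultimately have "1 - 2 * \<eta> \<le> cmod (cip z w)"
      using norm_diff_ineq[of "cip p w" "cip (z - p) w"] by simp
    then have "((1 - 2 * \<eta>) ^ m)\<^sup>2 \<le> (cmod (cip z w) ^ m)\<^sup>2" using \<eta> by (intro power_mono) auto
    then show ?thesis using True nz by (simp add: cpow_def norm_power power_mult[symmetric] mult.commute)
  qed simp
  then have "(LINT z|lborel. ((1 - 2 * \<eta>)\<^sup>2) ^ m * indicator (ball p \<eta>) z) \<le> nsq lborel (cpow w m)"
    unfolding nsq_def using emeasure_lborel_ball_finite[of p \<eta>]
    by (intro integral_mono L2_integrable bergman_L2 cpow_bergman w integrable_mult_right integrable_real_indicator) auto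
  moreover have "measure lborel (ball p \<eta>) = measure lborel (ball (0 :: complex ^ 'n) \<eta>)"
    using \<eta> by (simp add: content_ball)
  ultimately show ?thesis by simp
qed

text \<open>With \<open>y = (cmod (cip z w))\<^sup>2\<close> the integrand on the ball is
  \<open>y ^ m * (1 - y)\<close>. Where \<open>y \<ge> r\<close> the second factor is at most
  \<open>1 - r\<close>, elsewhere the first is at most \<open>r ^ m\<close>.\<close>

lemma nsq_cpow_diff_le:
  fixes w :: "complex ^ 'n::finite"
  assumes w: "norm w = 1" and r: "0 \<le> r" "r \<le> 1"
  shows "nsq lborel (cpow w m) - nsq lborel (cpow w (Suc m))
     \<le> (1 - r) * nsq lborel (cpow w m) + r ^ m * measure lborel (ball (0 :: complex ^ 'n) 1)"
proof -
  have le: "(cmod (cpow w m z))\<^sup>2 - (cmod (cpow w (Suc m) z))\<^sup>2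
      \<le> (1 - r) * (cmod (cpow w m z))\<^sup>2 + r ^ m * indicator (ball 0 1) z" for z
  proof (cases "norm z < 1")
    case True
    define y where "y = (cmod (cip z w))\<^sup>2"
    have "cmod (cip z w) \<le> 1" using cmod_cip_le[of z w] w True by simp
    then have y: "0 \<le> y" "y \<le> 1" by (auto simp: y_def power_le_one)
    have e: "(cmod (cpow w k z))\<^sup>2 = y ^ k" for k
      using True by (simp add: cpow_def y_def norm_power power_mult[symmetric] mult.commute)
    have "y ^ m * (1 - y) \<le> (1 - r) * y ^ m + r ^ m"
    proof (cases "y \<ge> r")
      case True
      have "y ^ m * (1 - y) \<le> y ^ m * (1 - r)" using True y by (intro mult_left_mono) auto
      then show ?thesis using r by (simp add: mult.commute add_increasing2)
    next
      case False
      have "y ^ m * (1 - y) \<le> r ^ m * 1" using False y by (intro mult_mono power_mono) auto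
      moreover have "0 \<le> (1 - r) * y ^ m" using r y by simp
      ultimately show ?thesis by linarith
    qed
    then show ?thesis using True by (simp add: e algebra_simps)
  qed (simp add: cpow_def)
  note L = L2_integrable[OF bergman_L2[OF cpow_bergman[OF w]]]
  have i: "integrable lborel (indicator (ball 0 1) :: complex ^ 'n \<Rightarrow> real)"
    using emeasure_lborel_ball_finite[of "0 :: complex ^ 'n" 1] by (intro integrable_real_indicator) auto
  have "nsq lborel (cpow w m) - nsq lborel (cpow w (Suc m))
      = (LINT z|lborel. (cmod (cpow w m z))\<^sup>2 - (cmod (cpow w (Suc m) z))\<^sup>2)"
    unfolding nsq_def by (rule Bochner_Integration.integral_diff[OF L L, symmetric])
  also have "\<dots> \<le> (LINT z|lborel. (1 - r) * (cmod (cpow w m z))\<^sup>2 + r ^ m * indicator (ball 0 1) z)"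
    by (intro integral_mono le Bochner_Integration.integrable_diff Bochner_Integration.integrable_add
        integrable_mult_right L i)
  also have "\<dots> = (1 - r) * nsq lborel (cpow w m) + r ^ m * measure lborel (ball (0 :: complex ^ 'n) 1)"
    unfolding nsq_def by (subst Bochner_Integration.integral_add) (auto intro: L i)
  finally show ?thesis .
qed

text \<open>The two preceding bounds together: for \<open>r < r'\<close> the error
  \<open>r ^ m\<close> is negligible against the lower bound \<open>r' ^ m\<close> for the squared
  norm. All constants are independent of \<open>w\<close>, so one \<open>m0\<close> serves every
  complex line.\<close>

lemma nsq_cpow_ratio:
  assumes "\<epsilon> > 0"
  shows "\<exists>m0. \<forall>m\<ge>m0. \<forall>w :: complex ^ 'n::finite. norm w = 1 \<longrightarrow>
    nsq lborel (cpow w m) - nsq lborel (cpow w (Suc m)) \<le> \<epsilon> * nsq lborel (cpow w m)"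
proof -
  define e where "e = min \<epsilon> 1"
  have e: "0 < e" "e \<le> 1" "e \<le> \<epsilon>" using assms by (auto simp: e_def)
  \<comment> \<open>These choices give \<open>r' = (1 - e / 8)\<^sup>2 > 1 - e / 4 > r\<close>. The
    cap \<open>e \<le> 1\<close> keeps \<open>r\<close> nonnegative and \<open>\<eta>\<close> below
    1/2.\<close>
  define r where "r = 1 - e / 2"
  define \<eta> where "\<eta> = e / 16"
  define r' where "r' = (1 - 2 * \<eta>)\<^sup>2"
  have "r' = 1 - e / 4 + (e / 8)\<^sup>2" by (simp add: r'_def \<eta>_def power2_eq_square algebra_simps)
  moreover have "0 \<le> (e / 8)\<^sup>2" by simp
  ultimately have "r < r'" using e unfolding r_def by linarith
  then have rr: "0 \<le> r" "r \<le> 1" "r < r'" using e by (auto simp: r_def)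
  define v where "v = measure lborel (ball (0 :: complex ^ 'n) 1)"
  define v' where "v' = measure lborel (ball (0 :: complex ^ 'n) \<eta>)"
  have \<eta>: "0 < \<eta>" "\<eta> < 1/2" using e by (auto simp: \<eta>_def)
  have v': "v' > 0" unfolding v'_def using content_ball_pos[OF \<eta>(1)] by blast
  have "(\<lambda>m. (v / v') * (r / r') ^ m) \<longlonglongrightarrow> (v / v') * 0"
    using rr by (intro tendsto_mult_left LIMSEQ_power_zero) auto
  then have "\<forall>\<^sub>F m in sequentially. (v / v') * (r / r') ^ m < e / 2"
    using e by (intro order_tendstoD(2)) auto
  then obtain m0 where m0: "\<And>m. m \<ge> m0 \<Longrightarrow> (v / v') * (r / r') ^ m < e / 2"
    unfolding eventually_sequentially by blast
  have "nsq lborel (cpow w m) - nsq lborel (cpow w (Suc m)) \<le> \<epsilon> * nsq lborel (cpow w m)"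
    if m: "m \<ge> m0" and w: "norm w = 1" for m and w :: "complex ^ 'n"
  proof -
    let ?b = "nsq lborel (cpow w m)"
    have "r ^ m * v = (v / v') * (r / r') ^ m * (r' ^ m * v')"
      using rr v' by (simp add: power_divide)
    also have "\<dots> \<le> (v / v') * (r / r') ^ m * ?b"
      using nsq_cpow_lower[OF w \<eta>, of m] rr v'
      by (intro mult_left_mono) (auto simp: r'_def v'_def v_def)
    also have "\<dots> \<le> (e / 2) * ?b" using m0[OF m] by (intro mult_right_mono) auto
    finally have "r ^ m * v \<le> (e / 2) * ?b" .
    moreover have "?b - nsq lborel (cpow w (Suc m)) \<le> (e / 2) * ?b + r ^ m * v"
      using nsq_cpow_diff_le[OF w rr(1,2), of m] by (simp add: r_def v_def)
    ultimately have "?b - nsq lborel (cpow w (Suc m)) \<le> e * ?b" by simp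
    also have "\<dots> \<le> \<epsilon> * ?b" using e by (intro mult_right_mono) auto
    finally show ?thesis .
  qed
  then show ?thesis by blast
qed

text \<open>Pairing with \<open>cpow w m\<close> and moving the adjoints across turns the
  combination with weights \<open>w $ i\<close> into multiplication by \<open>cip z w\<close>, which
  raises \<open>cpow w m\<close> to \<open>cpow w (Suc m)\<close>.\<close>

lemma slice_coeff_recursion:
  fixes w :: "complex ^ 'n::finite"
  assumes f: "f \<in> bergman" and w: "norm w = 1" and c: "power_coeffs c (slice f w) 1"
    and q: "power_coeffs q (slice (\<lambda>z. \<Sum>i\<in>UNIV. w $ i * Tad i f z) w) 1"
  shows "q m * of_real (nsq lborel (cpow w m)) = c (Suc m) * of_real (nsq lborel (cpow w (Suc m)))"
proof -
  note e = cpow_bergman[OF w]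
  have "q m * of_real (nsq lborel (cpow w m)) = ip lborel (\<lambda>z. \<Sum>i\<in>UNIV. w $ i * Tad i f z) (cpow w m)"
    by (rule ip_cpow[OF bergman_sum[OF bergman_cmult[OF Tad_bergman[OF f]]] w q, symmetric])
  also have "\<dots> = (\<Sum>i\<in>UNIV. w $ i * ip lborel (Tad i f) (cpow w m))"
    by (subst ip_sum_left) (auto simp: ip_cmult_left intro!: bergman_L2 bergman_cmult Tad_bergman f e)
  also have "\<dots> = (\<Sum>i\<in>UNIV. cnj (ip lborel (\<lambda>z. cnj (w $ i) * (z $ i * cpow w m z)) f))"
  proof (rule sum.cong[OF refl])
    fix i
    have "ip lborel (Tad i f) (cpow w m) = cnj (ip lborel (cpow w m) (Tad i f))" by (rule ip_commute)
    also have "\<dots> = cnj (ip lborel (\<lambda>z. z $ i * cpow w m z) f)" by (simp only: ip_Tad[OF f e])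
    finally show "w $ i * ip lborel (Tad i f) (cpow w m)
       = cnj (ip lborel (\<lambda>z. cnj (w $ i) * (z $ i * cpow w m z)) f)"
      by (simp add: ip_cmult_left)
  qed
  also have "\<dots> = cnj (ip lborel (\<lambda>z. \<Sum>i\<in>UNIV. cnj (w $ i) * (z $ i * cpow w m z)) f)"
    by (subst ip_sum_left) (auto intro!: bergman_L2 bergman_cmult bergman_mult_z f e)
  also have "(\<lambda>z. \<Sum>i\<in>UNIV. cnj (w $ i) * (z $ i * cpow w m z)) = cpow w (Suc m)"
    by (auto simp: cpow_def cip_def sum_distrib_left sum_distrib_right mult_ac fun_eq_iff)
  also have "cnj (ip lborel (cpow w (Suc m)) f) = ip lborel f (cpow w (Suc m))" by (rule ip_commute[symmetric])
  also have "\<dots> = c (Suc m) * of_real (nsq lborel (cpow w (Suc m)))" by (rule ip_cpow[OF f w c])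
  finally show ?thesis .
qed

text \<open>On a line, \<open>I - row_col\<close> multiplies the \<open>n\<close>-th Taylor
  coefficient by \<open>\<kappa> n\<close>, which is at most \<open>\<epsilon>\<close> beyond
  \<open>m0\<close>. The first \<open>m0 + 1\<close> coefficients are bounded by Cauchy's inequality
  on the circle of radius 1/2, whence the factor \<open>4 ^ m0\<close> after squaring. Parseval's
  identity sums the two parts.\<close>

lemma circle_mean_defect_bound:
  fixes w :: "complex ^ 'n::finite"
  assumes f: "f \<in> bergman" and w: "norm w = 1" and x: "cmod x < 1"
    and s: "\<And>z. norm z \<le> 1/2 \<Longrightarrow> cmod (f z) \<le> s" and \<epsilon>: "\<epsilon> > 0"
    and m0: "\<And>m. m \<ge> m0 \<Longrightarrow> nsq lborel (cpow w m) - nsq lborel (cpow w (Suc m)) \<le> \<epsilon> * nsq lborel (cpow w m)"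
  defines "g \<equiv> slice f w" and "u \<equiv> slice (\<lambda>z. f z - row_col f z) w"
  shows "Re (circle_mean (\<lambda>t. u (x * cis t) * cnj (g (x * cis t))))
     \<le> \<epsilon> * Re (circle_mean (\<lambda>t. g (x * cis t) * cnj (g (x * cis t)))) + real (Suc m0) * (4 ^ m0 * s\<^sup>2)"
proof -
  define b where "b m = nsq lborel (cpow w m)" for m
  have b: "b m > 0" for m unfolding b_def by (rule nsq_cpow_pos[OF w])
  define qf where "qf = (\<lambda>z. \<Sum>i\<in>UNIV. w $ i * Tad i f z)"
  have qf: "qf \<in> bergman" unfolding qf_def by (intro bergman_sum bergman_cmult Tad_bergman f)
  have gh: "g holomorphic_on ball 0 1" unfolding g_def by (rule slice_holomorphic[OF f w])
  define c where "c n = (deriv ^^ n) g 0 / fact n" for n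
  define q where "q n = (deriv ^^ n) (slice qf w) 0 / fact n" for n
  have c: "power_coeffs c g 1" unfolding c_def by (rule power_coeffs_deriv[OF gh])
  have q: "power_coeffs q (slice qf w) 1" unfolding q_def
    by (rule power_coeffs_deriv[OF slice_holomorphic[OF qf w]])
  have rec: "q m * of_real (b m) = c (Suc m) * of_real (b (Suc m))" for m
    unfolding b_def by (rule slice_coeff_recursion[OF f w c[unfolded g_def] q[unfolded qf_def]])
  \<comment> \<open>\<open>row_col f\<close> vanishes at the origin, so the constant coefficient is
    kept with multiplier 1; the other multipliers come from \<open>rec\<close>.\<close>
  define \<kappa> where "\<kappa> n = (case n of 0 \<Rightarrow> 1 | Suc m \<Rightarrow> 1 - b (Suc m) / b m)" for n
  define a where "a n = of_real (\<kappa> n) * c n" for n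
  have a0: "a 0 = c 0" by (simp add: a_def \<kappa>_def)
  have aS: "a (Suc m) = c (Suc m) - q m" for m
    using rec[of m] b[of m] by (simp add: a_def \<kappa>_def field_simps)
  have a: "power_coeffs a u 1"
    unfolding power_coeffs_def
  proof (intro allI impI)
    fix x :: complex assume x: "cmod x < 1"
    have "(\<lambda>n. q n * x ^ n) sums slice qf w x" using q x by (simp add: power_coeffs_def)
    then have "(\<lambda>n. x * (q n * x ^ n)) sums (x * slice qf w x)" by (rule sums_mult)
    then have "(\<lambda>n. (case n of 0 \<Rightarrow> 0 | Suc m \<Rightarrow> x * (q m * x ^ m))) sums (x * slice qf w x)"
      using sums_Suc_imp[of "\<lambda>n. case n of 0 \<Rightarrow> 0 | Suc m \<Rightarrow> x * (q m * x ^ m)"] by simp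
    moreover have "(\<lambda>n. c n * x ^ n) sums g x" using c x by (simp add: power_coeffs_def)
    ultimately have "(\<lambda>n. c n * x ^ n - (case n of 0 \<Rightarrow> 0 | Suc m \<Rightarrow> x * (q m * x ^ m))) sums (g x - x * slice qf w x)"
      by (intro sums_diff)
    \<comment> \<open>At the point \<open>x *s w\<close> the coordinates are
      \<open>x * w $ i\<close>, so \<open>row_col f\<close> restricts to \<open>x\<close> times the
      restriction of \<open>qf\<close>: its coefficients are those of \<open>qf\<close> shifted by
      one.\<close>
    moreover have "g x - x * slice qf w x = u x"
      by (simp add: g_def u_def slice_def qf_def row_col_def sum_distrib_left mult_ac)
    moreover have "c n * x ^ n - (case n of 0 \<Rightarrow> 0 | Suc m \<Rightarrow> x * (q m * x ^ m)) = a n * x ^ n" for n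
      by (cases n) (simp_all add: a0 aS algebra_simps)
    ultimately show "(\<lambda>n. a n * x ^ n) sums u x" by simp
  qed
  define y where "y = (cmod x)\<^sup>2"
  have y: "0 \<le> y" "y \<le> 1" using x by (auto simp: y_def power_le_one)
  have cont: "continuous_on (ball 0 1) g" using gh by (rule holomorphic_on_imp_continuous_on)
  let ?S1 = "circle_mean (\<lambda>t. u (x * cis t) * cnj (g (x * cis t)))"
  let ?S2 = "circle_mean (\<lambda>t. g (x * cis t) * cnj (g (x * cis t)))"
  have s1: "(\<lambda>n. \<kappa> n * ((cmod (c n))\<^sup>2 * y ^ n)) sums Re ?S1"
  proof -
    have "Re (a n * cnj (c n) * of_real ((cmod x)\<^sup>2) ^ n) = \<kappa> n * ((cmod (c n))\<^sup>2 * y ^ n)" for n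
    proof -
      have "a n * cnj (c n) * of_real ((cmod x)\<^sup>2) ^ n = of_real (\<kappa> n) * (c n * cnj (c n)) * of_real (y ^ n)"
        by (simp add: a_def y_def)
      also have "\<dots> = of_real (\<kappa> n * ((cmod (c n))\<^sup>2 * y ^ n))"
        by (simp only: complex_norm_square[symmetric] of_real_mult mult.assoc)
      finally show ?thesis by (simp only: Re_complex_of_real)
    qed
    then show ?thesis using sums_Re[OF circle_mean_Parseval[OF a c cont x]] by (simp only:)
  qed
  have s2: "(\<lambda>n. (cmod (c n))\<^sup>2 * y ^ n) sums Re ?S2"
  proof -
    have "Re (c n * cnj (c n) * of_real ((cmod x)\<^sup>2) ^ n) = (cmod (c n))\<^sup>2 * y ^ n" for n
      unfolding complex_norm_square[symmetric] y_def
      by (simp only: of_real_power[symmetric] of_real_mult[symmetric] Re_complex_of_real)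
    then show ?thesis using sums_Re[OF circle_mean_Parseval[OF c c cont x]] by (simp only:)
  qed
  have cb: "(cmod (c n))\<^sup>2 * y ^ n \<le> 4 ^ m0 * s\<^sup>2" if "n \<le> m0" for n
  proof -
    have "norm ((deriv ^^ n) g 0) \<le> fact n * s / (1/2) ^ n"
    proof (rule Cauchy_inequality)
      show "g holomorphic_on ball 0 (1/2)" by (rule holomorphic_on_subset[OF gh]) auto
      show "continuous_on (cball 0 (1/2)) g" by (rule continuous_on_subset[OF cont]) auto
      fix x :: complex assume "norm (0 - x) = 1/2"
      then show "norm (g x) \<le> s" using w by (simp add: g_def slice_def s norm_vector_scalar_mult)
    qed simp
    then have "cmod (c n) \<le> 2 ^ n * s" by (simp add: c_def norm_divide field_simps power_divide)
    then have "(cmod (c n))\<^sup>2 \<le> (2 ^ n * s)\<^sup>2" by (rule power_mono) simp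
    also have "\<dots> = (2 ^ n * 2 ^ n) * s\<^sup>2" by (simp add: power2_eq_square mult_ac)
    also have "(2 :: real) ^ n * 2 ^ n = 4 ^ n" by (simp flip: power_mult_distrib)
    also have "4 ^ n * s\<^sup>2 \<le> 4 ^ m0 * s\<^sup>2" using that by (intro mult_right_mono power_increasing) auto
    finally have "(cmod (c n))\<^sup>2 \<le> 4 ^ m0 * s\<^sup>2" .
    moreover have "(cmod (c n))\<^sup>2 * y ^ n \<le> (cmod (c n))\<^sup>2" using y by (simp add: mult_left_le power_le_one)
    ultimately show ?thesis by linarith
  qed
  have k1: "\<kappa> n \<le> 1" for n using b by (cases n) (auto simp: \<kappa>_def less_imp_le)
  have k2: "\<kappa> n \<le> \<epsilon>" if nm: "n > m0" for n
  proof -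
    obtain m where n: "n = Suc m" using nm by (cases n) auto
    have "b m - b (Suc m) \<le> \<epsilon> * b m" unfolding b_def using m0[of m] nm n by simp
    then show ?thesis using b[of m] by (simp add: n \<kappa>_def field_simps)
  qed
  have t1: "(\<lambda>n. \<kappa> n * ((cmod (c n))\<^sup>2 * y ^ n) - \<epsilon> * ((cmod (c n))\<^sup>2 * y ^ n)) sums (Re ?S1 - \<epsilon> * Re ?S2)"
    by (intro sums_diff sums_mult s1 s2)
  have t2: "(\<lambda>n. if n \<in> {..m0} then 4 ^ m0 * s\<^sup>2 else 0) sums (\<Sum>n\<in>{..m0}. 4 ^ m0 * s\<^sup>2)"
    by (rule sums_If_finite_set) simp
  have t3: "\<kappa> n * ((cmod (c n))\<^sup>2 * y ^ n) - \<epsilon> * ((cmod (c n))\<^sup>2 * y ^ n)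
      \<le> (if n \<in> {..m0} then 4 ^ m0 * s\<^sup>2 else 0)" for n
  proof (cases "n \<le> m0")
    case True
    have "\<kappa> n * ((cmod (c n))\<^sup>2 * y ^ n) \<le> 1 * ((cmod (c n))\<^sup>2 * y ^ n)"
      using k1 y by (intro mult_right_mono) auto
    moreover have "0 \<le> \<epsilon> * ((cmod (c n))\<^sup>2 * y ^ n)" using \<epsilon> y by simp
    ultimately show ?thesis using cb[OF True] True by simp
  next
    case False
    have "\<kappa> n * ((cmod (c n))\<^sup>2 * y ^ n) \<le> \<epsilon> * ((cmod (c n))\<^sup>2 * y ^ n)"
      using k2 False y by (intro mult_right_mono) auto
    then show ?thesis using False by simp
  qed
  have "Re ?S1 - \<epsilon> * Re ?S2 \<le> (\<Sum>n\<in>{..m0}. 4 ^ m0 * s\<^sup>2)"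
    by (rule sums_le[OF t3 t1 t2])
  then show ?thesis by (simp add: algebra_simps)
qed

text \<open>The defect is the inner product of \<open>f - row_col f\<close> and \<open>f\<close>;
  averaging the integrand over scalar rotations reduces it to the estimate on circles, with
  constants independent of the line.\<close>

lemma defect_bound:
  assumes \<epsilon>: "\<epsilon> > 0"
  shows "\<exists>K\<ge>0. \<forall>f \<in> (bergman :: 'n::finite cfun set). \<forall>s. (\<forall>z. norm z \<le> 1/2 \<longrightarrow> cmod (f z) \<le> s) \<longrightarrow>
    defect f \<le> \<epsilon> * nsq lborel f + K * s\<^sup>2"
proof -
  obtain m0 where m0: "\<And>m w. m \<ge> m0 \<Longrightarrow> norm (w :: complex ^ 'n) = 1 \<Longrightarrow>
    nsq lborel (cpow w m) - nsq lborel (cpow w (Suc m)) \<le> \<epsilon> * nsq lborel (cpow w m)"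
    using nsq_cpow_ratio[OF \<epsilon>] by metis
  define k where "k = real (Suc m0) * 4 ^ m0"
  define v where "v = measure lborel (ball (0 :: complex ^ 'n) 1)"
  have "defect f \<le> \<epsilon> * nsq lborel f + (k * v) * s\<^sup>2"
    if f: "f \<in> bergman" and s: "\<forall>z. norm z \<le> 1/2 \<longrightarrow> cmod (f z) \<le> s" for f :: "'n cfun" and s
  proof -
    define d where "d = (\<lambda>z. f z - row_col f z)"
    have d: "d \<in> bergman" unfolding d_def by (intro bergman_diff f row_col_bergman)
    define F where "F z = d z * cnj (f z)" for z
    define G where "G z = f z * cnj (f z)" for z
    have F: "integrable lborel F" and G: "integrable lborel G"
      unfolding F_def G_def by (intro ip_integrable bergman_L2 d f)+
    have iso: "norm (cis t *s z) = norm z" for t and z :: "complex ^ 'n" by (simp add: norm_vector_scalar_mult)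
    note IF = integral_circle_mean[OF cis_scale_measurable linear_vector_scalar_mult iso F]
    note IG = integral_circle_mean[OF cis_scale_measurable linear_vector_scalar_mult iso G]
    have le: "Re (circle_mean (\<lambda>t. F (cis t *s z)))
        \<le> \<epsilon> * Re (circle_mean (\<lambda>t. G (cis t *s z))) + (k * s\<^sup>2) * indicator (ball 0 1) z" for z
    proof (cases "norm z < 1")
      case True
      have "\<exists>w. norm w = 1 \<and> z = complex_of_real (norm z) *s w"
      proof (cases "z = 0")
        case True
        have "norm (axis undefined 1 :: complex ^ 'n) = 1" by simp
        then show ?thesis using True by (intro exI[of _ "axis undefined 1"]) simp
      next
        case False
        then show ?thesis
          by (intro exI[of _ "complex_of_real (1 / norm z) *s z"])
             (auto simp: norm_vector_scalar_mult norm_divide vec_eq_iff)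
      qed
      then obtain w where w: "norm w = 1" "z = complex_of_real (norm z) *s w" by blast
      have cz: "cis t *s z = (complex_of_real (norm z) * cis t) *s w" for t
        by (subst w(2)) (simp add: vec_eq_iff mult_ac)
      have x: "cmod (complex_of_real (norm z)) < 1" using True by simp
      have s': "cmod (f z) \<le> s" if "norm z \<le> 1/2" for z using s that by blast
      from circle_mean_defect_bound[OF f w(1) x s' \<epsilon> m0[OF _ w(1)]]
      show ?thesis using True
        by (simp add: F_def G_def d_def cz slice_def k_def mult_ac)
    next
      case False
      then have "f (cis t *s z) = 0" for t using bergman_zero[OF f] by (simp add: iso)
      then show ?thesis using False by (simp add: F_def G_def circle_mean_def set_lebesgue_integral_def)
    qed
    have ind: "integrable lborel (indicator (ball 0 1) :: complex ^ 'n \<Rightarrow> real)"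
      using emeasure_lborel_ball_finite[of "0 :: complex ^ 'n" 1] by (intro integrable_real_indicator) auto
    have "(LINT z|lborel. Re (circle_mean (\<lambda>t. F (cis t *s z))))
      \<le> (LINT z|lborel. \<epsilon> * Re (circle_mean (\<lambda>t. G (cis t *s z))) + (k * s\<^sup>2) * indicator (ball 0 1) z)"
      by (intro integral_mono le Bochner_Integration.integrable_add integrable_mult_right integrable_Re IF IG ind)
    also have "\<dots> = \<epsilon> * (LINT z|lborel. Re (circle_mean (\<lambda>t. G (cis t *s z)))) + (k * s\<^sup>2) * v"
      unfolding v_def by (subst Bochner_Integration.integral_add) (auto intro!: integrable_Re IG ind)
    finally have "Re (LINT z|lborel. F z) \<le> \<epsilon> * Re (LINT z|lborel. G z) + (k * s\<^sup>2) * v"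
      by (simp add: integral_Re IF IG)
    moreover have "(LINT z|lborel. G z) = of_real (nsq lborel f)"
      using ip_self[of lborel f] by (simp add: ip_def G_def)
    moreover have "(LINT z|lborel. F z) = of_real (defect f)"
    proof -
      have "(LINT z|lborel. F z) = ip lborel f f - ip lborel (row_col f) f"
        unfolding F_def d_def ip_def[symmetric] by (intro ip_diff_left bergman_L2 f row_col_bergman)
      then show ?thesis by (simp add: ip_self ip_row_col[OF f] defect_def)
    qed
    ultimately show ?thesis by (simp add: mult_ac)
  qed
  moreover have "k * v \<ge> 0" by (simp add: k_def v_def)
  ultimately show ?thesis by blast
qed

section \<open>Carleson measures and convexity\<close>

text \<open>Stands for weak convergence to 0, in the form in which Montel's theorem provides it.
  Stability under \<open>Tad i\<close>, proved below, is what allows adjoints to be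
  iterated.\<close>

definition null_seq :: "(nat \<Rightarrow> 'n::finite cfun) \<Rightarrow> bool" where
  "null_seq f \<longleftrightarrow> (\<forall>k. f k \<in> bergman) \<and> (\<exists>B. \<forall>k. nsq lborel (f k) \<le> B) \<and> loc_lim f (\<lambda>z. 0)"

lemma null_seq_bergman: "null_seq f \<Longrightarrow> f k \<in> bergman"
  by (simp add: null_seq_def)

lemma loc_lim_0_eventually:
  assumes "loc_lim f (\<lambda>z. 0)" "r < 1" "s > 0"
  shows "\<forall>\<^sub>F k in sequentially. \<forall>z. norm z \<le> r \<longrightarrow> cmod (f k z) < s"
  using assms unfolding loc_lim_def uniform_limit_iff by (simp add: Ball_def)

lemma loc_lim_0_I:
  assumes "\<And>r s. r < 1 \<Longrightarrow> s > 0 \<Longrightarrow> \<forall>\<^sub>F k in sequentially. \<forall>z. norm z \<le> r \<longrightarrow> cmod (f k z) < s"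
  shows "loc_lim f (\<lambda>z. 0)"
  unfolding loc_lim_def uniform_limit_iff using assms by (simp add: Ball_def)

lemma defect_nonneg: "f \<in> bergman \<Longrightarrow> 0 \<le> defect f"
  using sum_nsq_Tad_le by (simp add: defect_def)

lemma null_seq_defect:
  fixes f :: "nat \<Rightarrow> 'n::finite cfun"
  assumes f: "null_seq f"
  shows "(\<lambda>k. defect (f k)) \<longlonglongrightarrow> 0"
proof (rule LIMSEQ_I)
  fix e :: real assume e: "e > 0"
  obtain B where B: "\<And>k. nsq lborel (f k) \<le> B" using f by (auto simp: null_seq_def)
  have B0: "B \<ge> 0" using B[of 0] nsq_nonneg order_trans by blast
  \<comment> \<open>The two terms of the bound become at most \<open>e / 2\<close> and, by the
    choice of \<open>s\<close>, at most \<open>e / 4\<close>. The \<open>+ 1\<close> in each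
    denominator allows for \<open>B = 0\<close> and \<open>K = 0\<close>.\<close>
  define \<epsilon> where "\<epsilon> = e / (2 * (B + 1))"
  have \<epsilon>: "\<epsilon> > 0" using e B0 by (simp add: \<epsilon>_def)
  obtain K where K: "K \<ge> 0" "\<And>g s. g \<in> (bergman :: 'n cfun set) \<Longrightarrow> (\<forall>z. norm z \<le> 1/2 \<longrightarrow> cmod (g z) \<le> s) \<Longrightarrow>
    defect g \<le> \<epsilon> * nsq lborel g + K * s\<^sup>2"
    using defect_bound[OF \<epsilon>] by blast
  define s where "s = sqrt (e / (4 * (K + 1)))"
  have s: "s > 0" "s\<^sup>2 = e / (4 * (K + 1))" using e K(1) by (auto simp: s_def)
  obtain N where N: "\<And>k. k \<ge> N \<Longrightarrow> \<forall>z. norm z \<le> 1/2 \<longrightarrow> cmod (f k z) < s"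
    using loc_lim_0_eventually[of f "1/2" s] f s(1) unfolding null_seq_def eventually_sequentially by auto
  have "norm (defect (f k) - 0) < e" if "k \<ge> N" for k
  proof -
    have "defect (f k) \<le> \<epsilon> * nsq lborel (f k) + K * s\<^sup>2"
      using N[OF that] by (intro K(2) null_seq_bergman[OF f]) (auto intro: less_imp_le)
    also have "\<epsilon> * nsq lborel (f k) \<le> \<epsilon> * B" using B \<epsilon> by simp
    also have "\<epsilon> * B \<le> e / 2" using e B0 by (simp add: \<epsilon>_def field_simps)
    also have "K * s\<^sup>2 \<le> e / 4" using e K(1) by (simp add: s field_simps)
    finally have "defect (f k) < e" using e by simp
    then show ?thesis using defect_nonneg[OF null_seq_bergman[OF f]] by simp
  qed
  then show "\<exists>N. \<forall>k\<ge>N. norm (defect (f k) - 0) < e" by blast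
qed

lemma null_seq_mult_z:
  assumes f: "null_seq f"
  shows "null_seq (\<lambda>k z. z $ i * f k z)"
proof -
  have le: "cmod (z $ i * f k z) \<le> cmod (f k z)" for k z
    by (rule cmod_nth_mult_le[OF null_seq_bergman[OF f]])
  obtain B where "\<And>k. nsq lborel (f k) \<le> B" using f by (auto simp: null_seq_def)
  then have "nsq lborel (\<lambda>z. z $ i * f k z) \<le> B" for k
    using mult_z_L2(2)[OF null_seq_bergman[OF f]] order_trans by blast
  moreover have "loc_lim (\<lambda>k z. z $ i * f k z) (\<lambda>z. 0)"
  proof (rule loc_lim_0_I)
    fix r s :: real assume "r < 1" "s > 0"
    then have "\<forall>\<^sub>F k in sequentially. \<forall>z. norm z \<le> r \<longrightarrow> cmod (f k z) < s"
      using f by (intro loc_lim_0_eventually) (auto simp: null_seq_def)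
    then show "\<forall>\<^sub>F k in sequentially. \<forall>z. norm z \<le> r \<longrightarrow> cmod (z $ i * f k z) < s"
      by eventually_elim (use le le_less_trans in blast)
  qed
  ultimately show ?thesis
    unfolding null_seq_def using bergman_mult_z[OF null_seq_bergman[OF f]] by blast
qed

text \<open>\<open>Tad i (f k)\<close> differs from \<open>cnj (z $ i) * f k z\<close> by a Hankel
  part whose norm is controlled by the defect and so tends to 0, while the function itself is
  dominated by \<open>f k\<close>. Smallness in the mean over a small ball becomes smallness at its
  centre by the submean inequality for the holomorphic function \<open>Tad i (f k)\<close>.\<close>

lemma null_seq_Tad:
  fixes f :: "nat \<Rightarrow> 'n::finite cfun"
  assumes f: "null_seq f"
  shows "null_seq (\<lambda>k. Tad i (f k))"
proof -
  note fb = null_seq_bergman[OF f]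
  obtain B where B: "\<And>k. nsq lborel (f k) \<le> B" using f by (auto simp: null_seq_def)
  have "nsq lborel (Tad i (f k)) \<le> B" for k
  proof -
    have "nsq lborel (Tad i (f k)) \<le> (\<Sum>i\<in>UNIV. nsq lborel (Tad i (f k)))"
      by (rule member_le_sum) auto
    then show ?thesis using sum_nsq_Tad_le[OF fb, of k] B[of k] by linarith
  qed
  moreover have "loc_lim (\<lambda>k. Tad i (f k)) (\<lambda>z. 0)"
  proof (rule loc_lim_0_I)
    fix r s :: real assume r: "r < 1" and s: "s > 0"
    define \<rho> where "\<rho> = (1 - r) / 2"
    have \<rho>: "\<rho> > 0" "r + \<rho> < 1" using r by (auto simp: \<rho>_def field_simps)
    define v where "v = measure lborel (ball (0 :: complex ^ 'n) \<rho>)"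
    have v: "v > 0" unfolding v_def using content_ball_pos[OF \<rho>(1)] by blast
    \<comment> \<open>By \<open>cmod_add_sq_le\<close> with parameter 1 the bound
      \<open>s / 2\<close> contributes at most \<open>s\<^sup>2 * v / 2\<close> to the integral and
      the Hankel part less than \<open>s\<^sup>2 * v / 4\<close>, which together stay below
      \<open>s\<^sup>2 * v\<close>.\<close>
    have "\<forall>\<^sub>F k in sequentially. \<forall>z. norm z \<le> r + \<rho> \<longrightarrow> cmod (f k z) < s / 2"
      using f \<rho> s by (intro loc_lim_0_eventually) (auto simp: null_seq_def)
    moreover have "\<forall>\<^sub>F k in sequentially. defect (f k) < s\<^sup>2 * v / 8"
      by (rule order_tendstoD(2)[OF null_seq_defect[OF f]]) (use s v in simp)
    ultimately show "\<forall>\<^sub>F k in sequentially. \<forall>z. norm z \<le> r \<longrightarrow> cmod (Tad i (f k) z) < s"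
    proof eventually_elim
      case (elim k)
      define H where "H z = cnj (z $ i) * f k z - Tad i (f k) z" for z
      have HL: "H \<in> L2 lborel" unfolding H_def
        by (intro L2_minus mult_z_L2(3) bergman_L2 Tad_bergman fb)
      have "nsq lborel H \<le> (\<Sum>i\<in>UNIV. nsq lborel (\<lambda>z. cnj (z $ i) * f k z - Tad i (f k) z))"
        unfolding H_def
        by (rule member_le_sum[where f = "\<lambda>i. nsq lborel (\<lambda>z. cnj (z $ i) * f k z - Tad i (f k) z)"]) auto
      then have Hd: "nsq lborel H \<le> defect (f k)" using sum_nsq_mult_cnj_minus_Tad_le[OF fb, of k] by linarith
      show ?case
      proof (intro allI impI)
        fix z :: "complex ^ 'n" assume z: "norm z \<le> r"
        let ?B = "ball (0 :: complex ^ 'n) \<rho>"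
        have sub: "cball z \<rho> \<subseteq> cball 0 (r + \<rho>)" using z by (intro cball_shrink[of z r]) auto
        then have sub': "cball z \<rho> \<subseteq> ball 0 1" using \<rho>(2) by force
        have ptw: "indicator ?B u * (cmod (Tad i (f k) (z + u)))\<^sup>2
          \<le> 2 * (cmod (H (z + u)))\<^sup>2 + (s\<^sup>2 / 2) * indicator ?B u" for u
        proof (cases "u \<in> ?B")
          case True
          then have "z + u \<in> cball z \<rho>" by (simp add: dist_norm)
          then have n: "norm (z + u) \<le> r + \<rho>" using sub by auto
          have "cmod (cnj ((z + u) $ i) * f k (z + u)) \<le> cmod (f k (z + u))"
            using cmod_nth_mult_le[OF fb, of "z + u" i k] by (simp only: norm_mult complex_mod_cnj)
          also have "\<dots> \<le> s / 2" using elim(1) n by (simp add: less_imp_le)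
          finally have "(cmod (cnj ((z + u) $ i) * f k (z + u)))\<^sup>2 \<le> (s / 2)\<^sup>2"
            by (rule power_mono) simp
          moreover have "Tad i (f k) (z + u) = - H (z + u) + cnj ((z + u) $ i) * f k (z + u)" by (simp add: H_def)
          ultimately show ?thesis
            using True cmod_add_sq_le[of 1 "- H (z + u)" "cnj ((z + u) $ i) * f k (z + u)"]
            by (simp add: power2_eq_square)
        qed simp
        note iH = lborel_shift[OF L2_integrable[OF HL], of z]
        have ind: "integrable lborel (indicator ?B :: complex ^ 'n \<Rightarrow> real)"
          using emeasure_lborel_ball_finite[of "0 :: complex ^ 'n" \<rho>] by (intro integrable_real_indicator) auto
        have iT: "integrable lborel (\<lambda>u. indicator ?B u *\<^sub>R (cmod (Tad i (f k) (z + u)))\<^sup>2)"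
          by (rule integrable_mult_indicator[OF _ lborel_shift(1)])
             (auto intro!: L2_integrable bergman_L2 Tad_bergman fb)
        have "(cmod (Tad i (f k) z))\<^sup>2 * v \<le> (LINT u|lborel. indicator ?B u * (cmod (Tad i (f k) (z + u)))\<^sup>2)"
          unfolding v_def by (rule bergman_submean[OF Tad_bergman[OF fb] \<rho>(1) sub'])
        also have "\<dots> \<le> (LINT u|lborel. 2 * (cmod (H (z + u)))\<^sup>2 + (s\<^sup>2 / 2) * indicator ?B u)"
          by (intro integral_mono ptw Bochner_Integration.integrable_add integrable_mult_right iH(1) ind)
             (use iT in simp)
        also have "\<dots> = 2 * nsq lborel H + (s\<^sup>2 / 2) * v"
          unfolding v_def nsq_def iH(2)[symmetric]
          by (subst Bochner_Integration.integral_add) (auto intro!: iH(1) ind)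
        also have "\<dots> < s\<^sup>2 * v"
        proof -
          have "0 < s\<^sup>2 * v" using v s by simp
          then show ?thesis using Hd elim(2) by linarith
        qed
        finally have "(cmod (Tad i (f k) z))\<^sup>2 < s\<^sup>2" using v by simp
        then show "cmod (Tad i (f k) z) < s" using s by (simp add: power2_less_imp_less)
      qed
    qed
  qed
  ultimately show ?thesis
    unfolding null_seq_def using Tad_bergman[OF fb] by blast
qed

text \<open>For \<open>s = 1\<close> this is Pythagoras for removing the component along
  \<open>cnj w\<close>. For a vector of another length the map is no longer a projection, and the
  factor becomes \<open>2 - s\<close>.\<close>

lemma sum_sq_minus_projection:
  fixes w x :: "'i \<Rightarrow> complex"
  assumes "finite I"
  defines "X \<equiv> \<Sum>i\<in>I. w i * x i" and "s \<equiv> \<Sum>i\<in>I. (cmod (w i))\<^sup>2"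
  shows "(\<Sum>i\<in>I. (cmod (x i - cnj (w i) * X))\<^sup>2) = (\<Sum>i\<in>I. (cmod (x i))\<^sup>2) - (2 - s) * (cmod X)\<^sup>2"
proof -
  have e: "(cmod (a - b))\<^sup>2 = (cmod a)\<^sup>2 - 2 * Re (a * cnj b) + (cmod b)\<^sup>2" for a b
    unfolding cmod_power2 by (simp add: power2_eq_square algebra_simps)
  have "(\<Sum>i\<in>I. Re (x i * cnj (cnj (w i) * X))) = Re (\<Sum>i\<in>I. (w i * x i) * cnj X)"
    by (simp add: mult_ac)
  also have "\<dots> = Re (X * cnj X)" unfolding X_def by (simp only: sum_distrib_right[symmetric])
  also have "\<dots> = (cmod X)\<^sup>2" by (simp only: complex_norm_square[symmetric] Re_complex_of_real)
  finally have 1: "(\<Sum>i\<in>I. Re (x i * cnj (cnj (w i) * X))) = (cmod X)\<^sup>2" .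
  have 2: "(\<Sum>i\<in>I. (cmod (cnj (w i) * X))\<^sup>2) = s * (cmod X)\<^sup>2"
    by (simp add: s_def norm_mult power_mult_distrib sum_distrib_right)
  show ?thesis
    unfolding e sum.distrib sum_subtractf sum_distrib_left[symmetric] 1 2 by (simp add: algebra_simps)
qed

text \<open>Obtained from the nonnegativity of the sum of squares that is left after removing from \<open>b\<close> its
  components along \<open>cnj w\<close> in both indices.\<close>
lemma symmetric_contraction_ineq:
  fixes w :: "'i \<Rightarrow> complex" and b :: "'i \<Rightarrow> 'i \<Rightarrow> complex"
  assumes fin: "finite I" and sym: "\<And>i j. b i j = b j i" and w: "(\<Sum>i\<in>I. (cmod (w i))\<^sup>2) \<le> 1"
  defines "A \<equiv> \<lambda>i. \<Sum>j\<in>I. w j * b i j"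
  shows "2 * (\<Sum>i\<in>I. (cmod (A i))\<^sup>2) \<le> (\<Sum>i\<in>I. \<Sum>j\<in>I. (cmod (b i j))\<^sup>2) + (cmod (\<Sum>i\<in>I. w i * A i))\<^sup>2"
proof -
  define s where "s = (\<Sum>i\<in>I. (cmod (w i))\<^sup>2)"
  define G where "G = (\<Sum>i\<in>I. w i * A i)"
  define c where "c i j = b i j - cnj (w j) * A i" for i j
  have C: "(\<Sum>i\<in>I. w i * c i j) = A j - cnj (w j) * G" for j
  proof -
    have "(\<Sum>i\<in>I. w i * c i j) = (\<Sum>i\<in>I. w i * b i j) - cnj (w j) * (\<Sum>i\<in>I. w i * A i)"
      by (simp add: c_def right_diff_distrib sum_subtractf sum_distrib_left mult_ac)
    then show ?thesis by (simp add: A_def G_def sym[of _ j])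
  qed
  have s0: "0 \<le> s" "s \<le> 1" using w by (auto simp: s_def sum_nonneg)
  define a where "a = (\<Sum>i\<in>I. (cmod (A i))\<^sup>2)"
  have "0 \<le> (\<Sum>j\<in>I. \<Sum>i\<in>I. (cmod (c i j - cnj (w i) * (\<Sum>i\<in>I. w i * c i j)))\<^sup>2)"
    by (intro sum_nonneg) simp
  also have "\<dots> = (\<Sum>j\<in>I. (\<Sum>i\<in>I. (cmod (c i j))\<^sup>2) - (2 - s) * (cmod (A j - cnj (w j) * G))\<^sup>2)"
  proof (rule sum.cong[OF refl])
    fix j
    show "(\<Sum>i\<in>I. (cmod (c i j - cnj (w i) * (\<Sum>i\<in>I. w i * c i j)))\<^sup>2)
      = (\<Sum>i\<in>I. (cmod (c i j))\<^sup>2) - (2 - s) * (cmod (A j - cnj (w j) * G))\<^sup>2"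
      using sum_sq_minus_projection[OF fin, where x = "\<lambda>i. c i j" and w = w] by (simp only: C s_def)
  qed
  also have "\<dots> = (\<Sum>i\<in>I. \<Sum>j\<in>I. (cmod (c i j))\<^sup>2) - (2 - s) * (\<Sum>j\<in>I. (cmod (A j - cnj (w j) * G))\<^sup>2)"
    by (subst sum.swap) (simp add: sum_subtractf sum_distrib_left)
  also have "(\<Sum>j\<in>I. (cmod (A j - cnj (w j) * G))\<^sup>2) = a - (2 - s) * (cmod G)\<^sup>2"
    unfolding a_def s_def G_def by (rule sum_sq_minus_projection[OF fin])
  also have "(\<Sum>i\<in>I. \<Sum>j\<in>I. (cmod (c i j))\<^sup>2) = (\<Sum>i\<in>I. \<Sum>j\<in>I. (cmod (b i j))\<^sup>2) - (2 - s) * a"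
    unfolding c_def A_def a_def sum_sq_minus_projection[OF fin] s_def[symmetric]
    by (simp add: sum_subtractf sum_distrib_left)
  finally have 1: "(2 - s) * a + (2 - s) * (a - (2 - s) * (cmod G)\<^sup>2) \<le> (\<Sum>i\<in>I. \<Sum>j\<in>I. (cmod (b i j))\<^sup>2)"
    by simp
  have Ga: "(cmod G)\<^sup>2 \<le> s * a"
    unfolding G_def s_def a_def by (rule cmod_sum_mult_sq_le)
  have a0: "a \<ge> 0" unfolding a_def by (intro sum_nonneg) simp
  \<comment> \<open>Passing from \<open>1\<close> to the claim leaves the remainder
    \<open>(1 - s) * (2 * a - (3 - s) * (cmod G)\<^sup>2)\<close>, which must be nonnegative. This
    follows from Cauchy-Schwarz and from \<open>(3 - s) * s \<le> 2\<close>, that is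
    \<open>(1 - s) * (2 - s) \<ge> 0\<close>.\<close>
  have 2: "(3 - s) * (cmod G)\<^sup>2 \<le> (3 - s) * (s * a)" using Ga s0 by (intro mult_left_mono) auto
  have "0 \<le> ((1 - s) * (2 - s)) * a" using s0 a0 by (intro mult_nonneg_nonneg) auto
  then have "(3 - s) * (s * a) \<le> 2 * a" by (simp add: algebra_simps)
  with 2 have "(3 - s) * (cmod G)\<^sup>2 \<le> 2 * a" by linarith
  then have "0 \<le> (1 - s) * (2 * a - (3 - s) * (cmod G)\<^sup>2)" using s0 by (intro mult_nonneg_nonneg) auto
  then have "2 * a \<le> (2 - s) * a + (2 - s) * (a - (2 - s) * (cmod G)\<^sup>2) + (cmod G)\<^sup>2"
    by (simp add: algebra_simps power2_eq_square)
  then show ?thesis using 1 by (simp add: a_def G_def)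
qed

text \<open>Membership in \<open>L2 \<mu>\<close> is demanded separately because the integral of a
  non-integrable function is 0 by convention, so that the bound on \<open>nsq \<mu> f\<close> would
  say nothing there.\<close>

definition carleson :: "(complex ^ 'n::finite) measure \<Rightarrow> real \<Rightarrow> bool" where
  "carleson \<mu> C \<longleftrightarrow> C \<ge> 0 \<and> space \<mu> \<subseteq> ball 0 1 \<and>
    (\<forall>f\<in>bergman. f \<in> L2 \<mu> \<and> nsq \<mu> f \<le> C * nsq lborel f)"

text \<open>The contraction inequality at each point \<open>z\<close>, with
  \<open>b i j = Tad j (Tad i f) z\<close> and the coordinates of \<open>z\<close> as weights,
  integrated against \<open>\<mu>\<close>. Contracting one index gives
  \<open>row_col (Tad i f)\<close>; no limit is involved yet.\<close>

lemma carleson_convex_step: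
  fixes f :: "'n::finite cfun"
  assumes \<mu>: "carleson \<mu> C" and f: "f \<in> bergman"
  shows "2 * (\<Sum>i\<in>UNIV. nsq \<mu> (row_col (Tad i f)))
    \<le> (\<Sum>i\<in>UNIV. \<Sum>j\<in>UNIV. nsq \<mu> (Tad j (Tad i f))) + nsq \<mu> (\<lambda>z. \<Sum>i\<in>UNIV. z $ i * row_col (Tad i f) z)"
proof -
  have L: "g \<in> bergman \<Longrightarrow> integrable \<mu> (\<lambda>z. (cmod (g z))\<^sup>2)" for g
    using \<mu> L2_integrable unfolding carleson_def by blast
  have T: "Tad i f \<in> bergman" "row_col (Tad i f) \<in> bergman" "Tad j (Tad i f) \<in> bergman" for i j
    by (intro Tad_bergman row_col_bergman f)+
  have G: "(\<lambda>z. \<Sum>i\<in>UNIV. z $ i * row_col (Tad i f) z) \<in> bergman"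
    by (intro bergman_sum bergman_mult_z T)
  have ptw: "2 * (\<Sum>i\<in>UNIV. (cmod (row_col (Tad i f) z))\<^sup>2)
     \<le> (\<Sum>i\<in>UNIV. \<Sum>j\<in>UNIV. (cmod (Tad j (Tad i f) z))\<^sup>2) + (cmod (\<Sum>i\<in>UNIV. z $ i * row_col (Tad i f) z))\<^sup>2"
    if "z \<in> space \<mu>" for z
  proof -
    have "norm z < 1" using that \<mu> by (auto simp: carleson_def)
    then have "(\<Sum>i\<in>UNIV. (cmod (z $ i))\<^sup>2) \<le> 1" unfolding norm_vec_sq[symmetric] by (simp add: power_le_one)
    from symmetric_contraction_ineq[of UNIV "\<lambda>i j. Tad j (Tad i f) z" "\<lambda>i. z $ i", OF finite_class.finite_UNIV _ this]
    show ?thesis unfolding row_col_def by (simp add: Tad_commute[OF f])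
  qed
  have "2 * (\<Sum>i\<in>UNIV. nsq \<mu> (row_col (Tad i f))) = (LINT z|\<mu>. 2 * (\<Sum>i\<in>UNIV. (cmod (row_col (Tad i f) z))\<^sup>2))"
    unfolding nsq_def by (simp add: Bochner_Integration.integral_sum L T)
  also have "\<dots> \<le> (LINT z|\<mu>. (\<Sum>i\<in>UNIV. \<Sum>j\<in>UNIV. (cmod (Tad j (Tad i f) z))\<^sup>2)
      + (cmod (\<Sum>i\<in>UNIV. z $ i * row_col (Tad i f) z))\<^sup>2)"
    by (intro integral_mono ptw Bochner_Integration.integrable_add integrable_mult_right
        Bochner_Integration.integrable_sum L T G)
  also have "\<dots> = (\<Sum>i\<in>UNIV. \<Sum>j\<in>UNIV. nsq \<mu> (Tad j (Tad i f)))
      + nsq \<mu> (\<lambda>z. \<Sum>i\<in>UNIV. z $ i * row_col (Tad i f) z)"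
    unfolding nsq_def
    by (simp add: Bochner_Integration.integral_add Bochner_Integration.integral_sum
        Bochner_Integration.integrable_sum L T L[OF G])
  finally show ?thesis .
qed

text \<open>Young's inequality with a small weight \<open>t\<close> on the bounded
  \<open>v k\<close>: the excess is at most \<open>t * (C * B)\<close>, while the large weight
  \<open>1 + 1 / t\<close> falls on the difference, which tends to 0.\<close>

lemma carleson_approx:
  fixes u v :: "nat \<Rightarrow> 'n::finite cfun"
  assumes \<mu>: "carleson \<mu> C" and u: "\<And>k. u k \<in> bergman" and v: "\<And>k. v k \<in> bergman" "\<And>k. nsq lborel (v k) \<le> B"
    and d: "(\<lambda>k. nsq lborel (\<lambda>z. u k z - v k z)) \<longlonglongrightarrow> 0" and e: "e > 0"
  shows "\<forall>\<^sub>F k in sequentially. nsq \<mu> (u k) \<le> nsq \<mu> (v k) + e"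
proof -
  have C: "C \<ge> 0" using \<mu> by (simp add: carleson_def)
  have B: "B \<ge> 0" using v(2)[of 0] nsq_nonneg order_trans by blast
  define t where "t = e / (2 * (C * B + 1))"
  have CB: "C * B \<ge> 0" using B C by simp
  have t: "t > 0" using e CB by (simp add: t_def add_nonneg_pos)
  have tCB: "t * (C * B) \<le> e / 2" using e CB by (simp add: t_def field_simps)
  have "(\<lambda>k. (1 + 1 / t) * (C * nsq lborel (\<lambda>z. u k z - v k z))) \<longlonglongrightarrow> (1 + 1 / t) * (C * 0)"
    by (intro tendsto_mult_left d)
  then have "\<forall>\<^sub>F k in sequentially. (1 + 1 / t) * (C * nsq lborel (\<lambda>z. u k z - v k z)) < e / 2"
    using e by (intro order_tendstoD(2)) auto
  then show ?thesis
  proof eventually_elim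
    case (elim k)
    have dk: "(\<lambda>z. u k z - v k z) \<in> bergman" by (intro bergman_diff u v)
    have L: "g \<in> bergman \<Longrightarrow> g \<in> L2 \<mu>" "g \<in> bergman \<Longrightarrow> nsq \<mu> g \<le> C * nsq lborel g" for g
      using \<mu> unfolding carleson_def by blast+
    have "nsq \<mu> (u k) = nsq \<mu> (\<lambda>z. v k z + (u k z - v k z))" by simp
    also have "\<dots> \<le> (1 + t) * nsq \<mu> (v k) + (1 + 1 / t) * nsq \<mu> (\<lambda>z. u k z - v k z)"
      by (rule nsq_add_le[OF L(1)[OF v(1)] L(1)[OF dk] t])
    also have "(1 + 1 / t) * nsq \<mu> (\<lambda>z. u k z - v k z) \<le> (1 + 1 / t) * (C * nsq lborel (\<lambda>z. u k z - v k z))"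
      using t by (intro mult_left_mono L(2)[OF dk]) auto
    also have "(1 + t) * nsq \<mu> (v k) \<le> nsq \<mu> (v k) + t * (C * B)"
    proof -
      have "nsq \<mu> (v k) \<le> C * B" using L(2)[OF v(1), of k] mult_left_mono[OF v(2)[of k] C] by linarith
      then have "t * nsq \<mu> (v k) \<le> t * (C * B)" using t by (intro mult_left_mono) auto
      then show ?thesis by (simp add: algebra_simps)
    qed
    finally show ?case using tCB elim by linarith
  qed
qed

text \<open>The recursion adds the adjoint that is applied to \<open>f\<close> first, so that
  statements about all null sequences pass from \<open>f\<close> to \<open>Tad i f\<close> by
  induction.\<close>

fun iter_energy :: "(complex ^ 'n) measure \<Rightarrow> nat \<Rightarrow> 'n::finite cfun \<Rightarrow> real" where
  "iter_energy \<mu> 0 f = nsq \<mu> f"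
| "iter_energy \<mu> (Suc m) f = (\<Sum>i\<in>UNIV. iter_energy \<mu> m (Tad i f))"

text \<open>The Carleson bound treats each word separately; the sum over all words keeps the same
  constant because the column of adjoints is a contraction.\<close>

lemma iter_energy_bounds:
  assumes "carleson \<mu> C" "f \<in> bergman"
  shows "0 \<le> iter_energy \<mu> m f" "iter_energy \<mu> m f \<le> C * nsq lborel f"
proof -
  show "0 \<le> iter_energy \<mu> m f" by (induction m arbitrary: f) (auto simp: sum_nonneg)
  show "iter_energy \<mu> m f \<le> C * nsq lborel f" using assms(2)
  proof (induction m arbitrary: f)
    case 0
    then show ?case using assms(1) by (simp add: carleson_def)
  next
    case (Suc m)
    have "iter_energy \<mu> (Suc m) f \<le> (\<Sum>i\<in>UNIV. C * nsq lborel (Tad i f))"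
      by (simp, intro sum_mono Suc.IH Tad_bergman Suc.prems)
    also have "\<dots> \<le> C * nsq lborel f"
      unfolding sum_distrib_left[symmetric]
      by (intro mult_left_mono sum_nsq_Tad_le Suc.prems) (use assms(1) in \<open>simp add: carleson_def\<close>)
    finally show ?case .
  qed
qed

lemma nsq_row_col_le: "f \<in> bergman \<Longrightarrow> nsq lborel (row_col f) \<le> nsq lborel f"
  unfolding row_col_def
  by (rule order_trans[OF nsq_sum_mult_z_le sum_nsq_Tad_le]) (auto intro: Tad_bergman)

lemma nsq_tendsto_0:
  assumes "\<And>k. nsq M (g k) \<le> b k" "b \<longlonglongrightarrow> 0"
  shows "(\<lambda>k. nsq M (g k)) \<longlonglongrightarrow> 0"
  by (rule tendsto_sandwich[OF _ _ tendsto_const assms(2)]) (simp_all add: assms(1))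

text \<open>On null sequences the defect tends to 0, so \<open>row_col\<close> acts as the identity
  up to a vanishing error. In the convexity step it may thus be dropped from
  \<open>row_col (Tad i f)\<close>, and the double contraction is close to \<open>row_col f\<close>,
  hence to \<open>f\<close>.\<close>

lemma iter_energy_convex_0:
  fixes f :: "nat \<Rightarrow> 'n::finite cfun"
  assumes \<mu>: "carleson \<mu> C" and f: "null_seq f" and e: "e > 0"
  shows "\<forall>\<^sub>F k in sequentially.
    2 * iter_energy \<mu> 1 (f k) \<le> iter_energy \<mu> 2 (f k) + iter_energy \<mu> 0 (f k) + e"
proof -
  define n where "n = real CARD('n)"
  have n: "n > 0" by (simp add: n_def)
  define h where "h i k = Tad i (f k)" for i k
  have hn: "null_seq (h i)" for i unfolding h_def by (rule null_seq_Tad[OF f])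
  note hb = null_seq_bergman[OF hn] and fb = null_seq_bergman[OF f]
  have d: "(\<lambda>k. nsq lborel (\<lambda>z. g k z - row_col (g k) z)) \<longlonglongrightarrow> 0" if "null_seq g" for g :: "nat \<Rightarrow> 'n cfun"
    by (rule nsq_tendsto_0[OF nsq_minus_row_col_le[OF null_seq_bergman[OF that]] null_seq_defect[OF that]])
  have bd: "\<exists>B. \<forall>k. nsq lborel (g k) \<le> B" if "null_seq g" for g :: "nat \<Rightarrow> 'n cfun"
    using that by (simp add: null_seq_def)
  \<comment> \<open>Twice the sum of \<open>n\<close> errors \<open>e / (4 * n)\<close> is
    \<open>e / 2\<close>; the other half is spent on replacing \<open>G k\<close> by
    \<open>f k\<close>.\<close>
  have 1: "\<forall>\<^sub>F k in sequentially. nsq \<mu> (h i k) \<le> nsq \<mu> (row_col (h i k)) + e / (4 * n)" for i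
  proof -
    obtain B where B: "\<And>k. nsq lborel (h i k) \<le> B" using bd[OF hn] by blast
    show ?thesis
    proof (rule carleson_approx[OF \<mu> hb row_col_bergman[OF hb] _ d[OF hn]])
      show "nsq lborel (row_col (h i k)) \<le> B" for k
        using nsq_row_col_le[OF hb, of i k] B[of k] by linarith
    qed (use e n in simp)
  qed
  define G where "G k = (\<lambda>z. \<Sum>i\<in>UNIV. z $ i * row_col (h i k) z)" for k
  have Gb: "G k \<in> bergman" for k unfolding G_def by (intro bergman_sum bergman_mult_z row_col_bergman hb)
  have 2: "\<forall>\<^sub>F k in sequentially. nsq \<mu> (G k) \<le> nsq \<mu> (f k) + e / 2"
  proof -
    obtain B where B: "\<And>k. nsq lborel (f k) \<le> B" using bd[OF f] by blast
    have le: "nsq lborel (\<lambda>z. G k z - f k z) \<le>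
        2 * (\<Sum>i\<in>UNIV. nsq lborel (\<lambda>z. h i k z - row_col (h i k) z)) + 2 * nsq lborel (\<lambda>z. f k z - row_col (f k) z)" for k
    proof -
      have x: "(\<lambda>z. \<Sum>i\<in>UNIV. z $ i * (row_col (h i k) z - h i k z)) \<in> bergman"
        "(\<lambda>z. row_col (f k) z - f k z) \<in> bergman"
        by (intro bergman_sum bergman_mult_z bergman_diff row_col_bergman hb fb)+
      have "(\<lambda>z. G k z - f k z) = (\<lambda>z. (\<Sum>i\<in>UNIV. z $ i * (row_col (h i k) z - h i k z)) + (row_col (f k) z - f k z))"
        by (simp add: G_def row_col_def[of "f k"] h_def right_diff_distrib sum_subtractf)
      then have "nsq lborel (\<lambda>z. G k z - f k z) \<le> (1 + 1) * nsq lborel (\<lambda>z. \<Sum>i\<in>UNIV. z $ i * (row_col (h i k) z - h i k z))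
          + (1 + 1 / 1) * nsq lborel (\<lambda>z. row_col (f k) z - f k z)"
        using nsq_add_le[OF bergman_L2[OF x(1)] bergman_L2[OF x(2)], of 1] by simp
      moreover have "nsq lborel (\<lambda>z. \<Sum>i\<in>UNIV. z $ i * (row_col (h i k) z - h i k z))
          \<le> (\<Sum>i\<in>UNIV. nsq lborel (\<lambda>z. row_col (h i k) z - h i k z))"
        by (rule nsq_sum_mult_z_le) (intro bergman_diff row_col_bergman hb)
      ultimately show ?thesis
        by (simp add: nsq_minus_commute[of lborel "row_col _"])
    qed
    have "(\<lambda>k. 2 * (\<Sum>i\<in>UNIV. nsq lborel (\<lambda>z. h i k z - row_col (h i k) z)) + 2 * nsq lborel (\<lambda>z. f k z - row_col (f k) z))
       \<longlonglongrightarrow> 2 * (\<Sum>i\<in>(UNIV :: 'n set). 0) + 2 * 0"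
      by (intro tendsto_add tendsto_mult_left tendsto_sum d[OF hn] d[OF f])
    then have "(\<lambda>k. nsq lborel (\<lambda>z. G k z - f k z)) \<longlonglongrightarrow> 0"
      by (intro nsq_tendsto_0[OF le]) simp
    from carleson_approx[OF \<mu> Gb fb B this, of "e / 2"] e show ?thesis by simp
  qed
  have "\<forall>\<^sub>F k in sequentially. \<forall>i\<in>UNIV. nsq \<mu> (h i k) \<le> nsq \<mu> (row_col (h i k)) + e / (4 * n)"
    by (rule eventually_ball_finite) (use 1 in auto)
  with 2 show ?thesis
  proof eventually_elim
    case (elim k)
    have "(\<Sum>i\<in>UNIV. nsq \<mu> (h i k)) \<le> (\<Sum>i\<in>UNIV. nsq \<mu> (row_col (h i k)) + e / (4 * n))"
      using elim(2) by (intro sum_mono) auto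
    also have "\<dots> = (\<Sum>i\<in>UNIV. nsq \<mu> (row_col (h i k))) + e / 4"
      using n by (simp add: sum.distrib n_def)
    finally have a: "2 * (\<Sum>i\<in>UNIV. nsq \<mu> (h i k)) \<le> 2 * (\<Sum>i\<in>UNIV. nsq \<mu> (row_col (h i k))) + e / 2" by simp
    have b: "2 * (\<Sum>i\<in>UNIV. nsq \<mu> (row_col (h i k)))
       \<le> (\<Sum>i\<in>UNIV. \<Sum>j\<in>UNIV. nsq \<mu> (Tad j (h i k))) + nsq \<mu> (G k)"
      unfolding G_def h_def by (rule carleson_convex_step[OF \<mu> fb])
    have c: "iter_energy \<mu> 1 (f k) = (\<Sum>i\<in>UNIV. nsq \<mu> (h i k))"
      "iter_energy \<mu> 2 (f k) = (\<Sum>i\<in>UNIV. \<Sum>j\<in>UNIV. nsq \<mu> (Tad j (h i k)))"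
      by (simp_all add: h_def numeral_2_eq_2)
    show ?case using a b elim(1) unfolding c by simp
  qed
qed

lemma iter_energy_convex:
  fixes f :: "nat \<Rightarrow> 'n::finite cfun"
  assumes \<mu>: "carleson \<mu> C" and "null_seq f" and "e > 0"
  shows "\<forall>\<^sub>F k in sequentially.
    2 * iter_energy \<mu> (Suc m) (f k) \<le> iter_energy \<mu> (Suc (Suc m)) (f k) + iter_energy \<mu> m (f k) + e"
  using assms(2,3)
proof (induction m arbitrary: f e)
  case 0
  then show ?case using iter_energy_convex_0[OF \<mu>, of f e] by (simp add: numeral_2_eq_2)
next
  case (Suc m)
  define n where "n = real CARD('n)"
  have n: "n > 0" by (simp add: n_def)
  have "\<forall>\<^sub>F k in sequentially. \<forall>i\<in>UNIV. 2 * iter_energy \<mu> (Suc m) (Tad i (f k))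
      \<le> iter_energy \<mu> (Suc (Suc m)) (Tad i (f k)) + iter_energy \<mu> m (Tad i (f k)) + e / n"
    by (rule eventually_ball_finite) (use Suc.IH[OF null_seq_Tad[OF Suc.prems(1)]] Suc.prems(2) n in auto)
  then show ?case
  proof eventually_elim
    case (elim k)
    have "(\<Sum>i\<in>UNIV. 2 * iter_energy \<mu> (Suc m) (Tad i (f k)))
      \<le> (\<Sum>i\<in>UNIV. iter_energy \<mu> (Suc (Suc m)) (Tad i (f k)) + iter_energy \<mu> m (Tad i (f k)) + e / n)"
      using elim by (intro sum_mono) auto
    also have "\<dots> = iter_energy \<mu> (Suc (Suc (Suc m))) (f k) + iter_energy \<mu> (Suc m) (f k) + e"
      using n by (simp only: sum.distrib iter_energy.simps(2)[of \<mu> "Suc (Suc m)" "f k"]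
          iter_energy.simps(2)[of \<mu> m "f k"]) (simp add: n_def)
    finally show ?case by (simp only: sum_distrib_left iter_energy.simps(2)[of \<mu> "Suc m" "f k"])
  qed
qed

text \<open>The increment at \<open>j\<close> is at least the first one minus \<open>j * e\<close>.
  Bounding each loss by \<open>N * e\<close> and telescoping over \<open>N\<close> steps gives the
  quadratic error.\<close>

lemma almost_convex_increment:
  fixes a :: "nat \<Rightarrow> real"
  assumes "e \<ge> 0" and "\<And>j. j < N \<Longrightarrow> 2 * a (Suc j) \<le> a (Suc (Suc j)) + a j + e"
  shows "real N * (a 1 - a 0) \<le> a N - a 0 + (real N)\<^sup>2 * e"
proof -
  have inc: "a 1 - a 0 \<le> a (Suc j) - a j + real j * e" if "j < N" for j
    using that
  proof (induction j)
    case (Suc j)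
    have "a 1 - a 0 \<le> a (Suc j) - a j + real j * e" using Suc by simp
    also have "\<dots> \<le> a (Suc (Suc j)) - a (Suc j) + real (Suc j) * e"
      using assms(2)[of j] Suc.prems by (simp add: algebra_simps)
    finally show ?case .
  qed simp
  have "real N * (a 1 - a 0) = (\<Sum>j<N. a 1 - a 0)" by simp
  also have "\<dots> \<le> (\<Sum>j<N. a (Suc j) - a j + real N * e)"
  proof (rule sum_mono)
    fix j assume "j \<in> {..<N}"
    then have "j < N" by simp
    moreover from this have "real j * e \<le> real N * e" using assms(1) by (intro mult_right_mono) auto
    ultimately show "a 1 - a 0 \<le> a (Suc j) - a j + real N * e" using inc[of j] by linarith
  qed
  also have "\<dots> = a N - a 0 + (real N)\<^sup>2 * e"
    by (simp add: sum.distrib sum_lessThan_telescope power2_eq_square)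
  finally show ?thesis .
qed

text \<open>A convex sequence that is bounded above cannot increase.\<close>
lemma iter_energy_limit:
  fixes f :: "nat \<Rightarrow> 'n::finite cfun"
  assumes \<mu>: "carleson \<mu> C" and f: "null_seq f" and van: "\<And>k. nsq \<mu> (f k) = 0"
  shows "(\<lambda>k. nsq \<mu> (Tad i (f k))) \<longlonglongrightarrow> 0"
proof (rule LIMSEQ_I)
  fix e :: real assume e: "e > 0"
  obtain B where B: "\<And>k. nsq lborel (f k) \<le> B" using f by (auto simp: null_seq_def)
  have C: "C \<ge> 0" using \<mu> by (simp add: carleson_def)
  \<comment> \<open>Dividing the increment inequality by \<open>N\<close> leaves
    \<open>C * B / N\<close>, below \<open>e / 2\<close> by the choice of \<open>N\<close>, and
    \<open>N * e'\<close>, equal to \<open>e / 4\<close> by the choice of \<open>e'\<close>. With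
    \<open>N\<close> fixed only finitely many convexity inequalities are involved, so one
    \<open>k0\<close> serves them all.\<close>
  obtain N :: nat where "max 0 (2 * (C * B) / e) < real N" using reals_Archimedean2 by blast
  then have N: "real N > 2 * (C * B) / e" "N > 0" by auto
  define e' where "e' = e / (4 * real N)"
  have e': "e' > 0" using e N by (simp add: e'_def)
  have "\<forall>\<^sub>F k in sequentially. \<forall>j\<in>{..<N}. 2 * iter_energy \<mu> (Suc j) (f k)
      \<le> iter_energy \<mu> (Suc (Suc j)) (f k) + iter_energy \<mu> j (f k) + e'"
    by (rule eventually_ball_finite) (use iter_energy_convex[OF \<mu> f e'] in auto)
  then obtain k0 where k0: "\<And>k j. k \<ge> k0 \<Longrightarrow> j < N \<Longrightarrow> 2 * iter_energy \<mu> (Suc j) (f k)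
      \<le> iter_energy \<mu> (Suc (Suc j)) (f k) + iter_energy \<mu> j (f k) + e'"
    unfolding eventually_sequentially by (metis lessThan_iff)
  have "norm (nsq \<mu> (Tad i (f k)) - 0) < e" if k: "k \<ge> k0" for k
  proof -
    have "real N * (iter_energy \<mu> 1 (f k) - iter_energy \<mu> 0 (f k))
      \<le> iter_energy \<mu> N (f k) - iter_energy \<mu> 0 (f k) + (real N)\<^sup>2 * e'"
      by (rule almost_convex_increment[where a = "\<lambda>m. iter_energy \<mu> m (f k)"]) (use k0[OF k] e' in auto)
    then have "real N * iter_energy \<mu> 1 (f k) \<le> iter_energy \<mu> N (f k) + (real N)\<^sup>2 * e'"
      using van by (simp add: right_diff_distrib)
    also have "iter_energy \<mu> N (f k) \<le> C * B"
      using iter_energy_bounds(2)[OF \<mu> null_seq_bergman[OF f], of N k] mult_left_mono[OF B[of k] C] by linarith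
    also have "(real N)\<^sup>2 * e' = real N * (e / 4)" using N by (simp add: e'_def power2_eq_square)
    also have "C * B < real N * (e / 2)" using N e by (simp add: field_simps)
    finally have "real N * iter_energy \<mu> 1 (f k) < real N * (3 * e / 4)" by (simp add: algebra_simps)
    then have "iter_energy \<mu> 1 (f k) < 3 * e / 4" using N by (simp add: mult_less_cancel_left_pos)
    moreover have "nsq \<mu> (Tad i (f k)) \<le> iter_energy \<mu> 1 (f k)"
      using member_le_sum[of i UNIV "\<lambda>i. nsq \<mu> (Tad i (f k))"] by simp
    ultimately show ?thesis using e by simp
  qed
  then show "\<exists>N. \<forall>k\<ge>N. norm (nsq \<mu> (Tad i (f k)) - 0) < e" by blast
qed

section \<open>Essential normality\<close>

lemma bvol_pos: "bvol TYPE('n::finite) > 0"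
  unfolding bvol_def unit_ball_def using content_ball_pos[of 1 "0 :: complex ^ 'n"] by simp

lemma binner_eq:
  fixes f g :: "'n::finite cfun"
  assumes "f \<in> bergman"
  shows "binner f g = ip lborel f g / complex_of_real (bvol TYPE('n))"
proof -
  have "indicator unit_ball z *\<^sub>R (f z * cnj (g z)) = f z * cnj (g z)" for z
    using bergman_zero[OF assms, of z] by (auto simp: indicator_def unit_ball_def)
  then show ?thesis by (simp add: binner_def ip_def set_lebesgue_integral_def)
qed

lemma bnorm_eq:
  fixes f :: "'n::finite cfun"
  assumes "f \<in> bergman"
  shows "bnorm f = sqrt (nsq lborel f / bvol TYPE('n))"
proof -
  have "indicator unit_ball z *\<^sub>R (cmod (f z))\<^sup>2 = (cmod (f z))\<^sup>2" for z
    using bergman_zero[OF assms, of z] by (auto simp: indicator_def unit_ball_def)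
  then show ?thesis unfolding bnorm_def nsq_def set_lebesgue_integral_def by (simp only:)
qed

lemma bnorm_sq:
  fixes f :: "'n::finite cfun"
  assumes "f \<in> bergman"
  shows "(bnorm f)\<^sup>2 = nsq lborel f / bvol TYPE('n)"
  using bvol_pos[where 'n = 'n] by (simp add: bnorm_eq[OF assms])

lemma adjP_eq_proj:
  fixes f :: "'n::finite cfun"
  assumes f: "f \<in> bergman"
  shows "adjP (bsub M) (mult_z j) f = proj M (\<lambda>z. cnj (z $ j) * f z)"
  unfolding adjP_def
proof (rule the_equality)
  note L = mult_z_L2(3)[OF f, of j]
  have eq: "binner (mult_z j g) f = binner g h \<longleftrightarrow> ip lborel g h = ip lborel g (\<lambda>z. cnj (z $ j) * f z)"
    if "g \<in> bsub M" for g h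
    using bergman_mult_z[OF bsub_bergman[OF that], of j] bsub_bergman[OF that] bvol_pos[where 'n = 'n]
    by (auto simp: binner_eq mult_z_def ip_mult_cnj)
  show "proj M (\<lambda>z. cnj (z $ j) * f z) \<in> bsub M \<and>
    (\<forall>g\<in>bsub M. binner (mult_z j g) f = binner g (proj M (\<lambda>z. cnj (z $ j) * f z)))"
    using proj_in[OF L, of M] ip_proj[OF L, of _ M] by (simp add: eq)
  fix h assume "h \<in> bsub M \<and> (\<forall>g\<in>bsub M. binner (mult_z j g) f = binner g h)"
  then show "h = proj M (\<lambda>z. cnj (z $ j) * f z)"
    by (intro proj_unique[OF L, symmetric]) (auto simp: eq)
qed

section \<open>Commutators on the submodule\<close>

lemma proj_diff:
  assumes "\<phi> \<in> L2 lborel" "\<psi> \<in> L2 lborel"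
  shows "proj M (\<lambda>z. \<phi> z - \<psi> z) = (\<lambda>z. proj M \<phi> z - proj M \<psi> z)"
proof (rule proj_unique)
  show "(\<lambda>z. \<phi> z - \<psi> z) \<in> L2 lborel" by (rule L2_minus[OF assms])
  show "(\<lambda>z. proj M \<phi> z - proj M \<psi> z) \<in> bsub M" by (intro bsub_diff proj_in assms)
  fix f assume f: "f \<in> bsub M"
  have "ip lborel f (\<lambda>z. proj M \<phi> z - proj M \<psi> z) = ip lborel f (proj M \<phi>) - ip lborel f (proj M \<psi>)"
    by (rule ip_diff_right[OF bsub_L2[OF f] bsub_L2[OF proj_in[OF assms(1)]] bsub_L2[OF proj_in[OF assms(2)]]])
  also have "\<dots> = ip lborel f (\<lambda>z. \<phi> z - \<psi> z)"
    using f assms by (simp add: ip_proj ip_diff_right bsub_L2)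
  finally show "ip lborel f (\<lambda>z. proj M \<phi> z - proj M \<psi> z) = ip lborel f (\<lambda>z. \<phi> z - \<psi> z)" .
qed

text \<open>The component of \<open>T\<^sub>j\<^sup>* f\<close> in \<open>Q\<close>.\<close>
definition off_proj :: "(complex ^ 'n) set \<Rightarrow> 'n \<Rightarrow> 'n::finite cfun \<Rightarrow> 'n cfun" where
  "off_proj M j f = (\<lambda>z. Tad j f z - proj M (\<lambda>z. cnj (z $ j) * f z) z)"

lemma off_proj:
  assumes "f \<in> bergman"
  shows off_proj_bergman: "off_proj M j f \<in> bergman"
    and ip_off_proj: "g \<in> bsub M \<Longrightarrow> ip lborel g (off_proj M j f) = 0"
    and off_proj_eq: "w \<in> M \<Longrightarrow> off_proj M j f w = Tad j f w"
proof -
  note L = mult_z_L2(3)[OF assms, of j]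
  have p: "proj M (\<lambda>z. cnj (z $ j) * f z) \<in> bsub M" by (rule proj_in[OF L])
  show "off_proj M j f \<in> bergman" unfolding off_proj_def
    by (intro bergman_diff Tad_bergman assms bsub_bergman[OF p])
  show "off_proj M j f w = Tad j f w" if "w \<in> M" using p that by (simp add: off_proj_def bsub_def)
  assume g: "g \<in> bsub M"
  have "ip lborel g (off_proj M j f) = ip lborel g (Tad j f) - ip lborel g (proj M (\<lambda>z. cnj (z $ j) * f z))"
    unfolding off_proj_def
    by (rule ip_diff_right[OF bsub_L2[OF g] bergman_L2[OF Tad_bergman[OF assms]] bsub_L2[OF p]])
  also have "\<dots> = 0"
    using ip_Tad[OF assms bsub_bergman[OF g]] ip_proj[OF L g] by (simp add: ip_mult_cnj)
  finally show "ip lborel g (off_proj M j f) = 0" .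
qed

text \<open>The commutator of \<open>S\<^sub>i\<close> with the adjoint of \<open>S\<^sub>j\<close>,
  that adjoint being written as a compressed multiplication by \<open>cnj (z $ j)\<close>.\<close>

definition comm_op :: "(complex ^ 'n) set \<Rightarrow> 'n \<Rightarrow> 'n \<Rightarrow> 'n::finite cfun \<Rightarrow> 'n cfun" where
  "comm_op M i j f = (\<lambda>z. z $ i * proj M (\<lambda>z. cnj (z $ j) * f z) z - proj M (\<lambda>z. cnj (z $ j) * (z $ i * f z)) z)"

lemma nsq_add_le2:
  assumes "f \<in> L2 M" "g \<in> L2 M"
  shows "nsq M (\<lambda>x. f x + g x) \<le> 2 * nsq M f + 2 * nsq M g"
  using nsq_add_le[OF assms, of 1] by simp

text \<open>The projection of \<open>cnj (z $ j) * h z\<close> to \<open>P\<close> equals that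
  function minus its Hankel part \<open>H h\<close> minus \<open>off_proj M j h\<close>. For
  \<open>h = f\<close>, multiplied by \<open>z $ i\<close>, and for \<open>h = g\<close> the leading
  terms coincide and cancel, so only the four corrections remain; the factor 4 comes from splitting
  twice into two summands.\<close>

lemma nsq_comm_op_le:
  fixes f :: "'n::finite cfun" and i :: 'n
  assumes f: "f \<in> bergman"
  defines "g \<equiv> \<lambda>z. z $ i * f z"
  shows "nsq lborel (comm_op M i j f) \<le>
    4 * (nsq lborel (off_proj M j g) + nsq lborel (off_proj M j f) + defect g + defect f)"
proof -
  have g: "g \<in> bergman" unfolding g_def by (rule bergman_mult_z[OF f])
  define H where "H h = (\<lambda>z. cnj (z $ j) * h z - Tad j h z)" for h :: "'n cfun"
  have HL: "H h \<in> L2 lborel" if "h \<in> bergman" for h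
    unfolding H_def by (rule L2_minus[OF mult_z_L2(3)[OF that] bergman_L2[OF Tad_bergman[OF that]]])
  have Hd: "nsq lborel (H h) \<le> defect h" if "h \<in> bergman" for h
  proof -
    have "nsq lborel (H h) \<le> (\<Sum>j\<in>UNIV. nsq lborel (\<lambda>z. cnj (z $ j) * h z - Tad j h z))"
      unfolding H_def by (rule member_le_sum[where f = "\<lambda>j. nsq lborel (\<lambda>z. cnj (z $ j) * h z - Tad j h z)"]) auto
    then show ?thesis using sum_nsq_mult_cnj_minus_Tad_le[OF that] by linarith
  qed
  have Hz: "H h z = 0" if "h \<in> bergman" "norm z \<ge> 1" for h z
    using bergman_zero[OF that] bergman_zero[OF Tad_bergman[OF that(1)] that(2)] by (simp add: H_def)
  define X where "X = (\<lambda>z. (- z $ i) * H f z)"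
  define Y where "Y = (\<lambda>z. (-1) * (z $ i * off_proj M j f z))"
  have zH: "X \<in> L2 lborel" "nsq lborel X \<le> nsq lborel (H f)"
  proof -
    have "cmod ((- z $ i) * H f z) \<le> cmod (H f z)" for z
    proof (cases "norm z < 1")
      case True
      then have "cmod (z $ i) \<le> 1" using Finite_Cartesian_Product.norm_nth_le[of z i] by linarith
      then show ?thesis by (simp add: norm_mult mult_left_le_one_le)
    qed (simp add: Hz[OF f])
    then show "X \<in> L2 lborel" "nsq lborel X \<le> nsq lborel (H f)"
      unfolding X_def by (intro L2_mult_bounded[OF HL[OF f]]; measurable)+
  qed
  note o = off_proj_bergman
  have zo: "Y \<in> L2 lborel" "nsq lborel Y \<le> nsq lborel (off_proj M j f)"
    unfolding Y_def
    using mult_z_L2(2)[OF o[OF f, of M j], of i]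
    by (auto simp only: nsq_cmult norm_minus_cancel norm_one power_one mult_1
        intro!: bergman_L2 bergman_cmult bergman_mult_z o f)
  have "comm_op M i j f = (\<lambda>z. (off_proj M j g z + Y z) + (H g z + X z))"
    by (simp add: comm_op_def off_proj_def H_def g_def X_def Y_def fun_eq_iff algebra_simps)
  then have "nsq lborel (comm_op M i j f) = nsq lborel (\<lambda>z. (off_proj M j g z + Y z) + (H g z + X z))" by simp
  also have "\<dots> \<le> 2 * nsq lborel (\<lambda>z. off_proj M j g z + Y z) + 2 * nsq lborel (\<lambda>z. H g z + X z)"
    by (intro nsq_add_le2 L2_add bergman_L2[OF o[OF g]] zo HL[OF g] zH)
  also have "\<dots> \<le> 2 * (2 * nsq lborel (off_proj M j g) + 2 * nsq lborel Y) + 2 * (2 * nsq lborel (H g) + 2 * nsq lborel X)"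
    by (intro add_mono mult_left_mono nsq_add_le2 bergman_L2[OF o[OF g]] zo(1) HL[OF g] zH(1)) simp_all
  also have "\<dots> \<le> 4 * (nsq lborel (off_proj M j g) + nsq lborel (off_proj M j f) + defect g + defect f)"
  proof -
    have "2 * (2 * a + 2 * y) + 2 * (2 * h + 2 * x) \<le> 4 * (a + b + dg + df)"
      if "y \<le> b" "x \<le> hf" "hf \<le> df" "h \<le> dg" for a b x y h hf df dg :: real
      using that by simp
    from this[OF zo(2) zH(2) Hd[OF f] Hd[OF g]] show ?thesis .
  qed
  finally show ?thesis .
qed

theorem mainTheorem1:
  fixes M :: "(complex ^ 'n::finite) set"
    and mu :: "(complex ^ 'n) measure"
    and P Q :: "'n cfun set"
    and c C :: real
  assumes "M \<subseteq> unit_ball"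
    and "P = {f \<in> bergman. \<forall>w\<in>M. f w = 0}"
    and "Q = {g \<in> bergman. \<forall>f\<in>P. binner f g = 0}"
    and "sets mu = sets (restrict_space borel M)"
    and "finite_measure mu"
    and "regular_on M mu"
    and "c > 0" and "C > 0"
    and "\<forall>f\<in>Q. ennreal (c * (bnorm f)\<^sup>2) \<le> (\<integral>\<^sup>+ w. ennreal ((cmod (f w))\<^sup>2) \<partial>mu)
              \<and> (\<integral>\<^sup>+ w. ennreal ((cmod (f w))\<^sup>2) \<partial>mu) \<le> ennreal (C * (bnorm f)\<^sup>2)"
  shows "essentially_normal P"
proof -
  define v where "v = bvol TYPE('n)"
  have v: "v > 0" unfolding v_def by (rule bvol_pos)
  have P: "P = bsub M" by (simp add: assms(2) bsub_def)
  have space: "space mu = M"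
    using sets_eq_imp_space_eq[OF assms(4)] by (simp add: space_restrict_space)
  have QI: "g \<in> Q" if "g \<in> bergman" "\<And>f. f \<in> bsub M \<Longrightarrow> ip lborel f g = 0" for g
    using that by (simp add: assms(3) P binner_eq bsub_bergman)
  have meas: "f \<in> borel_measurable mu" if "f \<in> bergman" for f :: "'n cfun"
    using measurable_restrict_space1[OF bergman_measurable[OF that], of M] measurable_cong_sets[OF assms(4) refl]
    by blast
  \<comment> \<open>The hypothesis is stated with the normalised norm, whereas
    \<open>nsq lborel\<close> is not normalised; hence the division by \<open>v\<close>. Finiteness
    of the upper bound gives membership in \<open>L2 mu\<close>.\<close>
  have Qmu: "q \<in> L2 mu" "c / v * nsq lborel q \<le> nsq mu q" "nsq mu q \<le> C / v * nsq lborel q" if "q \<in> Q" for q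
  proof -
    have q: "q \<in> bergman" using that by (simp add: assms(3))
    have le: "ennreal (c * (bnorm q)\<^sup>2) \<le> (\<integral>\<^sup>+ w. ennreal ((cmod (q w))\<^sup>2) \<partial>mu)"
      "(\<integral>\<^sup>+ w. ennreal ((cmod (q w))\<^sup>2) \<partial>mu) \<le> ennreal (C * (bnorm q)\<^sup>2)"
      using assms(9) that by auto
    have "(\<integral>\<^sup>+ w. ennreal ((cmod (q w))\<^sup>2) \<partial>mu) < \<infinity>" using le(2) by (rule le_less_trans) simp
    then show L: "q \<in> L2 mu" using meas[OF q] by (simp add: L2_def integrable_iff_bounded)
    have eq: "(\<integral>\<^sup>+ w. ennreal ((cmod (q w))\<^sup>2) \<partial>mu) = ennreal (nsq mu q)"
      unfolding nsq_def by (rule nn_integral_eq_integral[OF L2_integrable[OF L]]) simp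
    have "c * (bnorm q)\<^sup>2 \<le> nsq mu q" using le(1) unfolding eq by simp
    then show "c / v * nsq lborel q \<le> nsq mu q" by (simp add: bnorm_sq[OF q] v_def)
    have "nsq mu q \<le> C * (bnorm q)\<^sup>2" using le(2) assms(8) unfolding eq by simp
    then show "nsq mu q \<le> C / v * nsq lborel q" by (simp add: bnorm_sq[OF q] v_def)
  qed
  have nsq_mu_cong: "nsq mu f = nsq mu g" if "\<And>w. w \<in> M \<Longrightarrow> f w = g w" for f g :: "'n cfun"
    unfolding nsq_def by (rule Bochner_Integration.integral_cong) (auto simp: space that)
  have carl: "carleson mu (C / v)"
    unfolding carleson_def
  proof (intro conjI ballI)
    show "0 \<le> C / v" using v assms(8) by simp
    show "space mu \<subseteq> ball 0 1" using assms(1) by (simp add: space unit_ball_def)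
    fix f :: "'n cfun" assume f: "f \<in> bergman"
    note L = bergman_L2[OF f]
    define q where "q = (\<lambda>z. f z - proj M f z)"
    have p: "proj M f \<in> bsub M" by (rule proj_in[OF L])
    have qQ: "q \<in> Q"
    proof (rule QI)
      show "q \<in> bergman" unfolding q_def by (intro bergman_diff f bsub_bergman[OF p])
      show "ip lborel g q = 0" if "g \<in> bsub M" for g
        unfolding q_def using ip_diff_right[OF bsub_L2[OF that] L bsub_L2[OF p]] ip_proj[OF L that] by simp
    qed
    have eq: "f w = q w" if "w \<in> M" for w using p that by (simp add: q_def bsub_def)
    have "integrable mu (\<lambda>w. (cmod (f w))\<^sup>2) \<longleftrightarrow> integrable mu (\<lambda>w. (cmod (q w))\<^sup>2)"
      by (rule Bochner_Integration.integrable_cong) (auto simp: space eq)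
    then show "f \<in> L2 mu" using L2_integrable[OF Qmu(1)[OF qQ]] meas[OF f] by (simp add: L2_def)
    have "nsq mu f = nsq mu q" by (rule nsq_mu_cong[OF eq])
    also have "\<dots> \<le> C / v * nsq lborel q" by (rule Qmu(3)[OF qQ])
    also have "\<dots> \<le> C / v * nsq lborel f"
      using nsq_proj[OF L, of M] v assms(8) by (intro mult_left_mono) (auto simp: q_def)
    finally show "nsq mu f \<le> C / v * nsq lborel f" .
  qed
  have off: "(\<lambda>k. nsq lborel (off_proj M j (f k))) \<longlonglongrightarrow> 0" if f: "null_seq f" "\<And>k. f k \<in> bsub M" for f j
  proof (rule nsq_tendsto_0)
    note fb = null_seq_bergman[OF f(1)]
    have "nsq mu (f k) = nsq mu (\<lambda>w. 0)" for k
      by (rule nsq_mu_cong) (use f(2)[of k] in \<open>simp add: bsub_def\<close>)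
    then have "(\<lambda>k. nsq mu (Tad j (f k))) \<longlonglongrightarrow> 0"
      by (intro iter_energy_limit[OF carl f(1)]) (simp add: nsq_def)
    then have "(\<lambda>k. v / c * nsq mu (Tad j (f k))) \<longlonglongrightarrow> v / c * 0" by (rule tendsto_mult_left)
    then show "(\<lambda>k. v / c * nsq mu (Tad j (f k))) \<longlonglongrightarrow> 0" by simp
    fix k
    have "c / v * nsq lborel (off_proj M j (f k)) \<le> nsq mu (off_proj M j (f k))"
      by (rule Qmu(2), rule QI) (simp_all add: off_proj_bergman ip_off_proj fb)
    also have "\<dots> = nsq mu (Tad j (f k))"
      by (rule nsq_mu_cong) (rule off_proj_eq[OF fb])
    finally show "nsq lborel (off_proj M j (f k)) \<le> v / c * nsq mu (Tad j (f k))"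
      using v assms(7) by (simp add: field_simps)
  qed
  have comm: "(\<lambda>k. nsq lborel (comm_op M i j (f k))) \<longlonglongrightarrow> 0" if f: "null_seq f" "\<And>k. f k \<in> bsub M" for f i j
  proof (rule nsq_tendsto_0[OF nsq_comm_op_le[OF null_seq_bergman[OF f(1)]]])
    note g = null_seq_mult_z[OF f(1), of i]
    have "(\<lambda>k. 4 * (nsq lborel (off_proj M j (\<lambda>z. z $ i * f k z)) + nsq lborel (off_proj M j (f k))
        + defect (\<lambda>z. z $ i * f k z) + defect (f k))) \<longlonglongrightarrow> 4 * (0 + 0 + 0 + 0)"
      by (intro tendsto_mult_left tendsto_add off[OF f] off[OF g] null_seq_defect[OF f(1)] null_seq_defect[OF g]
          bsub_mult_z f(2))
    then show "(\<lambda>k. 4 * (nsq lborel (off_proj M j (\<lambda>z. z $ i * f k z)) + nsq lborel (off_proj M j (f k))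
        + defect (\<lambda>z. z $ i * f k z) + defect (f k))) \<longlonglongrightarrow> 0" by simp
  qed
  show ?thesis
    unfolding essentially_normal_def compact_op_def
  proof (intro allI impI)
    fix i j :: 'n and u :: "nat \<Rightarrow> 'n cfun" and B :: real
    assume u: "\<forall>k. u k \<in> P \<and> bnorm (u k) \<le> B"
    let ?K = "\<lambda>f. mult_z i (adjP P (mult_z j) f) - adjP P (mult_z j) (mult_z i f)"
    have K: "?K f = comm_op M i j f" if "f \<in> bsub M" for f
      using adjP_eq_proj[OF bsub_bergman[OF that], of M j]
        adjP_eq_proj[OF bsub_bergman[OF bsub_mult_z[OF that]], of M j i]
      by (simp add: P comm_op_def mult_z_def fun_eq_iff)
    have uM: "u k \<in> bsub M" for k using u by (simp add: P)
    have bnd: "nsq lborel (u k) \<le> v * B\<^sup>2" for k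
    proof -
      have "0 \<le> bnorm (u k)" using v by (simp add: bnorm_eq[OF bsub_bergman[OF uM]] v_def)
      then have "(bnorm (u k))\<^sup>2 \<le> B\<^sup>2" using u by (intro power_mono) auto
      then show ?thesis using v by (simp add: bnorm_sq[OF bsub_bergman[OF uM]] v_def field_simps)
    qed
    obtain g r where r: "strict_mono (r :: nat \<Rightarrow> nat)" and g: "g \<in> bergman" "loc_lim (u \<circ> r) g"
      "\<forall>z. (\<lambda>k. u (r k) z) \<longlonglongrightarrow> g z"
      using bergman_Montel[of u, OF bsub_bergman[OF uM] bnd] by auto
    have "g w = 0" if "w \<in> M" for w
    proof -
      have "u (r k) w = 0" for k using uM[of "r k"] that by (simp add: bsub_def)
      then show ?thesis using g(3)[rule_format, of w] by (simp add: LIMSEQ_const_iff)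
    qed
    then have gM: "g \<in> bsub M" using g(1) by (simp add: bsub_def)
    \<comment> \<open>Montel's theorem gives only locally uniform convergence of the subsequence.
      Subtracting the limit produces a null sequence in \<open>P\<close>, and by linearity of the
      commutator its images converge in norm to \<open>comm_op M i j g\<close>.\<close>
    define f where "f k = (\<lambda>z. u (r k) z - g z)" for k
    have fM: "f k \<in> bsub M" for k unfolding f_def by (rule bsub_diff[OF uM gM])
    have "null_seq f"
      unfolding null_seq_def
    proof (intro conjI allI)
      show "f k \<in> bergman" for k by (rule bsub_bergman[OF fM])
      have "nsq lborel (f k) \<le> 2 * (v * B\<^sup>2) + 2 * nsq lborel g" for k
      proof -
        have "nsq lborel (f k) = nsq lborel (\<lambda>z. u (r k) z + (-1) * g z)" by (simp add: f_def)
        also have "\<dots> \<le> 2 * nsq lborel (u (r k)) + 2 * nsq lborel (\<lambda>z. (-1) * g z)"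
          by (rule nsq_add_le2[OF bsub_L2[OF uM] L2_cmult[OF bsub_L2[OF gM]]])
        finally show ?thesis using bnd[of "r k"] by (simp add: nsq_cmult[of lborel "-1", simplified])
      qed
      then show "\<exists>B. \<forall>k. nsq lborel (f k) \<le> B" by blast
      show "loc_lim f (\<lambda>z. 0)"
        using g(2) unfolding loc_lim_def uniform_limit_iff by (simp add: f_def dist_norm)
    qed
    have "?K (u (r k)) - comm_op M i j g = comm_op M i j (f k)" for k
    proof -
      have pd: "proj M (\<lambda>z. cnj (z $ j) * h1 z - cnj (z $ j) * h2 z)
        = (\<lambda>z. proj M (\<lambda>z. cnj (z $ j) * h1 z) z - proj M (\<lambda>z. cnj (z $ j) * h2 z) z)"
        if "h1 \<in> bergman" "h2 \<in> bergman" for h1 h2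
        by (rule proj_diff[OF mult_z_L2(3)[OF that(1)] mult_z_L2(3)[OF that(2)]])
      note b = bsub_bergman[OF uM[of "r k"]] g(1)
      show ?thesis
        unfolding K[OF uM] using pd[OF b] pd[OF bergman_mult_z[OF b(1)] bergman_mult_z[OF b(2)], of i i]
        by (simp add: comm_op_def f_def right_diff_distrib fun_eq_iff)
    qed
    moreover have "(\<lambda>k. bnorm (comm_op M i j (f k))) \<longlonglongrightarrow> 0"
    proof -
      have cM: "comm_op M i j h \<in> bsub M" if "h \<in> bsub M" for h
        unfolding comm_op_def using bsub_bergman[OF that]
        by (intro bsub_diff bsub_mult_z proj_in mult_z_L2(3) bergman_mult_z)
      have "bnorm (comm_op M i j (f k)) = sqrt (nsq lborel (comm_op M i j (f k)) / v)" for k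
        unfolding v_def by (rule bnorm_eq[OF bsub_bergman[OF cM[OF fM]]])
      moreover have "(\<lambda>k. sqrt (nsq lborel (comm_op M i j (f k)) / v)) \<longlonglongrightarrow> sqrt (0 / v)"
        using v by (intro tendsto_real_sqrt tendsto_divide tendsto_const comm[OF \<open>null_seq f\<close> fM]) simp
      ultimately show ?thesis by simp
    qed
    moreover have "comm_op M i j g \<in> P"
      unfolding comm_op_def P
      by (intro bsub_diff bsub_mult_z proj_in mult_z_L2(3) bergman_mult_z g(1))
    ultimately show "\<exists>(r::nat\<Rightarrow>nat) g. strict_mono r \<and> g \<in> P \<and> (\<lambda>k. bnorm (?K (u (r k)) - g)) \<longlonglongrightarrow> 0"
      using r by (intro exI[of _ r] exI[of _ "comm_op M i j g"]) simp
  qed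
qed

end
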